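(* Let $F_0:S^1\to\mathbb{R}^2$ be a smooth strictly convex closed plane curve with unit inner normal $\vec N_0$, let $f\in C^\infty(S^1)$, and let $c$ be a bounded continuous function on $[0,T)$. Consider the initial value problem $$\frac{\partial^2F}{\partial t^2}(u,t)=k(u,t)\vec N(u,t)-\nabla\rho(u,t)+c(t)F(u,t),\qquad F(u,0)=F_0(u),\qquad \frac{\partial F}{\partial t}(u,0)=f(u)\vec N_0(u),$$ where $$\nabla\rho=\left[\left(\frac{\partial^2F}{\partial s\,\partial t},\frac{\partial F}{\partial t}\right)+c(t)\,(F,\vec T)\right]\vec T .$$ Then there exist a constant $T_1>0$ and a family of strictly convex closed curves $F(\cdot,t)$, $t\in[0,T_1)$, which solves this initial value problem on $S^1\times[0,T_1)$, and this solution is unique.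
   Context: $(\cdot,\cdot)$ is the standard Euclidean inner product on $\mathbb{R}^2$. For a family of closed plane curves $F:S^1\times[0,T)\to\mathbb{R}^2$, $k(u,t)$, $\vec N(u,t)$, $\vec T(u,t)$ denote the curvature, unit inner normal vector and unit tangent vector of the curve $F(\cdot,t)$, and $s=s(\cdot,t)$ its arc-length parameter, so that $\frac{\partial}{\partial s}=\frac{1}{v}\frac{\partial}{\partial u}$ with $v=\left|\frac{\partial F}{\partial u}\right|$, $\vec T=\frac{\partial F}{\partial s}$, $\frac{\partial \vec T}{\partial s}=k\vec N$, $\frac{\partial\vec N}{\partial s}=-k\vec T$; $\frac{\partial^2F}{\partial s\,\partial t}$ means $\frac{\partial}{\partial s}\left(\frac{\partial F}{\partial t}\right)$. *)

theory Defs
  imports "HOL-Analysis.Analysis" "HOL-Library.Periodic_Fun" "HOL-Library.Extended_Real"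
begin

text \<open>
  The circle is \<open>\<real> / 2\<pi>\<int>\<close>: a function on it is a \<open>2\<pi>\<close>-periodic function of a real variable.
\<close>

definition smooth :: "(real \<Rightarrow> 'a::real_normed_vector) \<Rightarrow> bool" where
  "smooth g \<longleftrightarrow> (\<forall>n u. ((\<lambda>h x. vector_derivative h (at x)) ^^ n) g differentiable (at u))"

definition smooth_on_circle :: "(real \<Rightarrow> 'a::real_normed_vector) \<Rightarrow> bool" where
  "smooth_on_circle g \<longleftrightarrow> smooth g \<and> periodic_fun_simple g (2 * pi)"

definition regular :: "(real \<Rightarrow> real^2) \<Rightarrow> bool" where
  "regular \<gamma> \<longleftrightarrow> (\<forall>u. \<gamma> differentiable (at u) \<and> vector_derivative \<gamma> (at u) \<noteq> 0)"

definition speed :: "(real \<Rightarrow> real^2) \<Rightarrow> real \<Rightarrow> real" where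
  "speed \<gamma> u = norm (vector_derivative \<gamma> (at u))"

definition arc_deriv ::
    "(real \<Rightarrow> real^2) \<Rightarrow> (real \<Rightarrow> 'a::real_normed_vector) \<Rightarrow> real \<Rightarrow> 'a" where
  "arc_deriv \<gamma> g u = (1 / speed \<gamma> u) *\<^sub>R vector_derivative g (at u)"

definition unit_tangent :: "(real \<Rightarrow> real^2) \<Rightarrow> real \<Rightarrow> real^2" where
  "unit_tangent \<gamma> = arc_deriv \<gamma> \<gamma>"

definition rot90 :: "real^2 \<Rightarrow> real^2" where
  "rot90 x = vector [- x $ 2, x $ 1]"

text \<open>
  Of the two unit normals, the one pointing into the region enclosed by the curve, whichever way
  the curve is traversed. For a curve that is not simple this is merely one of the two unit
  normals; the product of curvature and normal below does not depend on the choice.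
\<close>

definition inner_normal :: "(real \<Rightarrow> real^2) \<Rightarrow> real \<Rightarrow> real^2" where
  "inner_normal \<gamma> u =
     (let n = rot90 (unit_tangent \<gamma> u) in
      if \<forall>\<^sub>F \<epsilon> in at_right (0::real). \<gamma> u + \<epsilon> *\<^sub>R n \<in> inside (range \<gamma>) then n else - n)"

text \<open>
  The scalar \<open>k\<close> in \<open>\<partial>T/\<partial>s = k N\<close>; as \<open>\<partial>T/\<partial>s\<close> is orthogonal to \<open>T\<close>, it is recovered by pairing
  with \<open>N\<close>.
\<close>

definition curvature :: "(real \<Rightarrow> real^2) \<Rightarrow> real \<Rightarrow> real" where
  "curvature \<gamma> u = arc_deriv \<gamma> (unit_tangent \<gamma>) u \<bullet> inner_normal \<gamma> u"

definition strictly_convex_closed_curve :: "(real \<Rightarrow> real^2) \<Rightarrow> bool" where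
  "strictly_convex_closed_curve \<gamma> \<longleftrightarrow>
     smooth_on_circle \<gamma> \<and> regular \<gamma> \<and> inj_on \<gamma> {0..<2 * pi} \<and> (\<forall>u. curvature \<gamma> u > 0)"

text \<open>
  Families of curves are functions \<open>F u t\<close>, with \<open>t\<close> ranging over an interval \<open>I\<close>; time derivatives
  are taken within \<open>I\<close>, hence are one-sided at an initial time belonging to \<open>I\<close>.
\<close>

definition deriv_u :: "(real \<Rightarrow> real \<Rightarrow> real^2) \<Rightarrow> real \<Rightarrow> real \<Rightarrow> real^2" where
  "deriv_u F u t = vector_derivative (\<lambda>x. F x t) (at u)"

definition deriv_t :: "real set \<Rightarrow> (real \<Rightarrow> real \<Rightarrow> real^2) \<Rightarrow> real \<Rightarrow> real \<Rightarrow> real^2" where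
  "deriv_t I F u t = vector_derivative (\<lambda>\<tau>. F u \<tau>) (at t within I)"

definition C1_family :: "real set \<Rightarrow> (real \<Rightarrow> real \<Rightarrow> real^2) \<Rightarrow> bool" where
  "C1_family I F \<longleftrightarrow>
     (\<forall>u. \<forall>t\<in>I. (\<lambda>x. F x t) differentiable (at u) \<and> (\<lambda>\<tau>. F u \<tau>) differentiable (at t within I)) \<and>
     continuous_on (UNIV \<times> I) (\<lambda>(u, t). deriv_u F u t) \<and>
     continuous_on (UNIV \<times> I) (\<lambda>(u, t). deriv_t I F u t)"

definition C2_family :: "real set \<Rightarrow> (real \<Rightarrow> real \<Rightarrow> real^2) \<Rightarrow> bool" where
  "C2_family I F \<longleftrightarrow> C1_family I F \<and> C1_family I (deriv_u F) \<and> C1_family I (deriv_t I F)"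

definition grad_rho ::
    "real set \<Rightarrow> (real \<Rightarrow> real) \<Rightarrow> (real \<Rightarrow> real \<Rightarrow> real^2) \<Rightarrow> real \<Rightarrow> real \<Rightarrow> real^2" where
  "grad_rho I c F u t =
     (let \<gamma> = (\<lambda>x. F x t); F_t = (\<lambda>x. deriv_t I F x t) in
      (arc_deriv \<gamma> F_t u \<bullet> F_t u + c t * (F u t \<bullet> unit_tangent \<gamma> u)) *\<^sub>R unit_tangent \<gamma> u)"

text \<open>
  Classical solutions on \<open>[0, T\<^sub>1)\<close> among all families of regular closed curves, convex or not.
  They are only required to be twice continuously differentiable: as \<open>c\<close> is merely continuous,
  smoothness in \<open>t\<close> cannot be expected.
\<close>

definition solves_ivp ::
    "(real \<Rightarrow> real) \<Rightarrow> (real \<Rightarrow> real^2) \<Rightarrow> (real \<Rightarrow> real) \<Rightarrow> real \<Rightarrow> (real \<Rightarrow> real \<Rightarrow> real^2) \<Rightarrow> bool"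
  where
  "solves_ivp c F\<^sub>0 f T\<^sub>1 F \<longleftrightarrow>
     (let I = {0..<T\<^sub>1} in
      C2_family I F \<and>
      (\<forall>t\<in>I. periodic_fun_simple (\<lambda>u. F u t) (2 * pi) \<and> regular (\<lambda>u. F u t)) \<and>
      (\<forall>u. \<forall>t\<in>I. deriv_t I (deriv_t I F) u t =
         curvature (\<lambda>x. F x t) u *\<^sub>R inner_normal (\<lambda>x. F x t) u - grad_rho I c F u t
           + c t *\<^sub>R F u t) \<and>
      (\<forall>u. F u 0 = F\<^sub>0 u) \<and>
      (\<forall>u. deriv_t I F u 0 = f u *\<^sub>R inner_normal F\<^sub>0 u))"

end

theory Submission
  imports Defs
begin

text \<open>
  The tangential term \<open>\<nabla>\<rho>\<close> keeps the flow normal: \<open>\<partial>F/\<partial>t = \<sigma> N\<close>. With the tangent angle \<open>\<theta>\<close> and the speed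
  \<open>v = |\<partial>F/\<partial>u|\<close> the equation becomes \<open>\<theta>\<^sub>t = \<sigma>\<^sub>u/v\<close>, \<open>\<sigma>\<^sub>t = \<theta>\<^sub>u/v + c (F, N)\<close>, \<open>v\<^sub>t = - \<sigma> \<theta>\<^sub>u\<close>, and therefore
  \<open>(ln v + \<sigma>\<^sup>2/2)\<^sub>t = c \<sigma> (F, N)\<close>. So \<open>\<sigma> \<plusminus> \<theta>\<close>, \<open>ln v + \<sigma>\<^sup>2/2\<close> and the coordinates of \<open>F\<close> solve a diagonal
  first-order system with speeds \<open>\<plusminus> 1/v\<close> and \<open>0\<close>.

  Solutions of such a system are limits of the scheme that transports each component along
  straight characteristics for a short time and adds the source. One step composes smooth
  functions, so all space derivatives can be estimated by the maximum norm, and the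
  iterates for step sizes \<open>2\<^sup>-\<^sup>m\<close> converge geometrically. Uniqueness follows from the maximum
  principle for the squared difference of two solutions.

  The initial curve is simple with curvature of one sign, hence has turning number \<open>\<plusminus> 1\<close> (Hopf), and this
  is preserved. A curve with turning number \<open>\<plusminus> 1\<close> and monotone tangent angle bounds a convex set, so it is
  simple, and its curvature is positive with respect to the inner normal.
\<close>

section \<open>Weighted bounds on derivatives\<close>

text \<open>The curvature term contains only the normal part of the second space derivative of
  \<open>F\<close>, so the second-order system is degenerate in the tangential direction; normal
  speed, tangent angle and length remove this degeneracy. The length itself is not a good unknown,
  since its time derivative contains \<open>\<theta>\<^sub>u\<close>; the same space derivative
  occurs in \<open>\<sigma> \<sigma>\<^sub>t\<close>, and adding \<open>\<sigma>\<^sup>2/2\<close>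
  to the logarithm cancels it. The logarithm also turns 1/v into an exponential, which is smooth
  without restriction. Uniqueness is claimed among all regular closed families, so the frame has to
  be extracted from an arbitrary solution before anything can be compared. This works because the
  product of curvature and normal does not depend on the choice of the normal. The initial velocity
  does depend on it: here the inside of the initial curve, and with it the turning number, must be
  known. As \<open>c\<close> is only continuous, regularity in time is low while smoothness in
  \<open>u\<close> is required. All derivative estimates therefore concern \<open>u\<close>; the
  time derivative is obtained at the end from a local expansion.\<close>

text \<open>
  \<open>dbound k e M g\<close> means \<open>|g\<^sup>(\<^sup>j\<^sup>)| \<le> M e\<^sup>-\<^sup>j\<close> for \<open>j \<le> k\<close>. In \<open>tame\<close> the weight only enters from the second
  derivative on. Letting \<open>e\<close> decrease exponentially in time absorbs the growth of the higher
  derivatives, so that the life span of a solution does not depend on the order of differentiability.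
\<close>

primrec dbound :: "nat \<Rightarrow> real \<Rightarrow> real \<Rightarrow> (real \<Rightarrow> real) \<Rightarrow> bool" where
  "dbound 0 e M g \<longleftrightarrow> (\<forall>u. \<bar>g u\<bar> \<le> M)"
| "dbound (Suc k) e M g \<longleftrightarrow> (\<forall>u. \<bar>g u\<bar> \<le> M) \<and>
     (\<exists>g'. (\<forall>u. (g has_real_derivative g' u) (at u)) \<and> dbound k e (M / e) g')"

definition tame :: "nat \<Rightarrow> real \<Rightarrow> real \<Rightarrow> (real \<Rightarrow> real) \<Rightarrow> bool" where
  "tame k e M g \<longleftrightarrow> (\<forall>u. \<bar>g u\<bar> \<le> M) \<and>
     (\<exists>g'. (\<forall>u. (g has_real_derivative g' u) (at u)) \<and> dbound k e M g')"

lemma dbound_SucI: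
  "(\<And>u. \<bar>g u\<bar> \<le> M) \<Longrightarrow> (\<And>u. (g has_real_derivative g' u) (at u)) \<Longrightarrow>
    dbound k e (M / e) g' \<Longrightarrow> dbound (Suc k) e M g"
  by auto

lemma tameI:
  "(\<And>u. \<bar>g u\<bar> \<le> M) \<Longrightarrow> (\<And>u. (g has_real_derivative g' u) (at u)) \<Longrightarrow>
    dbound k e M g' \<Longrightarrow> tame k e M g"
  unfolding tame_def by auto

lemma dbound_abs_le: "dbound k e M g \<Longrightarrow> \<bar>g u\<bar> \<le> M"
  by (cases k) auto

lemma dbound_nonneg: "dbound k e M g \<Longrightarrow> 0 \<le> M"
  using dbound_abs_le[of k e M g 0] by linarith

lemma dbound_Suc_imp: "dbound (Suc k) e M g \<Longrightarrow> dbound k e M g"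
proof (induction k arbitrary: M g)
  case (Suc k)
  then show ?case by (metis dbound.simps(2))
qed simp

lemma dbound_order_mono: "dbound k e M g \<Longrightarrow> j \<le> k \<Longrightarrow> dbound j e M g"
proof (induction k)
  case (Suc k)
  then show ?case using dbound_Suc_imp[of k e M g] by (cases "j = Suc k") auto
qed simp

lemma dbound_mono:
  "dbound k e M g \<Longrightarrow> M \<le> M' \<Longrightarrow> 0 < e' \<Longrightarrow> e' \<le> e \<Longrightarrow> dbound k e' M' g"
proof (induction k arbitrary: M M' g)
  case 0
  then show ?case by (auto intro: order_trans)
next
  case (Suc k)
  from Suc.prems(1) obtain g' where g': "\<And>u. (g has_real_derivative g' u) (at u)"
      "dbound k e (M / e) g'" by auto
  have "0 \<le> M" using Suc.prems(1) by (rule dbound_nonneg)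
  then have "M / e \<le> M' / e'" using Suc.prems by (intro frac_le) auto
  with Suc.IH[OF g'(2)] Suc.prems have "dbound k e' (M' / e') g'" by auto
  moreover have "\<bar>g u\<bar> \<le> M'" for u using dbound_abs_le[OF Suc.prems(1), of u] Suc.prems by linarith
  ultimately show ?case using g'(1) by auto
qed

lemma dbound_add:
  "dbound k e M f \<Longrightarrow> dbound k e M' g \<Longrightarrow> dbound k e (M + M') (\<lambda>u. f u + g u)"
proof (induction k arbitrary: M M' f g)
  case 0
  have "\<bar>f u + g u\<bar> \<le> M + M'" for u
    using 0 by (metis abs_triangle_ineq add_mono dbound.simps(1) order_trans)
  then show ?case by simp
next
  case (Suc k)
  then obtain f' g' where
    "\<And>u. (f has_real_derivative f' u) (at u)" "dbound k e (M / e) f'"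
    "\<And>u. (g has_real_derivative g' u) (at u)" "dbound k e (M' / e) g'" by auto
  moreover from this Suc.IH have "dbound k e ((M + M') / e) (\<lambda>u. f' u + g' u)"
    by (simp add: add_divide_distrib)
  moreover have "\<bar>f u + g u\<bar> \<le> M + M'" for u
    using dbound_abs_le[OF Suc.prems(1), of u] dbound_abs_le[OF Suc.prems(2), of u] by linarith
  ultimately show ?case by (auto intro!: exI[of _ "\<lambda>u. f' u + g' u"] DERIV_add)
qed

text \<open>The factor 2^k comes from the product rule: each differentiation splits the product into
  two terms and so doubles the constant.\<close>

lemma dbound_mult:
  "0 < e \<Longrightarrow> dbound k e M f \<Longrightarrow> dbound k e M' g \<Longrightarrow> dbound k e (2 ^ k * M * M') (\<lambda>u. f u * g u)"
proof (induction k arbitrary: M M' f g)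
  case 0
  have "\<bar>f u * g u\<bar> \<le> M * M'" for u
    using 0 dbound_nonneg[OF 0(2)] by (auto simp: abs_mult intro!: mult_mono)
  then show ?case by simp
next
  case (Suc k)
  then obtain f' g' where
    d: "\<And>u. (f has_real_derivative f' u) (at u)" "dbound k e (M / e) f'"
    "\<And>u. (g has_real_derivative g' u) (at u)" "dbound k e (M' / e) g'" by auto
  have 1: "dbound k e M f" "dbound k e M' g" using Suc.prems dbound_Suc_imp by blast+
  have "dbound k e (2^k * (M/e) * M' + 2^k * M * (M'/e)) (\<lambda>u. f' u * g u + f u * g' u)"
    by (intro dbound_add Suc.IH d 1 Suc.prems)
  then have 2: "dbound k e (2 ^ Suc k * M * M' / e) (\<lambda>u. f' u * g u + f u * g' u)"
    by (simp add: field_simps)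
  have nn: "0 \<le> M" "0 \<le> M'" using 1 dbound_nonneg by blast+
  have "\<bar>f u * g u\<bar> \<le> 2 ^ Suc k * M * M'" for u
  proof -
    have "\<bar>f u * g u\<bar> \<le> M * M'" using nn dbound_abs_le[OF 1(1), of u] dbound_abs_le[OF 1(2), of u]
      by (auto simp: abs_mult intro!: mult_mono)
    also have "\<dots> \<le> 2 ^ Suc k * (M * M')"
      using mult_right_mono[of 1 "2 ^ Suc k" "M * M'"] nn by (simp add: one_le_power del: power_Suc)
    finally show ?thesis by (simp add: mult_ac)
  qed
  moreover have "((\<lambda>u. f u * g u) has_real_derivative f' u * g u + f u * g' u) (at u)" for u
    using DERIV_mult[OF d(1)[of u] d(3)[of u]] by (simp add: algebra_simps)
  ultimately show ?case using 2 by (rule dbound_SucI)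
qed

lemma dbound_zero: "0 \<le> M \<Longrightarrow> 0 < e \<Longrightarrow> dbound k e M (\<lambda>u. 0)"
  by (induction k arbitrary: M) (auto intro!: exI[of _ "\<lambda>_. 0"])

lemma dbound_const: "\<bar>a\<bar> \<le> M \<Longrightarrow> 0 < e \<Longrightarrow> dbound k e M (\<lambda>u. a)"
  by (cases k) (auto intro!: exI[of _ "\<lambda>_. 0"] dbound_zero)

lemma dbound_cmult:
  assumes "dbound k e M f" "0 < e" shows "dbound k e (\<bar>a\<bar> * M) (\<lambda>u. a * f u)"
  using assms
proof (induction k arbitrary: M f)
  case 0
  then show ?case by (auto simp: abs_mult intro!: mult_left_mono)
next
  case (Suc k)
  then obtain f' where d: "\<And>u. (f has_real_derivative f' u) (at u)" "dbound k e (M / e) f'" by auto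
  have "dbound k e (\<bar>a\<bar> * M / e) (\<lambda>u. a * f' u)" using Suc.IH[OF d(2)] Suc.prems by simp
  moreover have "\<bar>a * f u\<bar> \<le> \<bar>a\<bar> * M" for u
    using dbound_abs_le[OF Suc.prems(1), of u] by (auto simp: abs_mult intro!: mult_left_mono)
  ultimately show ?case using d by (auto intro!: exI[of _ "\<lambda>u. a * f' u"] DERIV_cmult)
qed

text \<open>A factor 1 + a in the bound can be moved into the weight, because from the first
  derivative on the smaller weight supplies at least one such factor. Order 0 gets none, whence the
  separate bound on \<open>p\<close>.\<close>

lemma dbound_rescale:
  assumes "dbound k e (M * (1 + a)) p" "\<And>u. \<bar>p u\<bar> \<le> M" "0 \<le> a" "0 < e"
  shows "dbound k (e / (1 + a)) M p"
proof (cases k)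
  case 0
  then show ?thesis using assms by simp
next
  case (Suc j)
  with assms obtain p' where p': "\<And>u. (p has_real_derivative p' u) (at u)"
    "dbound j e (M * (1 + a) / e) p'" by auto
  have "dbound j (e / (1 + a)) (M / (e / (1 + a))) p'"
    by (rule dbound_mono[OF p'(2)]) (use assms in \<open>auto simp: field_simps\<close>)
  with p' assms Suc show ?thesis by auto
qed

text \<open>Any bound on the derivatives is compatible with the amplitude \<open>M\<close> once the
  weight is small enough. This keeps the higher derivatives of the initial data from influencing
  \<open>M\<close>.\<close>

lemma dbound_shrink:
  assumes "dbound k 1 B p" "\<And>u. \<bar>p u\<bar> \<le> M" "0 < M"
  shows "\<exists>e>0. e \<le> 1 \<and> dbound k e M p"
proof -
  have B: "0 \<le> B" using assms(1) by (rule dbound_nonneg)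
  have "dbound k 1 (M * (1 + B / M)) p"
    by (rule dbound_mono[OF assms(1)]) (use assms B in \<open>auto simp: field_simps\<close>)
  from dbound_rescale[OF this assms(2)] show ?thesis
    using assms B by (intro exI[of _ "1 / (1 + B / M)"]) (auto simp: field_simps add_pos_nonneg)
qed

section \<open>Bounds with an unweighted first derivative\<close>

lemma tame_abs_le: "tame k e M g \<Longrightarrow> \<bar>g u\<bar> \<le> M"
  by (simp add: tame_def)

lemma tame_nonneg: "tame k e M g \<Longrightarrow> 0 \<le> M"
  using tame_abs_le[of k e M g 0] by linarith

lemma tame_mono:
  "tame k e M g \<Longrightarrow> M \<le> M' \<Longrightarrow> j \<le> k \<Longrightarrow> 0 < e' \<Longrightarrow> e' \<le> e \<Longrightarrow> tame j e' M' g"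
  unfolding tame_def using dbound_mono dbound_order_mono order_trans by meson

text \<open>As e \<le> 1, the unweighted bound on the first derivative is stronger than the weighted
  one, and one order is gained on the way back to \<open>dbound\<close>.\<close>

lemma tame_dbound:
  assumes "tame k e M g" "0 < e" "e \<le> 1" shows "dbound (Suc k) e M g"
proof -
  from assms obtain g' where g': "\<And>u. (g has_real_derivative g' u) (at u)" "dbound k e M g'"
    by (auto simp: tame_def)
  have "M \<le> M / e" using assms tame_nonneg[OF assms(1)]
    by (simp add: field_simps mult_left_le)
  then have "dbound k e (M / e) g'" using dbound_mono[OF g'(2)] assms by auto
  with g' assms show ?thesis by (auto simp: tame_def)
qed

lemma tame_const: "\<bar>a\<bar> \<le> M \<Longrightarrow> 0 < e \<Longrightarrow> tame k e M (\<lambda>u. a)"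
  unfolding tame_def by (auto intro!: exI[of _ "\<lambda>_. 0"] dbound_zero)

lemma tame_add:
  assumes "tame k e M f" "tame k e M' g" shows "tame k e (M + M') (\<lambda>u. f u + g u)"
proof -
  from assms obtain f' g' where
    "\<And>u. (f has_real_derivative f' u) (at u)" "dbound k e M f'"
    "\<And>u. (g has_real_derivative g' u) (at u)" "dbound k e M' g'" by (auto simp: tame_def)
  moreover from this have "dbound k e (M + M') (\<lambda>u. f' u + g' u)"
    by (auto intro: dbound_add)
  moreover have "\<bar>f u + g u\<bar> \<le> M + M'" for u
    using tame_abs_le[OF assms(1), of u] tame_abs_le[OF assms(2), of u] by linarith
  ultimately show ?thesis unfolding tame_def
    by (auto intro!: exI[of _ "\<lambda>u. f' u + g' u"] DERIV_add)
qed

lemma tame_mult: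
  assumes "tame k e M f" "tame k e M' g" "0 < e" "e \<le> 1"
  shows "tame k e (2 ^ Suc k * M * M') (\<lambda>u. f u * g u)"
proof -
  from assms obtain f' g' where
    d: "\<And>u. (f has_real_derivative f' u) (at u)" "dbound k e M f'"
    "\<And>u. (g has_real_derivative g' u) (at u)" "dbound k e M' g'" by (auto simp: tame_def)
  have 1: "dbound k e M f" "dbound k e M' g"
    using tame_dbound[OF assms(1,3,4)] tame_dbound[OF assms(2,3,4)] dbound_Suc_imp by blast+
  have "dbound k e (2^k * M * M' + 2^k * M * M') (\<lambda>u. f' u * g u + f u * g' u)"
    by (intro dbound_add dbound_mult d 1 assms)
  then have 2: "dbound k e (2 ^ Suc k * M * M') (\<lambda>u. f' u * g u + f u * g' u)"
    by (simp add: field_simps)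
  have "\<bar>f u * g u\<bar> \<le> 2 ^ Suc k * M * M'" for u
    using dbound_abs_le[OF dbound_mult[OF _ tame_dbound[OF assms(1,3,4)] tame_dbound[OF assms(2,3,4)]]]
      assms by auto
  moreover have "((\<lambda>u. f u * g u) has_real_derivative f' u * g u + f u * g' u) (at u)" for u
    using DERIV_mult[OF d(1)[of u] d(3)[of u]] by (simp add: algebra_simps)
  ultimately show ?thesis using 2 by (rule tameI)
qed

text \<open>\<open>\<psi> n\<close> is the n-th derivative of one smooth function. What matters is
  the order of the quantifiers: \<open>M'\<close> depends on \<open>M\<close> and \<open>k\<close>,
  but not on the weight. The derivative of \<psi>(g) is the product of \<psi>'(g) and g', so order
  \<open>k\<close> needs \<open>dbound k\<close> for \<psi>'(g); by \<open>tame_dbound\<close> the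
  induction hypothesis of the preceding order provides exactly that.\<close>

lemma tame_compose:
  fixes \<psi> :: "nat \<Rightarrow> real \<Rightarrow> real"
  assumes "\<And>n x. (\<psi> n has_real_derivative \<psi> (Suc n) x) (at x)"
  shows "\<exists>M'. \<forall>e g. 0 < e \<longrightarrow> e \<le> 1 \<longrightarrow> tame k e M g \<longrightarrow> tame k e M' (\<lambda>u. \<psi> n (g u))"
proof (induction k arbitrary: n)
  have bd: "\<exists>B. \<forall>x. \<bar>x\<bar> \<le> M \<longrightarrow> \<bar>\<psi> n x\<bar> \<le> B" for n
  proof -
    have "continuous_on {-M..M} (\<psi> n)"
      using assms by (auto intro!: continuous_at_imp_continuous_on DERIV_isCont)
    then have "bounded (\<psi> n ` {-M..M})"
      using compact_continuous_image compact_imp_bounded by blast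
    then obtain B where "\<And>x. x \<in> {-M..M} \<Longrightarrow> \<bar>\<psi> n x\<bar> \<le> B"
      unfolding bounded_iff by (auto simp del: atLeastAtMost_iff)
    then show ?thesis by (intro exI[of _ B]) (auto simp: abs_le_iff)
  qed
  have step: "\<exists>M'. \<forall>e g. 0 < e \<longrightarrow> e \<le> 1 \<longrightarrow> tame k e M g \<longrightarrow> tame k e M' (\<lambda>u. \<psi> n (g u))"
    if *: "\<exists>B. \<forall>e g. 0 < e \<longrightarrow> e \<le> 1 \<longrightarrow> tame k e M g \<longrightarrow> dbound k e B (\<lambda>u. \<psi> (Suc n) (g u))" for k n
  proof -
    obtain B where B: "\<And>e g. 0 < e \<Longrightarrow> e \<le> 1 \<Longrightarrow> tame k e M g \<Longrightarrow> dbound k e B (\<lambda>u. \<psi> (Suc n) (g u))"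
      using * by blast
    obtain B0 where B0: "\<And>x. \<bar>x\<bar> \<le> M \<Longrightarrow> \<bar>\<psi> n x\<bar> \<le> B0" using bd by blast
    show ?thesis
    proof (intro exI allI impI)
      fix e :: real and g assume e: "0 < e" "e \<le> 1" and g: "tame k e M g"
      from g obtain g' where d: "\<And>u. (g has_real_derivative g' u) (at u)" "dbound k e M g'"
        by (auto simp: tame_def)
      have "dbound k e (2^k * B * M) (\<lambda>u. \<psi> (Suc n) (g u) * g' u)"
        by (intro dbound_mult B d e g)
      then have "dbound k e (max B0 (2^k * B * M)) (\<lambda>u. \<psi> (Suc n) (g u) * g' u)"
        by (rule dbound_mono) (use e in auto)
      moreover have "((\<lambda>u. \<psi> n (g u)) has_real_derivative \<psi> (Suc n) (g u) * g' u) (at u)" for u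
        by (rule DERIV_chain'[OF d(1) assms])
      moreover have "\<bar>\<psi> n (g u)\<bar> \<le> max B0 (2^k * B * M)" for u
        using B0[OF tame_abs_le[OF g, of u]] by simp
      ultimately show "tame k e (max B0 (2^k * B * M)) (\<lambda>u. \<psi> n (g u))"
        by (intro tameI)
    qed
  qed
  {
    case 0
    obtain B0 where B0: "\<And>x. \<bar>x\<bar> \<le> M \<Longrightarrow> \<bar>\<psi> (Suc n) x\<bar> \<le> B0" using bd by blast
    show ?case by (rule step) (auto intro!: exI[of _ B0] B0 simp: tame_def)
  next
    case (Suc k)
    from Suc[of "Suc n"] obtain M' where
      M': "\<And>e g. 0 < e \<Longrightarrow> e \<le> 1 \<Longrightarrow> tame k e M g \<Longrightarrow> tame k e M' (\<lambda>u. \<psi> (Suc n) (g u))" by blast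
    show ?case
    proof (rule step, intro exI allI impI)
      fix e :: real and g assume e: "0 < e" "e \<le> 1" and g: "tame (Suc k) e M g"
      then have "tame k e M g" by (auto elim!: tame_mono)
      then show "dbound (Suc k) e M' (\<lambda>u. \<psi> (Suc n) (g u))"
        using M' e tame_dbound by blast
    qed
  }
qed

text \<open>Closing the projections under sums, products and composition with smooth functions of
  one variable covers every coefficient of the system, and each estimate becomes an induction that
  never mentions partial derivatives. The sequence \<open>\<psi>\<close> is a smooth function on the
  whole line together with all its derivatives; division is thereby excluded, which the exponential
  form of 1/v makes harmless.\<close>

inductive nice :: "(('i \<Rightarrow> real) \<Rightarrow> real) \<Rightarrow> bool" where
  nice_const: "nice (\<lambda>x. a)"
| nice_proj: "nice (\<lambda>x. x i)"
| nice_add: "nice H \<Longrightarrow> nice H' \<Longrightarrow> nice (\<lambda>x. H x + H' x)"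
| nice_mult: "nice H \<Longrightarrow> nice H' \<Longrightarrow> nice (\<lambda>x. H x * H' x)"
| nice_comp: "nice H \<Longrightarrow> (\<And>n x. (\<psi> n has_real_derivative \<psi> (Suc n) x) (at x)) \<Longrightarrow> nice (\<lambda>x. \<psi> 0 (H x))"

lemma nice_minus: "nice H \<Longrightarrow> nice (\<lambda>x. - H x)"
  using nice_mult[OF nice_const[of "-1"], of H] by simp

lemma nice_diff: "nice H \<Longrightarrow> nice H' \<Longrightarrow> nice (\<lambda>x. H x - H' x)"
  using nice_add[OF _ nice_minus, of H H'] by simp

lemma nice_exp: "nice H \<Longrightarrow> nice (\<lambda>x. exp (H x))"
  using nice_comp[of H "\<lambda>_. exp"] by (simp add: DERIV_exp)

text \<open>Each derivative shifts the sine by a quarter period, so one formula describes the whole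
  sequence of derivatives.\<close>

lemma nice_sin: "nice H \<Longrightarrow> nice (\<lambda>x. sin (H x))"
proof -
  assume "nice H"
  have "((\<lambda>x. sin (x + real n * (pi / 2))) has_real_derivative sin (x + real (Suc n) * (pi / 2))) (at x)" for n x
  proof -
    have "sin (x + real (Suc n) * (pi / 2)) = cos (x + real n * (pi / 2))"
      using sin_add[of "x + real n * (pi / 2)" "pi / 2"] by (simp add: add_divide_distrib algebra_simps)
    then show ?thesis by (auto intro!: derivative_eq_intros)
  qed
  from nice_comp[of H "\<lambda>n x. sin (x + real n * (pi / 2))", OF \<open>nice H\<close> this] show ?thesis by simp
qed

lemma nice_cos: "nice H \<Longrightarrow> nice (\<lambda>x. cos (H x))"
  using nice_sin[OF nice_add[OF _ nice_const[of "pi/2"]], of H] by (simp add: sin_add)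

lemma nice_tame:
  "nice H \<Longrightarrow> \<exists>M'. \<forall>e w. 0 < e \<longrightarrow> e \<le> 1 \<longrightarrow> (\<forall>i. tame k e M (w i)) \<longrightarrow> tame k e M' (\<lambda>u. H (\<lambda>i. w i u))"
proof (induction rule: nice.induct)
  case (nice_const a)
  then show ?case by (auto intro!: exI[of _ "\<bar>a\<bar>"] tame_const)
next
  case (nice_proj i)
  then show ?case by auto
next
  case (nice_add H H')
  then show ?case using tame_add by meson
next
  case (nice_mult H H')
  then show ?case using tame_mult by meson
next
  case (nice_comp H \<psi>)
  from nice_comp.IH obtain M' where
    M': "\<And>e w. 0 < e \<Longrightarrow> e \<le> 1 \<Longrightarrow> (\<forall>i. tame k e M (w i)) \<Longrightarrow> tame k e M' (\<lambda>u. H (\<lambda>i. w i u))" by blast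
  have "\<exists>M''. \<forall>e g. 0 < e \<longrightarrow> e \<le> 1 \<longrightarrow> tame k e M' g \<longrightarrow> tame k e M'' (\<lambda>u. \<psi> 0 (g u))"
    by (rule tame_compose) (rule nice_comp.hyps(2))
  with M' show ?case by meson
qed

text \<open>The distance is expressed by a common bound \<open>d\<close> on the coordinate
  differences, that is, in the maximum norm, the norm in which stability and uniqueness are
  estimated.\<close>

lemma nice_bounded_Lipschitz:
  "nice H \<Longrightarrow> \<exists>L\<ge>0. (\<forall>x. (\<forall>i. \<bar>x i\<bar> \<le> M) \<longrightarrow> \<bar>H x\<bar> \<le> L) \<and>
     (\<forall>x y d. (\<forall>i. \<bar>x i\<bar> \<le> M) \<longrightarrow> (\<forall>i. \<bar>y i\<bar> \<le> M) \<longrightarrow> (\<forall>i. \<bar>x i - y i\<bar> \<le> d) \<longrightarrow> \<bar>H x - H y\<bar> \<le> L * d)"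
proof (induction rule: nice.induct)
  case (nice_const a)
  show ?case
  proof (intro exI[of _ "\<bar>a\<bar>"] conjI allI impI)
    fix x y :: "'a \<Rightarrow> real" and d assume "\<forall>i. \<bar>x i - y i\<bar> \<le> d"
    then have "0 \<le> d" by (meson abs_ge_zero order_trans)
    then show "\<bar>a - a\<bar> \<le> \<bar>a\<bar> * d" by simp
  qed auto
next
  case (nice_proj i)
  show ?case
  proof (intro exI[of _ "max 1 M"] conjI allI impI)
    fix x y :: "'a \<Rightarrow> real" and d assume "\<forall>i. \<bar>x i - y i\<bar> \<le> d"
    then have "\<bar>x i - y i\<bar> \<le> d" "0 \<le> d" by (auto intro: order_trans[OF abs_ge_zero])
    then show "\<bar>x i - y i\<bar> \<le> max 1 M * d"
      using mult_right_mono[of 1 "max 1 M" d] by auto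
  qed (auto simp: max.coboundedI2)
next
  case (nice_add H H')
  then obtain L L' where L: "0 \<le> L" "0 \<le> L'"
    "\<And>x. (\<forall>i. \<bar>x i\<bar> \<le> M) \<Longrightarrow> \<bar>H x\<bar> \<le> L" "\<And>x. (\<forall>i. \<bar>x i\<bar> \<le> M) \<Longrightarrow> \<bar>H' x\<bar> \<le> L'"
    "\<And>x y d. (\<forall>i. \<bar>x i\<bar> \<le> M) \<Longrightarrow> (\<forall>i. \<bar>y i\<bar> \<le> M) \<Longrightarrow> (\<forall>i. \<bar>x i - y i\<bar> \<le> d) \<Longrightarrow> \<bar>H x - H y\<bar> \<le> L * d"
    "\<And>x y d. (\<forall>i. \<bar>x i\<bar> \<le> M) \<Longrightarrow> (\<forall>i. \<bar>y i\<bar> \<le> M) \<Longrightarrow> (\<forall>i. \<bar>x i - y i\<bar> \<le> d) \<Longrightarrow> \<bar>H' x - H' y\<bar> \<le> L' * d"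
    by blast
  show ?case
  proof (intro exI[of _ "L + L'"] conjI allI impI)
    fix x :: "'a \<Rightarrow> real" assume "\<forall>i. \<bar>x i\<bar> \<le> M"
    from L(3,4)[OF this] show "\<bar>H x + H' x\<bar> \<le> L + L'" by linarith
  next
    fix x y :: "'a \<Rightarrow> real" and d
    assume "\<forall>i. \<bar>x i\<bar> \<le> M" "\<forall>i. \<bar>y i\<bar> \<le> M" "\<forall>i. \<bar>x i - y i\<bar> \<le> d"
    from L(5,6)[OF this] show "\<bar>H x + H' x - (H y + H' y)\<bar> \<le> (L + L') * d"
      by (simp add: distrib_right abs_le_iff)
  qed (use L in auto)
next
  case (nice_mult H H')
  then obtain L L' where L: "0 \<le> L" "0 \<le> L'"
    "\<And>x. (\<forall>i. \<bar>x i\<bar> \<le> M) \<Longrightarrow> \<bar>H x\<bar> \<le> L" "\<And>x. (\<forall>i. \<bar>x i\<bar> \<le> M) \<Longrightarrow> \<bar>H' x\<bar> \<le> L'"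
    "\<And>x y d. (\<forall>i. \<bar>x i\<bar> \<le> M) \<Longrightarrow> (\<forall>i. \<bar>y i\<bar> \<le> M) \<Longrightarrow> (\<forall>i. \<bar>x i - y i\<bar> \<le> d) \<Longrightarrow> \<bar>H x - H y\<bar> \<le> L * d"
    "\<And>x y d. (\<forall>i. \<bar>x i\<bar> \<le> M) \<Longrightarrow> (\<forall>i. \<bar>y i\<bar> \<le> M) \<Longrightarrow> (\<forall>i. \<bar>x i - y i\<bar> \<le> d) \<Longrightarrow> \<bar>H' x - H' y\<bar> \<le> L' * d"
    by blast
  show ?case
  proof (intro exI[of _ "2 * (L * L')"] conjI allI impI)
    fix x :: "'a \<Rightarrow> real" assume "\<forall>i. \<bar>x i\<bar> \<le> M"
    from L(3,4)[OF this] L(1,2) have "\<bar>H x * H' x\<bar> \<le> L * L'" by (auto simp: abs_mult intro!: mult_mono)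
    then show "\<bar>H x * H' x\<bar> \<le> 2 * (L * L')" using mult_nonneg_nonneg[OF L(1,2)] by linarith
  next
    fix x y :: "'a \<Rightarrow> real" and d
    assume a: "\<forall>i. \<bar>x i\<bar> \<le> M" "\<forall>i. \<bar>y i\<bar> \<le> M" "\<forall>i. \<bar>x i - y i\<bar> \<le> d"
    have "H x * H' x - H y * H' y = H x * (H' x - H' y) + (H x - H y) * H' y" by (simp add: algebra_simps)
    also have "\<bar>\<dots>\<bar> \<le> L * (L' * d) + L * d * L'"
      by (rule order_trans[OF abs_triangle_ineq], unfold abs_mult, intro add_mono mult_mono)
        (use L(3)[OF a(1)] L(4)[OF a(2)] L(5,6)[OF a] L(1,2) in auto)
    finally show "\<bar>H x * H' x - H y * H' y\<bar> \<le> 2 * (L * L') * d" by (simp add: algebra_simps)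
  qed (use L in auto)
next
  case (nice_comp H \<psi>)
  then obtain L where L: "0 \<le> L"
    "\<And>x. (\<forall>i. \<bar>x i\<bar> \<le> M) \<Longrightarrow> \<bar>H x\<bar> \<le> L"
    "\<And>x y d. (\<forall>i. \<bar>x i\<bar> \<le> M) \<Longrightarrow> (\<forall>i. \<bar>y i\<bar> \<le> M) \<Longrightarrow> (\<forall>i. \<bar>x i - y i\<bar> \<le> d) \<Longrightarrow> \<bar>H x - H y\<bar> \<le> L * d"
    by blast
  have bd: "\<exists>B. \<forall>x\<in>{-L..L}. \<bar>\<psi> n x\<bar> \<le> B" for n
  proof -
    have "continuous_on {-L..L} (\<psi> n)"
      using nice_comp.hyps(2) by (auto intro!: continuous_at_imp_continuous_on DERIV_isCont)
    then have "bounded (\<psi> n ` {-L..L})"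
      using compact_continuous_image compact_imp_bounded by blast
    then show ?thesis unfolding bounded_iff by auto
  qed
  obtain B0 B1 where B: "\<And>x. x \<in> {-L..L} \<Longrightarrow> \<bar>\<psi> 0 x\<bar> \<le> B0" "\<And>x. x \<in> {-L..L} \<Longrightarrow> \<bar>\<psi> 1 x\<bar> \<le> B1"
    using bd by metis
  have B1: "0 \<le> B1" using B(2)[of 0] L(1) by auto
  have lip: "\<bar>\<psi> 0 s - \<psi> 0 t\<bar> \<le> B1 * \<bar>s - t\<bar>" if "s \<in> {-L..L}" "t \<in> {-L..L}" for s t
    using field_differentiable_bound[of "{-L..L}" "\<psi> 0" "\<psi> 1" B1 s t] nice_comp.hyps(2)[of 0] B that
    by (auto intro: has_field_derivative_at_within)
  show ?case
  proof (intro exI[of _ "max B0 (B1 * L)"] conjI allI impI)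
    show "0 \<le> max B0 (B1 * L)" using B1 L(1) by (simp add: max.coboundedI2)
  next
    fix x :: "'a \<Rightarrow> real" assume "\<forall>i. \<bar>x i\<bar> \<le> M"
    from L(2)[OF this] show "\<bar>\<psi> 0 (H x)\<bar> \<le> max B0 (B1 * L)"
      using B(1)[of "H x"] by (auto simp: abs_le_iff)
  next
    fix x y :: "'a \<Rightarrow> real" and d
    assume a: "\<forall>i. \<bar>x i\<bar> \<le> M" "\<forall>i. \<bar>y i\<bar> \<le> M" "\<forall>i. \<bar>x i - y i\<bar> \<le> d"
    have d: "0 \<le> d" using a(3) by (meson abs_ge_zero order_trans)
    have "\<bar>\<psi> 0 (H x) - \<psi> 0 (H y)\<bar> \<le> B1 * \<bar>H x - H y\<bar>"
      using lip L(2)[OF a(1)] L(2)[OF a(2)] by (auto simp: abs_le_iff)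
    also have "\<dots> \<le> B1 * (L * d)" using L(3)[OF a] B1 by (intro mult_left_mono)
    also have "\<dots> \<le> max B0 (B1 * L) * d"
      using mult_right_mono[of "B1 * L" "max B0 (B1 * L)" d] d by (simp add: mult_ac)
    finally show "\<bar>\<psi> 0 (H x) - \<psi> 0 (H y)\<bar> \<le> max B0 (B1 * L) * d" .
  qed
qed

section \<open>One step of the scheme\<close>

text \<open>Transport along characteristics. The change of variable differs from the identity by
  order \<delta>, so each differentiation costs a factor 1 + 2^K C \<delta>. The smaller weight pays
  for it and \<open>M\<close> survives unchanged, which allows arbitrarily many steps.\<close>

lemma dbound_compose_id_plus:
  assumes \<phi>: "\<And>u. (\<phi> has_real_derivative 1 + \<delta> * a u) (at u)" and a: "dbound K e C a"
    and "0 \<le> \<delta>" "0 < e'" "e' \<le> e / (1 + 2 ^ K * C * \<delta>)" "0 < e"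
  shows "dbound k e M p \<Longrightarrow> k \<le> K \<Longrightarrow> dbound k e' M (\<lambda>u. p (\<phi> u))"
proof (induction k arbitrary: M p)
  case 0
  then show ?case by simp
next
  case (Suc k)
  then obtain p' where p': "\<And>u. (p has_real_derivative p' u) (at u)" "dbound k e (M / e) p'" by auto
  have C: "0 \<le> C" using a by (rule dbound_nonneg)
  have M: "0 \<le> M" using Suc.prems(1) by (rule dbound_nonneg)
  have ee: "e' \<le> e"
  proof (rule order_trans[OF assms(5)])
    have "0 \<le> 2 ^ K * C * \<delta>" using C assms(3) by auto
    then show "e / (1 + 2 ^ K * C * \<delta>) \<le> e" using assms(6) divide_left_mono[of 1 "1 + 2 ^ K * C * \<delta>" e] by simp
  qed
  have 1: "dbound k e' (M / e) (\<lambda>u. p' (\<phi> u))" using Suc.IH[OF p'(2)] Suc.prems by simp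
  have 2: "dbound k e' C a"
    by (rule dbound_mono[OF dbound_order_mono[OF a]]) (use Suc.prems ee assms in auto)
  have 3: "dbound k e' (M / e + \<bar>\<delta>\<bar> * (2 ^ k * (M / e) * C)) (\<lambda>u. p' (\<phi> u) + \<delta> * (p' (\<phi> u) * a u))"
    by (intro dbound_add dbound_cmult dbound_mult 1 2 assms)
  have "M / e + \<bar>\<delta>\<bar> * (2 ^ k * (M / e) * C) = M / e * (1 + 2 ^ k * C * \<delta>)"
    using assms by (simp add: algebra_simps)
  also have "\<dots> \<le> M / e * (1 + 2 ^ K * C * \<delta>)"
    using Suc.prems assms C M by (intro mult_left_mono add_left_mono mult_right_mono power_increasing) auto
  also have "\<dots> \<le> M / e'"
  proof -
    have "0 < 1 + 2 ^ K * C * \<delta>" using C assms by (simp add: add_pos_nonneg)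
    then have "e' * (1 + 2 ^ K * C * \<delta>) \<le> e" using assms(5) by (simp add: field_simps)
    then have "(1 + 2 ^ K * C * \<delta>) \<le> e / e'" using assms by (simp add: field_simps)
    then have "M / e * (1 + 2 ^ K * C * \<delta>) \<le> M / e * (e / e')" using M assms by (intro mult_left_mono) auto
    then show ?thesis using assms by simp
  qed
  finally have 4: "dbound k e' (M / e') (\<lambda>u. p' (\<phi> u) + \<delta> * (p' (\<phi> u) * a u))"
    using dbound_mono[OF 3] assms by auto
  show ?case
  proof (rule dbound_SucI[OF _ _ 4])
    show "\<bar>p (\<phi> u)\<bar> \<le> M" for u using dbound_abs_le[OF Suc.prems(1)] .
    show "((\<lambda>u. p (\<phi> u)) has_real_derivative p' (\<phi> u) + \<delta> * (p' (\<phi> u) * a u)) (at u)" for u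
      using DERIV_chain'[OF \<phi> p'(1), of u] by (simp add: algebra_simps)
  qed
qed

lemma tame_Lipschitz:
  assumes "tame k e M g" shows "\<bar>g x - g y\<bar> \<le> M * \<bar>x - y\<bar>"
proof -
  from assms obtain g' where g': "\<And>u. (g has_real_derivative g' u) (at u)" "dbound k e M g'"
    by (auto simp: tame_def)
  show ?thesis
    using field_differentiable_bound[of UNIV g g' M x y] g'(1) dbound_abs_le[OF g'(2)] by auto
qed

lemma finite_uniform_bound:
  fixes P :: "'i::finite \<Rightarrow> real \<Rightarrow> bool"
  assumes "\<And>i M M'. P i M \<Longrightarrow> M \<le> M' \<Longrightarrow> P i M'" "\<And>i. \<exists>M. P i M"
  shows "\<exists>M\<ge>0. \<forall>i. P i M"
proof -
  obtain f where f: "\<And>i. P i (f i)" using assms(2) by metis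
  have "f i \<le> (\<Sum>j\<in>UNIV. \<bar>f j\<bar>)" for i
    using member_le_sum[of i UNIV "\<lambda>j. \<bar>f j\<bar>"] by simp
  then show ?thesis using f assms(1) by (meson abs_ge_zero sum_nonneg)
qed

definition blip :: "real \<Rightarrow> real \<Rightarrow> (('i \<Rightarrow> real) \<Rightarrow> real) \<Rightarrow> bool" where
  "blip M L H \<longleftrightarrow> (\<forall>x. (\<forall>i. \<bar>x i\<bar> \<le> M) \<longrightarrow> \<bar>H x\<bar> \<le> L) \<and>
     (\<forall>x y d. (\<forall>i. \<bar>x i\<bar> \<le> M) \<longrightarrow> (\<forall>i. \<bar>y i\<bar> \<le> M) \<longrightarrow> (\<forall>i. \<bar>x i - y i\<bar> \<le> d) \<longrightarrow> \<bar>H x - H y\<bar> \<le> L * d)"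

lemma blip_abs_le: "blip M L H \<Longrightarrow> (\<And>i. \<bar>x i\<bar> \<le> M) \<Longrightarrow> \<bar>H x\<bar> \<le> L"
  unfolding blip_def by blast

lemma blip_diff_le:
  "blip M L H \<Longrightarrow> (\<And>i. \<bar>x i\<bar> \<le> M) \<Longrightarrow> (\<And>i. \<bar>y i\<bar> \<le> M) \<Longrightarrow> (\<And>i. \<bar>x i - y i\<bar> \<le> d) \<Longrightarrow> \<bar>H x - H y\<bar> \<le> L * d"
  unfolding blip_def by blast

lemma blip_mono:
  assumes "blip M L H" "L \<le> L'" shows "blip M L' H"
  unfolding blip_def
proof (intro conjI allI impI)
  fix x :: "'a \<Rightarrow> real" assume "\<forall>i. \<bar>x i\<bar> \<le> M" then show "\<bar>H x\<bar> \<le> L'"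
    using blip_abs_le[OF assms(1), of x] assms(2) by auto
next
  fix x y :: "'a \<Rightarrow> real" and d
  assume "\<forall>i. \<bar>x i\<bar> \<le> M" "\<forall>i. \<bar>y i\<bar> \<le> M" and d: "\<forall>i. \<bar>x i - y i\<bar> \<le> d"
  then have "\<bar>H x - H y\<bar> \<le> L * d" using blip_diff_le[OF assms(1)] by blast
  moreover have "0 \<le> d" using d by (meson abs_ge_zero order_trans)
  ultimately show "\<bar>H x - H y\<bar> \<le> L' * d" using mult_right_mono[OF assms(2), of d] by linarith
qed

text \<open>
  The system is \<open>\<partial>w\<^sub>i/\<partial>t = lam\<^sub>i(w) \<partial>w\<^sub>i/\<partial>u + h\<^sub>i(w) + c(t) k\<^sub>i(w)\<close>. In \<open>step\<close>, \<open>\<delta>\<close> is the time step and \<open>\<gamma>\<close>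
  the increment of a primitive of \<open>c\<close>: with this increment in place of \<open>\<delta> c(t)\<close>, two steps compose up to
  an error of second order although \<open>c\<close> is only continuous.
\<close>

locale diagonal_system =
  fixes lam h k :: "'i::finite \<Rightarrow> ('i \<Rightarrow> real) \<Rightarrow> real" and K :: real
  assumes nice: "nice (lam i)" "nice (h i)" "nice (k i)" and K: "0 \<le> K"
begin

definition step :: "real \<Rightarrow> real \<Rightarrow> ('i \<Rightarrow> real \<Rightarrow> real) \<Rightarrow> 'i \<Rightarrow> real \<Rightarrow> real" where
  "step \<delta> \<gamma> w i u = w i (u + \<delta> * lam i (\<lambda>j. w j u)) + \<delta> * h i (\<lambda>j. w j u) + \<gamma> * k i (\<lambda>j. w j u)"

lemma coeff_blip: "\<exists>L\<ge>0. \<forall>i. blip M L (lam i) \<and> blip M L (h i) \<and> blip M L (k i)"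
proof (rule finite_uniform_bound)
  fix i
  have "\<exists>L. blip M L H" if "nice H" for H :: "('i \<Rightarrow> real) \<Rightarrow> real"
    using nice_bounded_Lipschitz[OF that, of M] unfolding blip_def by blast
  then obtain L1 L2 L3 where "blip M L1 (lam i)" "blip M L2 (h i)" "blip M L3 (k i)"
    using nice[of i] by metis
  then show "\<exists>L. blip M L (lam i) \<and> blip M L (h i) \<and> blip M L (k i)"
    by (intro exI[of _ "max L1 (max L2 L3)"]) (auto elim!: blip_mono)
qed (auto elim!: blip_mono)

lemma coeff_tame:
  "\<exists>C\<ge>0. \<forall>i e w. 0 < e \<longrightarrow> e \<le> 1 \<longrightarrow> (\<forall>i. tame n e M (w i)) \<longrightarrow>
     tame n e C (\<lambda>u. lam i (\<lambda>j. w j u)) \<and> tame n e C (\<lambda>u. h i (\<lambda>j. w j u)) \<and> tame n e C (\<lambda>u. k i (\<lambda>j. w j u))"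
proof (rule finite_uniform_bound)
  fix i
  let ?P = "\<lambda>C H. \<forall>e w. 0 < e \<longrightarrow> e \<le> 1 \<longrightarrow> (\<forall>i. tame n e M (w i)) \<longrightarrow> tame n e C (\<lambda>u. H (\<lambda>j. w j u))"
  obtain L1 L2 L3 where L: "?P L1 (lam i)" "?P L2 (h i)" "?P L3 (k i)"
    using nice_tame[OF nice(1)[of i], of n M] nice_tame[OF nice(2)[of i], of n M]
      nice_tame[OF nice(3)[of i], of n M] by (elim exE)
  show "\<exists>C. \<forall>e w. 0 < e \<longrightarrow> e \<le> 1 \<longrightarrow> (\<forall>i. tame n e M (w i)) \<longrightarrow>
     tame n e C (\<lambda>u. lam i (\<lambda>j. w j u)) \<and> tame n e C (\<lambda>u. h i (\<lambda>j. w j u)) \<and> tame n e C (\<lambda>u. k i (\<lambda>j. w j u))"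
  proof (intro exI[of _ "max L1 (max L2 L3)"] allI impI conjI)
    fix e :: real and w :: "'i \<Rightarrow> real \<Rightarrow> real" assume a: "0 < e" "e \<le> 1" "\<forall>i. tame n e M (w i)"
    show "tame n e (max L1 (max L2 L3)) (\<lambda>u. lam i (\<lambda>j. w j u))"
      by (rule tame_mono[of n e L1]) (use L(1) a in auto)
    show "tame n e (max L1 (max L2 L3)) (\<lambda>u. h i (\<lambda>j. w j u))"
      by (rule tame_mono[of n e L2]) (use L(2) a in auto)
    show "tame n e (max L1 (max L2 L3)) (\<lambda>u. k i (\<lambda>j. w j u))"
      by (rule tame_mono[of n e L3]) (use L(3) a in auto)
  qed
next
  fix i M M'
  show "\<forall>e w. 0 < e \<longrightarrow> e \<le> 1 \<longrightarrow> (\<forall>i. tame n e Ma (w i)) \<longrightarrow>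
     tame n e M (\<lambda>u. lam i (\<lambda>j. w j u)) \<and> tame n e M (\<lambda>u. h i (\<lambda>j. w j u)) \<and> tame n e M (\<lambda>u. k i (\<lambda>j. w j u))
    \<Longrightarrow> M \<le> M' \<Longrightarrow> \<forall>e w. 0 < e \<longrightarrow> e \<le> 1 \<longrightarrow> (\<forall>i. tame n e Ma (w i)) \<longrightarrow>
     tame n e M' (\<lambda>u. lam i (\<lambda>j. w j u)) \<and> tame n e M' (\<lambda>u. h i (\<lambda>j. w j u)) \<and> tame n e M' (\<lambda>u. k i (\<lambda>j. w j u))" for Ma
    using tame_mono[of n _ M _ M' n] by (meson order_refl)
qed

lemma step_has_derivative:
  assumes "\<And>u. (w i has_real_derivative w' u) (at u)"
    and "\<And>u. ((\<lambda>u. lam i (\<lambda>j. w j u)) has_real_derivative l' u) (at u)"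
    and "\<And>u. ((\<lambda>u. h i (\<lambda>j. w j u)) has_real_derivative h' u) (at u)"
    and "\<And>u. ((\<lambda>u. k i (\<lambda>j. w j u)) has_real_derivative k' u) (at u)"
  shows "(step \<delta> \<gamma> w i has_real_derivative w' (u + \<delta> * lam i (\<lambda>j. w j u))
    + \<delta> * (w' (u + \<delta> * lam i (\<lambda>j. w j u)) * l' u) + \<delta> * h' u + \<gamma> * k' u) (at u)"
proof -
  have "((\<lambda>u. u + \<delta> * lam i (\<lambda>j. w j u)) has_real_derivative 1 + \<delta> * l' u) (at u)"
    by (auto intro!: derivative_eq_intros assms)
  from DERIV_chain'[OF this assms(1)] assms(3,4)
  have "((\<lambda>u. w i (u + \<delta> * lam i (\<lambda>j. w j u)) + \<delta> * h i (\<lambda>j. w j u) + \<gamma> * k i (\<lambda>j. w j u)) has_real_derivative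
    w' (u + \<delta> * lam i (\<lambda>j. w j u)) * (1 + \<delta> * l' u) + \<delta> * h' u + \<gamma> * k' u) (at u)"
    by (intro DERIV_add DERIV_cmult)
  moreover have "step \<delta> \<gamma> w i = (\<lambda>u. w i (u + \<delta> * lam i (\<lambda>j. w j u)) + \<delta> * h i (\<lambda>j. w j u) + \<gamma> * k i (\<lambda>j. w j u))"
    by (simp add: step_def fun_eq_iff)
  ultimately show ?thesis by (simp add: algebra_simps)
qed

text \<open>For the values and first derivatives the growth per step is additive: transport
  multiplies the derivative by 1 + O(\<delta>), and the sources add terms of order \<delta>. The
  time for which a bound \<open>M\<close> holds is thus determined by these two orders
  alone.\<close>

lemma step_tame0:
  "\<exists>C\<ge>0. \<forall>w \<delta> \<gamma> a. 0 \<le> \<delta> \<longrightarrow> \<bar>\<gamma>\<bar> \<le> K * \<delta> \<longrightarrow> a \<le> M \<longrightarrow> (\<forall>i. tame 0 1 a (w i)) \<longrightarrow>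
     (\<forall>i. tame 0 1 (a + C * \<delta>) (step \<delta> \<gamma> w i))"
proof -
  obtain C where C: "0 \<le> C" "\<And>i e w. 0 < e \<Longrightarrow> e \<le> 1 \<Longrightarrow> (\<forall>i. tame 0 e M (w i)) \<Longrightarrow>
     tame 0 e C (\<lambda>u. lam i (\<lambda>j. w j u)) \<and> tame 0 e C (\<lambda>u. h i (\<lambda>j. w j u)) \<and> tame 0 e C (\<lambda>u. k i (\<lambda>j. w j u))"
    using coeff_tame[of 0 M] by blast
  show ?thesis
  \<comment> \<open>The three terms bound the stretching of the first derivative by transport, the
    source \<open>h\<close>, and the source \<open>k\<close> with its factor \<gamma> of size at
    most K \<delta>.\<close>
  proof (intro exI[of _ "\<bar>M\<bar> * C + C + K * C"] conjI allI impI)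
    show "0 \<le> \<bar>M\<bar> * C + C + K * C" using C K by simp
    fix w :: "'i \<Rightarrow> real \<Rightarrow> real" and \<delta> \<gamma> a i assume d: "0 \<le> \<delta>" and g: "\<bar>\<gamma>\<bar> \<le> K * \<delta>" and aM: "a \<le> M" and w: "\<forall>i. tame 0 1 a (w i)"
    have "\<forall>i. tame 0 1 M (w i)" using w aM tame_mono[of 0 1 a _ M 0 1] by auto
    from C(2)[OF _ _ this, of i] have c: "tame 0 1 C (\<lambda>u. lam i (\<lambda>j. w j u))"
      "tame 0 1 C (\<lambda>u. h i (\<lambda>j. w j u))" "tame 0 1 C (\<lambda>u. k i (\<lambda>j. w j u))" by auto
    from c obtain l' h' k' where
      d: "\<And>u. ((\<lambda>u. lam i (\<lambda>j. w j u)) has_real_derivative l' u) (at u)" "\<And>u. \<bar>l' u\<bar> \<le> C"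
      "\<And>u. ((\<lambda>u. h i (\<lambda>j. w j u)) has_real_derivative h' u) (at u)" "\<And>u. \<bar>h' u\<bar> \<le> C"
      "\<And>u. ((\<lambda>u. k i (\<lambda>j. w j u)) has_real_derivative k' u) (at u)" "\<And>u. \<bar>k' u\<bar> \<le> C" and d0: "0 \<le> \<delta>"
      using \<open>0 \<le> \<delta>\<close> unfolding tame_def dbound.simps by metis
    obtain w' where w': "\<And>u. (w i has_real_derivative w' u) (at u)" "\<And>u. \<bar>w' u\<bar> \<le> a"
      using w unfolding tame_def dbound.simps by metis
    have a: "0 \<le> a" "a \<le> \<bar>M\<bar>" using w tame_nonneg aM by (blast, linarith)
    show "tame 0 1 (a + (\<bar>M\<bar> * C + C + K * C) * \<delta>) (step \<delta> \<gamma> w i)"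
    proof (rule tameI[OF _ step_has_derivative[OF w'(1) d(1,3,5)]])
      fix u
      have "\<bar>\<gamma> * k i (\<lambda>j. w j u)\<bar> \<le> K * \<delta> * C" "\<bar>\<delta> * h i (\<lambda>j. w j u)\<bar> \<le> \<delta> * C"
        using tame_abs_le[OF c(2), of u] tame_abs_le[OF c(3), of u] d0 g
        by (auto simp: abs_mult intro!: mult_mono mult_left_mono)
      moreover have "\<bar>w i (u + \<delta> * lam i (\<lambda>j. w j u))\<bar> \<le> a" using w tame_abs_le by blast
      moreover have "0 \<le> \<bar>M\<bar> * C * \<delta>" using C d0 by simp
      ultimately show "\<bar>step \<delta> \<gamma> w i u\<bar> \<le> a + (\<bar>M\<bar> * C + C + K * C) * \<delta>"
        unfolding step_def distrib_right by (simp add: mult_ac abs_le_iff)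
      show "dbound 0 1 (a + (\<bar>M\<bar> * C + C + K * C) * \<delta>) (\<lambda>u. w' (u + \<delta> * lam i (\<lambda>j. w j u))
          + \<delta> * (w' (u + \<delta> * lam i (\<lambda>j. w j u)) * l' u) + \<delta> * h' u + \<gamma> * k' u)"
      proof (simp, intro allI)
        fix u
        let ?P = "u + \<delta> * lam i (\<lambda>j. w j u)"
        have "\<bar>w' ?P * l' u\<bar> \<le> \<bar>M\<bar> * C"
          using w'(2)[of ?P] d(2)[of u] a C unfolding abs_mult by (intro mult_mono) auto
        then have "\<bar>\<delta> * (w' ?P * l' u)\<bar> \<le> \<delta> * (\<bar>M\<bar> * C)"
          using d0 by (simp add: abs_mult mult_left_mono)
        moreover have "\<bar>\<gamma> * k' u\<bar> \<le> K * \<delta> * C" "\<bar>\<delta> * h' u\<bar> \<le> \<delta> * C"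
          using d(4)[of u] d(6)[of u] d0 g C by (auto simp: abs_mult intro!: mult_mono mult_left_mono)
        moreover have "\<bar>w' ?P\<bar> \<le> a" by (rule w'(2))
        ultimately show "\<bar>w' ?P + \<delta> * (w' ?P * l' u) + \<delta> * h' u + \<gamma> * k' u\<bar> \<le> a + (\<bar>M\<bar> * C + C + K * C) * \<delta>"
          unfolding distrib_right by (simp add: mult_ac abs_le_iff)
      qed
    qed
  qed
qed

text \<open>With the new values and first derivatives already controlled, the growth of the higher
  derivatives goes entirely into the weight. The assumed \<open>tame 0\<close> bound on the new
  state is the order 0 bound that \<open>dbound_rescale\<close> requires for its derivative.\<close>

lemma step_tame:
  assumes "1 \<le> M"
  shows "\<exists>C\<ge>0. \<forall>w \<delta> \<gamma> e. 0 \<le> \<delta> \<longrightarrow> \<delta> \<le> 1 \<longrightarrow> \<bar>\<gamma>\<bar> \<le> K * \<delta> \<longrightarrow> 0 < e \<longrightarrow> e \<le> 1 \<longrightarrow>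
     (\<forall>i. tame n e M (w i)) \<longrightarrow> (\<forall>i. tame 0 1 M (step \<delta> \<gamma> w i)) \<longrightarrow>
     (\<forall>i. tame n (e / (1 + C * \<delta>)) M (step \<delta> \<gamma> w i))"
proof -
  obtain C where C: "0 \<le> C" "\<And>i e w. 0 < e \<Longrightarrow> e \<le> 1 \<Longrightarrow> (\<forall>i. tame n e M (w i)) \<Longrightarrow>
     tame n e C (\<lambda>u. lam i (\<lambda>j. w j u)) \<and> tame n e C (\<lambda>u. h i (\<lambda>j. w j u)) \<and> tame n e C (\<lambda>u. k i (\<lambda>j. w j u))"
    using coeff_tame[of n M] by blast
  \<comment> \<open>\<open>A\<close> measures the loss of weight by transport, \<open>B\<close> that
    by the sources. Since \<delta> \<le> 1, the product of 1 + A \<delta> and 1 + B \<delta> is at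
    most 1 + (A + B + A B) \<delta>, which is the origin of the witness.\<close>
  define A where "A = 2 ^ n * C"
  define B where "B = 2 ^ n * C + C + K * C"
  have AB: "0 \<le> A" "0 \<le> B" using C K by (auto simp: A_def B_def)
  show ?thesis
  proof (intro exI[of _ "A + B + A * B"] conjI allI impI)
    show "0 \<le> A + B + A * B" using AB by simp
    fix w :: "'i \<Rightarrow> real \<Rightarrow> real" and \<delta> \<gamma> e i assume d0: "0 \<le> \<delta>" "\<delta> \<le> 1" and g: "\<bar>\<gamma>\<bar> \<le> K * \<delta>" and e: "0 < e" "e \<le> 1"
      and w: "\<forall>i. tame n e M (w i)" and s: "\<forall>i. tame 0 1 M (step \<delta> \<gamma> w i)"
    from C(2)[OF e w, of i] obtain l' h' k' where
      d: "\<And>u. ((\<lambda>u. lam i (\<lambda>j. w j u)) has_real_derivative l' u) (at u)" "dbound n e C l'"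
      "\<And>u. ((\<lambda>u. h i (\<lambda>j. w j u)) has_real_derivative h' u) (at u)" "dbound n e C h'"
      "\<And>u. ((\<lambda>u. k i (\<lambda>j. w j u)) has_real_derivative k' u) (at u)" "dbound n e C k'"
      unfolding tame_def by metis
    obtain w' where w': "\<And>u. (w i has_real_derivative w' u) (at u)" "dbound n e M w'"
      using w unfolding tame_def by metis
    define s' where "s' = (\<lambda>u. w' (u + \<delta> * lam i (\<lambda>j. w j u))
          + \<delta> * (w' (u + \<delta> * lam i (\<lambda>j. w j u)) * l' u) + \<delta> * h' u + \<gamma> * k' u)"
    have s': "\<And>u. (step \<delta> \<gamma> w i has_real_derivative s' u) (at u)"
      unfolding s'_def by (rule step_has_derivative[OF w'(1) d(1,3,5)])
    define e1 where "e1 = e / (1 + A * \<delta>)"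
    have A1: "1 \<le> 1 + A * \<delta>" "1 \<le> 1 + B * \<delta>" using AB d0 by auto
    have e1: "0 < e1" "e1 \<le> e" using e A1 divide_left_mono[of 1 "1 + A * \<delta>" e] by (auto simp: e1_def)
    have 1: "dbound n e1 M (\<lambda>u. w' (u + \<delta> * lam i (\<lambda>j. w j u)))"
    proof (rule dbound_compose_id_plus[OF _ d(2) d0(1) e1(1) _ e(1) w'(2)])
      show "e1 \<le> e / (1 + 2 ^ n * C * \<delta>)" by (simp add: e1_def A_def)
      show "((\<lambda>u. u + \<delta> * lam i (\<lambda>j. w j u)) has_real_derivative 1 + \<delta> * l' u) (at u)" for u
        by (auto intro!: derivative_eq_intros d)
    qed simp
    have m: "dbound n e1 C f" if "dbound n e C f" for f using dbound_mono[OF that _ e1] by simp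
    have "dbound n e1 (M + \<bar>\<delta>\<bar> * (2 ^ n * M * C) + \<bar>\<delta>\<bar> * C + \<bar>\<gamma>\<bar> * C) s'"
      unfolding s'_def by (intro dbound_add dbound_cmult dbound_mult m 1 d e1)
    moreover have "M + \<bar>\<delta>\<bar> * (2 ^ n * M * C) + \<bar>\<delta>\<bar> * C + \<bar>\<gamma>\<bar> * C \<le> M * (1 + B * \<delta>)"
    proof -
      have "\<bar>\<gamma>\<bar> * C \<le> K * \<delta> * C" using g C by (intro mult_right_mono)
      also have "\<dots> \<le> M * (K * \<delta> * C)"
        using mult_right_mono[OF assms, of "K * \<delta> * C"] K d0 C by simp
      finally have "\<bar>\<gamma>\<bar> * C \<le> M * (K * \<delta> * C)" .
      moreover have "\<bar>\<delta>\<bar> * C \<le> M * (\<delta> * C)"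
        using mult_right_mono[OF assms, of "\<delta> * C"] d0 C by simp
      ultimately show ?thesis using d0 by (simp add: B_def algebra_simps)
    qed
    ultimately have "dbound n e1 (M * (1 + B * \<delta>)) s'" using e1 by (auto intro: dbound_mono)
    moreover have "\<bar>s' u\<bar> \<le> M" for u
    proof -
      from s obtain g where "\<And>u. (step \<delta> \<gamma> w i has_real_derivative g u) (at u)" "\<And>u. \<bar>g u\<bar> \<le> M"
        unfolding tame_def dbound.simps by metis
      then show ?thesis using s' DERIV_unique by metis
    qed
    ultimately have "dbound n (e1 / (1 + B * \<delta>)) M s'" using AB d0 e1 by (intro dbound_rescale) auto
    then have "dbound n (e / (1 + (A + B + A * B) * \<delta>)) M s'"
    proof (rule dbound_mono)
      have "A * B * (\<delta> * \<delta>) \<le> A * B * \<delta>"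
        using AB d0 mult_left_mono[of \<delta> 1 \<delta>] by (intro mult_left_mono) auto
      then have *: "(1 + A * \<delta>) * (1 + B * \<delta>) \<le> 1 + (A + B + A * B) * \<delta>"
        by (simp add: algebra_simps)
      have pos: "0 < (1 + A * \<delta>) * (1 + B * \<delta>)" using A1 by auto
      show "e / (1 + (A + B + A * B) * \<delta>) \<le> e1 / (1 + B * \<delta>)"
        using * pos e by (simp add: e1_def frac_le)
      show "0 < e / (1 + (A + B + A * B) * \<delta>)" using * pos e by (intro divide_pos_pos) linarith+
    qed simp
    then show "tame n (e / (1 + (A + B + A * B) * \<delta>)) M (step \<delta> \<gamma> w i)"
      using s' s tame_abs_le by (intro tameI) blast+
  qed
qed

text \<open>The two states have different characteristics. Moving from one foot point to the other
  is charged to the Lipschitz bound of \<open>w\<close>; after that \<open>w\<close> and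
  \<open>z\<close> are compared at the same point.\<close>

lemma step_stable:
  "\<exists>L\<ge>0. \<forall>w z \<delta> \<gamma> E i u. 0 \<le> \<delta> \<longrightarrow> \<bar>\<gamma>\<bar> \<le> K * \<delta> \<longrightarrow> (\<forall>i. tame 0 1 M (w i)) \<longrightarrow>
     (\<forall>i u. \<bar>z i u\<bar> \<le> M) \<longrightarrow> (\<forall>i u. \<bar>w i u - z i u\<bar> \<le> E) \<longrightarrow>
     \<bar>step \<delta> \<gamma> w i u - step \<delta> \<gamma> z i u\<bar> \<le> (1 + L * \<delta>) * E"
proof -
  obtain L where L: "0 \<le> L" "\<And>i. blip M L (lam i)" "\<And>i. blip M L (h i)" "\<And>i. blip M L (k i)"
    using coeff_blip[of M] by blast
  show ?thesis
  proof (intro exI[of _ "\<bar>M\<bar> * L + L + K * L"] conjI allI impI)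
    show "0 \<le> \<bar>M\<bar> * L + L + K * L" using L K by simp
    fix w z :: "'i \<Rightarrow> real \<Rightarrow> real" and \<delta> \<gamma> E i u assume d0: "0 \<le> \<delta>" and g: "\<bar>\<gamma>\<bar> \<le> K * \<delta>" and w: "\<forall>i. tame 0 1 M (w i)"
      and z: "\<forall>i u. \<bar>z i u\<bar> \<le> M" and E: "\<forall>i u. \<bar>w i u - z i u\<bar> \<le> E"
    have M: "0 \<le> M" using w tame_nonneg by blast
    have E0: "0 \<le> E" using E by (meson abs_ge_zero order_trans)
    have b: "\<And>j. \<bar>w j u\<bar> \<le> M" using w tame_abs_le by blast
    let ?x = "\<lambda>j. w j u" and ?y = "\<lambda>j. z j u"
    have dl: "\<bar>lam i ?x - lam i ?y\<bar> \<le> L * E" "\<bar>h i ?x - h i ?y\<bar> \<le> L * E" "\<bar>k i ?x - k i ?y\<bar> \<le> L * E"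
      using z E by (auto intro: blip_diff_le[OF L(2) b] blip_diff_le[OF L(3) b] blip_diff_le[OF L(4) b])
    let ?P = "u + \<delta> * lam i ?x" and ?Q = "u + \<delta> * lam i ?y"
    have "\<bar>w i ?P - w i ?Q\<bar> \<le> M * \<bar>?P - ?Q\<bar>" using tame_Lipschitz w by blast
    also have "\<bar>?P - ?Q\<bar> = \<delta> * \<bar>lam i ?x - lam i ?y\<bar>"
      using d0 by (simp add: abs_mult flip: right_diff_distrib)
    also have "M * \<dots> \<le> M * (\<delta> * (L * E))" using dl M d0 by (intro mult_left_mono) auto
    finally have 1: "\<bar>w i ?P - w i ?Q\<bar> \<le> \<bar>M\<bar> * L * \<delta> * E" using M by (simp add: mult_ac)
    have 2: "\<bar>w i ?Q - z i ?Q\<bar> \<le> E" using E by blast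
    have "\<bar>\<delta> * (h i ?x - h i ?y)\<bar> \<le> \<delta> * (L * E)" "\<bar>\<gamma> * (k i ?x - k i ?y)\<bar> \<le> K * \<delta> * (L * E)"
      unfolding abs_mult using dl d0 g E0 L by (auto intro!: mult_mono mult_left_mono)
    then have 3: "\<bar>\<delta> * (h i ?x - h i ?y)\<bar> \<le> L * \<delta> * E" "\<bar>\<gamma> * (k i ?x - k i ?y)\<bar> \<le> K * L * \<delta> * E"
      by (simp_all add: mult_ac)
    have "step \<delta> \<gamma> w i u - step \<delta> \<gamma> z i u = (w i ?P - w i ?Q) + (w i ?Q - z i ?Q)
      + \<delta> * (h i ?x - h i ?y) + \<gamma> * (k i ?x - k i ?y)"
      by (simp add: step_def algebra_simps)
    also have "\<bar>\<dots>\<bar> \<le> \<bar>M\<bar> * L * \<delta> * E + E + L * \<delta> * E + K * L * \<delta> * E" using 1 2 3 by linarith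
    also have "\<dots> = (1 + (\<bar>M\<bar> * L + L + K * L) * \<delta>) * E" by (simp add: algebra_simps)
    finally show "\<bar>step \<delta> \<gamma> w i u - step \<delta> \<gamma> z i u\<bar> \<le> (1 + (\<bar>M\<bar> * L + L + K * L) * \<delta>) * E" .
  qed
qed

lemma step_near_aux:
  assumes L: "0 \<le> L" "\<And>i. blip M L (lam i)" "\<And>i. blip M L (h i)" "\<And>i. blip M L (k i)"
    and "0 \<le> \<delta>" "\<bar>\<gamma>\<bar> \<le> K * \<delta>" "\<forall>i. tame 0 1 M (w i)"
  shows "\<bar>step \<delta> \<gamma> w i u - w i u\<bar> \<le> (M * L + L + K * L) * \<delta>"
proof -
  have M: "0 \<le> M" using assms tame_nonneg by blast
  have b: "\<And>j. \<bar>w j u\<bar> \<le> M" using assms tame_abs_le by blast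
  let ?x = "\<lambda>j. w j u"
  have bl: "\<bar>lam i ?x\<bar> \<le> L" "\<bar>h i ?x\<bar> \<le> L" "\<bar>k i ?x\<bar> \<le> L"
    by (rule blip_abs_le[OF L(2) b] blip_abs_le[OF L(3) b] blip_abs_le[OF L(4) b])+
  have "\<bar>w i (u + \<delta> * lam i ?x) - w i u\<bar> \<le> M * \<bar>u + \<delta> * lam i ?x - u\<bar>"
    using tame_Lipschitz assms by blast
  also have "\<dots> \<le> M * (\<delta> * L)" using bl M assms(5)
    by (intro mult_left_mono) (auto simp: abs_mult intro!: mult_left_mono)
  finally have 1: "\<bar>w i (u + \<delta> * lam i ?x) - w i u\<bar> \<le> M * L * \<delta>" by (simp add: mult_ac)
  have "\<bar>\<delta> * h i ?x\<bar> \<le> \<delta> * L" "\<bar>\<gamma> * k i ?x\<bar> \<le> K * \<delta> * L"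
    unfolding abs_mult using bl assms(5,6) L by (auto intro!: mult_mono mult_left_mono)
  then show ?thesis using 1 by (simp add: step_def algebra_simps abs_le_iff)
qed

lemma step_near:
  "\<exists>C\<ge>0. \<forall>w \<delta> \<gamma> i u. 0 \<le> \<delta> \<longrightarrow> \<bar>\<gamma>\<bar> \<le> K * \<delta> \<longrightarrow> (\<forall>i. tame 0 1 M (w i)) \<longrightarrow>
     \<bar>step \<delta> \<gamma> w i u - w i u\<bar> \<le> C * \<delta>"
proof -
  obtain L where L: "0 \<le> L" "\<And>i. blip M L (lam i)" "\<And>i. blip M L (h i)" "\<And>i. blip M L (k i)"
    using coeff_blip[of M] by blast
  show ?thesis
  proof (intro exI[of _ "\<bar>M\<bar> * L + L + K * L"] conjI allI impI)
    show "0 \<le> \<bar>M\<bar> * L + L + K * L" using L K by simp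
    fix w :: "'i \<Rightarrow> real \<Rightarrow> real" and \<delta> \<gamma> i u assume *: "0 \<le> \<delta>" "\<bar>\<gamma>\<bar> \<le> K * \<delta>" "\<forall>i. tame 0 1 M (w i)"
    have "0 \<le> M" using * tame_nonneg by blast
    then show "\<bar>step \<delta> \<gamma> w i u - w i u\<bar> \<le> (\<bar>M\<bar> * L + L + K * L) * \<delta>"
      using step_near_aux[OF L *, of i u] by simp
  qed
qed

text \<open>The second step evaluates the coefficients at a state changed by O(b) and multiplies the
  change by \<open>a\<close>; the first step is read at a point displaced by O(a), and its
  coefficients carry the factor \<open>b\<close>. Hence the defect has order a b, with constants
  that involve first derivatives only.\<close>

lemma step_consistent:
  "\<exists>Q\<ge>0. \<forall>w a b \<gamma> \<beta> i u. 0 \<le> a \<longrightarrow> 0 \<le> b \<longrightarrow> \<bar>\<beta>\<bar> \<le> K * b \<longrightarrow> \<bar>\<gamma>\<bar> \<le> K * a \<longrightarrow> (\<forall>i. tame 0 1 M (w i)) \<longrightarrow>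
     (\<forall>i. tame 0 1 M (step b \<beta> w i)) \<longrightarrow>
     \<bar>step a \<gamma> (step b \<beta> w) i u - step (a + b) (\<beta> + \<gamma>) w i u\<bar> \<le> Q * (a * b)"
proof -
  obtain L where L: "0 \<le> L" "\<And>i. blip M L (lam i)" "\<And>i. blip M L (h i)" "\<And>i. blip M L (k i)"
    using coeff_blip[of M] by blast
  define C where "C = \<bar>M\<bar> * L + L + K * L"
  define D where "D = \<bar>M\<bar> * L"
  have CD: "0 \<le> C" "0 \<le> D" using L K by (auto simp: C_def D_def)
  show ?thesis
  proof (intro exI[of _ "\<bar>M\<bar> * (L * C + L * D) + L * D + L * C + K * (L * D) + K * (L * C)"] conjI allI impI)
    show "0 \<le> \<bar>M\<bar> * (L * C + L * D) + L * D + L * C + K * (L * D) + K * (L * C)" using L K CD by simp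
    fix w :: "'i \<Rightarrow> real \<Rightarrow> real" and a b \<gamma> \<beta> i u
    assume ab: "0 \<le> a" "0 \<le> b" and \<beta>: "\<bar>\<beta>\<bar> \<le> K * b" and \<gamma>: "\<bar>\<gamma>\<bar> \<le> K * a"
      and w: "\<forall>i. tame 0 1 M (w i)" and s: "\<forall>i. tame 0 1 M (step b \<beta> w i)"
    have M: "0 \<le> M" using w tame_nonneg by blast
    define z where "z = step b \<beta> w"
    define P where "P = u + a * lam i (\<lambda>j. z j u)"
    let ?x = "\<lambda>j. w j u" and ?y = "\<lambda>j. z j u" and ?p = "\<lambda>j. w j P"
    have bx: "\<And>j. \<bar>w j v\<bar> \<le> M" and by': "\<And>j. \<bar>z j v\<bar> \<le> M" for v
      using w s tame_abs_le unfolding z_def by blast+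
    have zx: "\<bar>z j u - w j u\<bar> \<le> C * b" for j
      using step_near_aux[OF L ab(2) \<beta> w, of j u] M by (simp add: z_def C_def)
    have aP: "\<bar>P - u\<bar> \<le> a * L"
      using blip_abs_le[OF L(2) by'] ab by (simp add: P_def abs_mult mult_left_mono)
    have px: "\<bar>w j P - w j u\<bar> \<le> D * a" for j
    proof -
      have "\<bar>w j P - w j u\<bar> \<le> M * \<bar>P - u\<bar>" using tame_Lipschitz w by blast
      also have "\<dots> \<le> M * (a * L)" using aP M by (rule mult_left_mono)
      finally show ?thesis using M by (simp add: D_def mult_ac)
    qed
    have yx: "\<bar>f ?y - f ?x\<bar> \<le> L * (C * b)" if "blip M L f" for f
      by (rule blip_diff_le[OF that by' bx zx])
    have qx: "\<bar>f ?p - f ?x\<bar> \<le> L * (D * a)" if "blip M L f" for f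
      by (rule blip_diff_le[OF that bx bx px])
    have 1: "\<bar>w i (P + b * lam i ?p) - w i (u + (a + b) * lam i ?x)\<bar> \<le> \<bar>M\<bar> * (L * C + L * D) * (a * b)"
    proof -
      have "\<bar>w i (P + b * lam i ?p) - w i (u + (a + b) * lam i ?x)\<bar>
         \<le> M * \<bar>P + b * lam i ?p - (u + (a + b) * lam i ?x)\<bar>" using tame_Lipschitz w by blast
      also have "P + b * lam i ?p - (u + (a + b) * lam i ?x)
          = a * (lam i ?y - lam i ?x) + b * (lam i ?p - lam i ?x)"
        by (simp add: P_def algebra_simps)
      also have "M * \<bar>a * (lam i ?y - lam i ?x) + b * (lam i ?p - lam i ?x)\<bar>
          \<le> M * (a * (L * (C * b)) + b * (L * (D * a)))"
        by (rule mult_left_mono[OF _ M], rule order_trans[OF abs_triangle_ineq], unfold abs_mult, intro add_mono mult_mono)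
          (use ab yx[OF L(2)] qx[OF L(2)] in auto)
      finally show ?thesis using M by (simp add: algebra_simps)
    qed
    have 2: "\<bar>b * (h i ?p - h i ?x)\<bar> \<le> L * D * (a * b)" "\<bar>a * (h i ?y - h i ?x)\<bar> \<le> L * C * (a * b)"
    proof -
      have "\<bar>b * (h i ?p - h i ?x)\<bar> \<le> b * (L * (D * a))" "\<bar>a * (h i ?y - h i ?x)\<bar> \<le> a * (L * (C * b))"
        using ab yx[OF L(3)] qx[OF L(3)] by (auto simp: abs_mult intro!: mult_left_mono)
      then show "\<bar>b * (h i ?p - h i ?x)\<bar> \<le> L * D * (a * b)" "\<bar>a * (h i ?y - h i ?x)\<bar> \<le> L * C * (a * b)"
        by (simp_all add: mult_ac)
    qed
    have 3: "\<bar>\<beta> * (k i ?p - k i ?x)\<bar> \<le> K * (L * D) * (a * b)" "\<bar>\<gamma> * (k i ?y - k i ?x)\<bar> \<le> K * (L * C) * (a * b)"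
    proof -
      have "\<bar>\<beta> * (k i ?p - k i ?x)\<bar> \<le> (K * b) * (L * (D * a))" "\<bar>\<gamma> * (k i ?y - k i ?x)\<bar> \<le> (K * a) * (L * (C * b))"
        unfolding abs_mult using ab yx[OF L(4)] qx[OF L(4)] \<beta> \<gamma> K by (auto intro!: mult_mono)
      then show "\<bar>\<beta> * (k i ?p - k i ?x)\<bar> \<le> K * (L * D) * (a * b)" "\<bar>\<gamma> * (k i ?y - k i ?x)\<bar> \<le> K * (L * C) * (a * b)"
        by (simp_all add: mult_ac)
    qed
    have "step a \<gamma> (step b \<beta> w) i u - step (a + b) (\<beta> + \<gamma>) w i u =
       (w i (P + b * lam i ?p) - w i (u + (a + b) * lam i ?x)) + b * (h i ?p - h i ?x)
       + a * (h i ?y - h i ?x) + \<beta> * (k i ?p - k i ?x) + \<gamma> * (k i ?y - k i ?x)"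
    proof -
      have "step a \<gamma> (step b \<beta> w) i u = z i P + a * h i ?y + \<gamma> * k i ?y" by (simp add: step_def[of a] z_def P_def)
      moreover have "z i P = w i (P + b * lam i ?p) + b * h i ?p + \<beta> * k i ?p" by (simp add: z_def step_def)
      ultimately show ?thesis by (simp add: step_def[of "a+b"] algebra_simps)
    qed
    also have "\<bar>\<dots>\<bar> \<le> \<bar>M\<bar> * (L * C + L * D) * (a * b) + L * D * (a * b) + L * C * (a * b)
       + K * (L * D) * (a * b) + K * (L * C) * (a * b)"
      by (intro order_trans[OF abs_triangle_ineq] add_mono 1 2 3)
    also have "\<dots> = (\<bar>M\<bar> * (L * C + L * D) + L * D + L * C + K * (L * D) + K * (L * C)) * (a * b)"
      by (simp add: distrib_right)
    finally show "\<bar>step a \<gamma> (step b \<beta> w) i u - step (a + b) (\<beta> + \<gamma>) w i u\<bar> \<le>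
      (\<bar>M\<bar> * (L * C + L * D) + L * D + L * C + K * (L * D) + K * (L * C)) * (a * b)" .
  qed
qed

end

section \<open>Convergence of the scheme\<close>

text \<open>On an interval of length sqrt \<epsilon> the mean value theorem yields a point where the
  derivative is at most 2 sqrt \<epsilon>, and the Lipschitz bound carries this to \<open>u\<close>.
  So uniform convergence of functions entails uniform convergence of their derivatives.\<close>

lemma derivative_bound_by_interpolation:
  assumes d: "\<And>u. (f has_real_derivative f' u) (at u)" and L: "\<And>x y. \<bar>f' x - f' y\<bar> \<le> B * \<bar>x - y\<bar>"
    and e: "\<And>u. \<bar>f u\<bar> \<le> \<epsilon>" "0 < \<epsilon>"
  shows "\<bar>f' u\<bar> \<le> (2 + B) * sqrt \<epsilon>"
proof -
  define \<eta> where "\<eta> = sqrt \<epsilon>"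
  have \<eta>: "0 < \<eta>" "\<epsilon> = \<eta> * \<eta>" using e(2) by (auto simp: \<eta>_def)
  obtain z where z: "u < z" "z < u + \<eta>" "f (u + \<eta>) - f u = \<eta> * f' z"
    using MVT2[of u "u + \<eta>" f f'] d \<eta>(1) by auto
  have B: "0 \<le> B" using L[of 1 0] by auto
  have "\<bar>\<eta> * f' z\<bar> \<le> 2 * (\<eta> * \<eta>)" using e(1)[of "u + \<eta>"] e(1)[of u] z(3) \<eta>(2) by linarith
  then have "\<eta> * \<bar>f' z\<bar> \<le> \<eta> * (2 * \<eta>)" using \<eta> by (simp add: abs_mult)
  then have "\<bar>f' z\<bar> \<le> 2 * \<eta>" using \<eta>(1) mult_le_cancel_left_pos by blast
  moreover have "\<bar>f' u - f' z\<bar> \<le> B * \<eta>"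
    using L[of u z] z mult_left_mono[OF _ B, of "\<bar>u - z\<bar>" \<eta>] by linarith
  ultimately have "\<bar>f' u\<bar> \<le> 2 * \<eta> + B * \<eta>" by linarith
  then show ?thesis by (simp add: \<eta>_def algebra_simps)
qed

lemma dbound_Lipschitz:
  assumes "dbound (Suc k) e M f" shows "\<bar>f x - f y\<bar> \<le> M / e * \<bar>x - y\<bar>"
proof -
  from assms obtain f' where d: "\<And>u. (f has_real_derivative f' u) (at u)" "dbound k e (M / e) f'" by auto
  show ?thesis
    using field_differentiable_bound[of UNIV f f' "M / e" x y] d(1) dbound_abs_le[OF d(2)] by auto
qed

lemma uniform_limit_derivative:
  fixes f f' :: "nat \<Rightarrow> real \<Rightarrow> real"
  assumes d: "\<And>m u. (f m has_real_derivative f' m u) (at u)"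
    and lip: "\<And>m x y. \<bar>f' m x - f' m y\<bar> \<le> B * \<bar>x - y\<bar>"
    and lim: "uniform_limit UNIV f g sequentially"
  shows "\<exists>g'. uniform_limit UNIV f' g' sequentially \<and> (\<forall>u. (g has_real_derivative g' u) (at u))"
proof -
  have B: "0 \<le> B" using lip[of 0 1 0] by simp
  have "uniformly_Cauchy_on UNIV f'"
  proof (rule uniformly_Cauchy_onI)
    fix \<epsilon> :: real assume \<epsilon>: "0 < \<epsilon>"
    \<comment> \<open>Chosen so that the interpolation bound equals \<epsilon>/2; the difference of
      two derivatives has Lipschitz constant 2 B.\<close>
    define \<delta> where "\<delta> = (\<epsilon> / (2 * (2 + 2 * B)))\<^sup>2"
    define b where "b = 2 + 2 * B"
    have "0 < b" using B by (simp add: b_def)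
    then have "0 < \<epsilon> / (2 * b)" "b * (\<epsilon> / (2 * b)) < \<epsilon>" using \<epsilon> by simp_all
    then have \<delta>: "0 < \<delta>" "(2 + 2 * B) * sqrt \<delta> < \<epsilon>"
      using \<open>0 < b\<close> \<epsilon> unfolding \<delta>_def b_def[symmetric] by simp_all
    have "uniformly_Cauchy_on UNIV f"
      using lim uniformly_convergent_Cauchy uniformly_convergentI by blast
    then obtain N where N: "\<And>m n x. N \<le> m \<Longrightarrow> N \<le> n \<Longrightarrow> dist (f m x) (f n x) < \<delta>"
      using \<delta>(1) unfolding uniformly_Cauchy_on_def by blast
    show "\<exists>N. \<forall>x\<in>UNIV. \<forall>m\<ge>N. \<forall>n\<ge>N. dist (f' m x) (f' n x) < \<epsilon>"
    proof (intro exI[of _ N] ballI allI impI)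
      fix x m n assume mn: "N \<le> m" "N \<le> n"
      have "\<bar>f' m x - f' n x\<bar> \<le> (2 + 2 * B) * sqrt \<delta>"
      proof (rule derivative_bound_by_interpolation[where f = "\<lambda>x. f m x - f n x" and f' = "\<lambda>x. f' m x - f' n x"])
        show "((\<lambda>x. f m x - f n x) has_real_derivative f' m u - f' n u) (at u)" for u
          by (intro DERIV_diff d)
        show "\<bar>f' m x - f' n x - (f' m y - f' n y)\<bar> \<le> 2 * B * \<bar>x - y\<bar>" for x y
          using lip[of m x y] lip[of n x y] by linarith
        show "\<bar>f m u - f n u\<bar> \<le> \<delta>" for u using N[OF mn, of u] by (simp add: dist_real_def)
      qed (rule \<delta>)
      then show "dist (f' m x) (f' n x) < \<epsilon>" using \<delta>(2) by (simp add: dist_real_def)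
    qed
  qed
  then obtain g' where g': "uniform_limit UNIV f' g' sequentially"
    using Cauchy_uniformly_convergent uniformly_convergent_on_def by blast
  have lim': "(\<lambda>m. f m u) \<longlonglongrightarrow> g u" for u using lim by (rule tendsto_uniform_limitI) simp
  have "\<exists>h. \<forall>x\<in>UNIV. (\<lambda>n. f n x) \<longlonglongrightarrow> h x \<and> (h has_derivative (*) (g' x)) (at x within UNIV)"
  proof (rule has_derivative_sequence[where f' = "\<lambda>n x. (*) (f' n x)" and ?x0.0 = 0 and l = "g 0"])
    show "(f n has_derivative (*) (f' n x)) (at x within UNIV)" for n x
      using d[of n x] unfolding has_field_derivative_def by simp
    fix e :: real assume "0 < e"
    from uniform_limitD[OF g' this] show "\<forall>\<^sub>F n in sequentially. \<forall>x\<in>UNIV. \<forall>h. norm (f' n x * h - g' x * h) \<le> e * norm h"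
    proof eventually_elim
      case (elim n)
      show ?case
      proof (intro ballI allI)
        fix x h
        have "\<bar>f' n x - g' x\<bar> * \<bar>h\<bar> \<le> e * \<bar>h\<bar>" using elim[rule_format, of x]
          by (intro mult_right_mono) (auto simp: dist_real_def)
        then show "norm (f' n x * h - g' x * h) \<le> e * norm h"
          by (simp add: abs_mult left_diff_distrib[symmetric])
      qed
    qed
  qed (use lim' in auto)
  then obtain h where h: "\<And>x. (\<lambda>n. f n x) \<longlonglongrightarrow> h x" "\<And>x. (h has_derivative (*) (g' x)) (at x)" by auto
  have "h = g" using h(1) lim' LIMSEQ_unique by blast
  then show ?thesis using h(2) g' by (auto simp: has_field_derivative_def)
qed

lemma abs_le_uniform_limit:
  fixes f :: "nat \<Rightarrow> real \<Rightarrow> real"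
  assumes "uniform_limit UNIV f g sequentially" "\<And>m u. \<bar>f m u\<bar> \<le> M"
  shows "\<bar>g u\<bar> \<le> M"
proof -
  have "(\<lambda>m. \<bar>f m u\<bar>) \<longlonglongrightarrow> \<bar>g u\<bar>"
    by (intro tendsto_rabs tendsto_uniform_limitI[OF assms(1)]) simp
  then show ?thesis by (rule LIMSEQ_le_const2) (use assms(2) in auto)
qed

text \<open>One order is lost: the convergence of a derivative rests on a Lipschitz bound for it,
  and hence on a bound for the next derivative.\<close>

lemma dbound_uniform_limit:
  assumes "\<And>m. dbound (Suc k) e M (f m)" "uniform_limit UNIV f g sequentially"
  shows "dbound k e M g"
  using assms
proof (induction k arbitrary: f g M)
  case 0
  then show ?case using abs_le_uniform_limit[of f g M] by auto
next
  case (Suc k)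
  from Suc.prems(1) have "\<forall>m. \<exists>f'. (\<forall>u. (f m has_real_derivative f' u) (at u)) \<and> dbound (Suc k) e (M / e) f'"
    by (subst (asm) dbound.simps) blast
  then obtain f' where f': "\<And>m u. (f m has_real_derivative f' m u) (at u)"
    "\<And>m. dbound (Suc k) e (M / e) (f' m)" by metis
  from uniform_limit_derivative[OF f'(1) dbound_Lipschitz[OF f'(2)] Suc.prems(2)]
  obtain g' where g': "uniform_limit UNIV f' g' sequentially" "\<And>u. (g has_real_derivative g' u) (at u)" by blast
  show ?case
  proof (rule dbound_SucI[OF _ g'(2)])
    show "\<bar>g u\<bar> \<le> M" for u
      by (rule abs_le_uniform_limit[OF Suc.prems(2)]) (rule dbound_abs_le[OF Suc.prems(1)])
  qed (rule Suc.IH[OF f'(2) g'(1)])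
qed

lemma tame_uniform_limit:
  assumes f: "\<And>m. tame (Suc n) e M (f m)" and g: "uniform_limit UNIV f g sequentially"
  shows "tame n e M g"
proof -
  have "\<forall>m. \<exists>f'. (\<forall>u. (f m has_real_derivative f' u) (at u)) \<and> dbound (Suc n) e M f'"
    using f unfolding tame_def by blast
  then obtain f' where f': "\<And>m u. (f m has_real_derivative f' m u) (at u)"
    "\<And>m. dbound (Suc n) e M (f' m)" by metis
  from uniform_limit_derivative[OF f'(1) dbound_Lipschitz[OF f'(2)] g]
  obtain g' where g': "uniform_limit UNIV f' g' sequentially" "\<And>u. (g has_real_derivative g' u) (at u)" by blast
  show ?thesis
  proof (rule tameI[OF _ g'(2)])
    show "\<bar>g u\<bar> \<le> M" for u
      by (rule abs_le_uniform_limit[OF g]) (rule tame_abs_le[OF f])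
  qed (rule dbound_uniform_limit[OF f'(2) g'(1)])
qed

lemma geometric_Cauchy_limit:
  fixes a :: "nat \<Rightarrow> real"
  assumes "\<And>m. \<bar>a (Suc m) - a m\<bar> \<le> D / 2 ^ m"
  shows "\<exists>l. \<forall>m. \<bar>a m - l\<bar> \<le> 2 * D / 2 ^ m"
proof -
  have D: "0 \<le> D" using assms[of 0] by simp
  have *: "\<bar>a (m + j) - a m\<bar> \<le> 2 * D / 2 ^ m - 2 * D / 2 ^ (m + j)" for m j
  proof (induction j)
    case (Suc j)
    have "\<bar>a (m + Suc j) - a (m + j)\<bar> \<le> D / 2 ^ (m + j)" using assms[of "m + j"] by simp
    moreover have "D / 2 ^ (m + j) = 2 * D / 2 ^ (m + j) - 2 * D / 2 ^ (m + Suc j)" by simp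
    ultimately show ?case using Suc by linarith
  qed simp
  then have **: "\<bar>a (m + j) - a m\<bar> \<le> 2 * D / 2 ^ m" for m j
    using D by (smt (verit) divide_nonneg_nonneg zero_le_power)
  have "Cauchy a"
  proof (rule metric_CauchyI)
    fix e :: real assume e: "0 < e"
    have "(\<lambda>m. 4 * D / 2 ^ m) \<longlonglongrightarrow> 0" by (rule LIMSEQ_divide_realpow_zero) simp
    then obtain N where N: "4 * D / 2 ^ N < e"
      using e by (metis (mono_tags, lifting) eventually_sequentially order_tendstoD(2) order_refl)
    show "\<exists>N. \<forall>m\<ge>N. \<forall>n\<ge>N. dist (a m) (a n) < e"
    proof (intro exI[of _ N] allI impI)
      fix m n assume "N \<le> m" "N \<le> n"
      then have "\<bar>a m - a N\<bar> \<le> 2 * D / 2 ^ N" "\<bar>a n - a N\<bar> \<le> 2 * D / 2 ^ N"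
        using **[of N "m - N"] **[of N "n - N"] by auto
      then show "dist (a m) (a n) < e" using N by (simp add: dist_real_def)
    qed
  qed
  then obtain l where l: "a \<longlonglongrightarrow> l" using Cauchy_convergent convergent_def by blast
  have "\<bar>a m - l\<bar> \<le> 2 * D / 2 ^ m" for m
  proof -
    have "(\<lambda>j. \<bar>a (j + m) - a m\<bar>) \<longlonglongrightarrow> \<bar>l - a m\<bar>"
      by (intro tendsto_intros LIMSEQ_ignore_initial_segment l)
    then have "\<bar>l - a m\<bar> \<le> 2 * D / 2 ^ m"
      by (rule LIMSEQ_le_const2) (use **[of m] in \<open>auto simp: add.commute\<close>)
    then show ?thesis by simp
  qed
  then show ?thesis by blast
qed

text \<open>Collects the constants of the one-step estimates, which depend on \<open>M\<close>, and
  the time \<open>T\<close> adapted to them: M0 + C T \<le> M keeps the iterates in the range where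
  these estimates hold, and L T \<le> 1/2 keeps the amplification of errors from destroying their
  quadratic size.\<close>

locale diagonal_scheme = diagonal_system lam h k K
  for lam h k :: "'i::finite \<Rightarrow> ('i \<Rightarrow> real) \<Rightarrow> real" and K :: real +
  fixes w0 :: "'i \<Rightarrow> real \<Rightarrow> real" and Cf :: "real \<Rightarrow> real" and M0 M C L Q N T :: real
  assumes Cf: "\<bar>Cf s - Cf t\<bar> \<le> K * \<bar>s - t\<bar>"
    and M: "1 \<le> M" and w0: "tame 0 1 M0 (w0 i)" and w0_smooth: "\<exists>B. tame n 1 B (w0 i)"
    and T: "0 < T" "T \<le> 1" "M0 + C * T \<le> M" "L * T \<le> 1 / 2"
    and nonneg: "0 \<le> C" "0 \<le> L" "0 \<le> Q" "0 \<le> N"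
    and growth: "\<And>w \<delta> \<gamma> a i. 0 \<le> \<delta> \<Longrightarrow> \<bar>\<gamma>\<bar> \<le> K * \<delta> \<Longrightarrow> a \<le> M \<Longrightarrow> (\<forall>i. tame 0 1 a (w i)) \<Longrightarrow>
      tame 0 1 (a + C * \<delta>) (step \<delta> \<gamma> w i)"
    and stable: "\<And>w z \<delta> \<gamma> E i u. 0 \<le> \<delta> \<Longrightarrow> \<bar>\<gamma>\<bar> \<le> K * \<delta> \<Longrightarrow> (\<forall>i. tame 0 1 M (w i)) \<Longrightarrow>
      (\<forall>i u. \<bar>z i u\<bar> \<le> M) \<Longrightarrow> (\<forall>i u. \<bar>w i u - z i u\<bar> \<le> E) \<Longrightarrow>
      \<bar>step \<delta> \<gamma> w i u - step \<delta> \<gamma> z i u\<bar> \<le> (1 + L * \<delta>) * E"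
    and near: "\<And>w \<delta> \<gamma> i u. 0 \<le> \<delta> \<Longrightarrow> \<bar>\<gamma>\<bar> \<le> K * \<delta> \<Longrightarrow> (\<forall>i. tame 0 1 M (w i)) \<Longrightarrow>
      \<bar>step \<delta> \<gamma> w i u - w i u\<bar> \<le> N * \<delta>"
    and consistent: "\<And>w a b \<gamma> \<beta> i u. 0 \<le> a \<Longrightarrow> 0 \<le> b \<Longrightarrow> \<bar>\<beta>\<bar> \<le> K * b \<Longrightarrow> \<bar>\<gamma>\<bar> \<le> K * a \<Longrightarrow>
      (\<forall>i. tame 0 1 M (w i)) \<Longrightarrow> (\<forall>i. tame 0 1 M (step b \<beta> w i)) \<Longrightarrow>
      \<bar>step a \<gamma> (step b \<beta> w) i u - step (a + b) (\<beta> + \<gamma>) w i u\<bar> \<le> Q * (a * b)"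
begin

primrec iter :: "real \<Rightarrow> nat \<Rightarrow> 'i \<Rightarrow> real \<Rightarrow> real" where
  "iter \<tau> 0 = w0"
| "iter \<tau> (Suc n) = step \<tau> (Cf (real (Suc n) * \<tau>) - Cf (real n * \<tau>)) (iter \<tau> n)"

lemma Cf_increment: "0 \<le> \<tau> \<Longrightarrow> \<bar>Cf (real (n + j) * \<tau>) - Cf (real n * \<tau>)\<bar> \<le> K * (real j * \<tau>)"
  using Cf[of "real (n + j) * \<tau>" "real n * \<tau>"] by (simp add: algebra_simps abs_mult)

lemma Cf_increment1: "0 \<le> \<tau> \<Longrightarrow> \<bar>Cf (real (Suc n) * \<tau>) - Cf (real n * \<tau>)\<bar> \<le> K * \<tau>"
  using Cf_increment[of \<tau> n 1] by simp

lemma bound_le_M: "t \<le> T \<Longrightarrow> M0 + C * t \<le> M"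
  using T(3) mult_left_mono[of t T C] nonneg by linarith

lemma iter_tame0_sharp: "0 \<le> \<tau> \<Longrightarrow> real n * \<tau> \<le> T \<Longrightarrow> tame 0 1 (M0 + C * (real n * \<tau>)) (iter \<tau> n i)"
proof (induction n arbitrary: i)
  case 0
  then show ?case using w0 by simp
next
  case (Suc n)
  have "real n * \<tau> \<le> T" using Suc.prems by (simp add: distrib_right)
  then have "tame 0 1 (M0 + C * (real n * \<tau>) + C * \<tau>) (iter \<tau> (Suc n) i)"
    unfolding iter.simps using Suc Cf_increment1[of \<tau> n] bound_le_M by (intro growth) auto
  then show ?case by (simp add: algebra_simps)
qed

lemma iter_tame0: "0 \<le> \<tau> \<Longrightarrow> real n * \<tau> \<le> T \<Longrightarrow> tame 0 1 M (iter \<tau> n i)"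
  by (rule tame_mono[OF iter_tame0_sharp]) (use bound_le_M in auto)

lemma step_iter_tame0:
  assumes "0 \<le> \<tau>" "real (n + j) * \<tau> \<le> T"
  shows "tame 0 1 M (step (real j * \<tau>) (Cf (real (n + j) * \<tau>) - Cf (real n * \<tau>)) (iter \<tau> n) i)"
proof -
  have n: "real n * \<tau> \<le> T" using assms by (simp add: algebra_simps) (smt (verit) mult_nonneg_nonneg of_nat_0_le_iff)
  have "tame 0 1 (M0 + C * (real n * \<tau>) + C * (real j * \<tau>))
    (step (real j * \<tau>) (Cf (real (n + j) * \<tau>) - Cf (real n * \<tau>)) (iter \<tau> n) i)"
    by (rule growth) (use n assms Cf_increment bound_le_M iter_tame0_sharp in auto)
  moreover have "M0 + C * (real n * \<tau>) + C * (real j * \<tau>) \<le> M"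
    using bound_le_M[OF assms(2)] by (simp add: algebra_simps)
  ultimately show ?thesis by (rule tame_mono) auto
qed

text \<open>Many small steps are compared with a single long one. A further step multiplies the
  error so far by 1 + L \<tau>, and merging it with the long step costs a consistency defect of Q j
  \<tau>^2.\<close>

lemma iter_local:
  assumes "0 \<le> \<tau>" "real (n + j) * \<tau> \<le> T"
  shows "\<bar>iter \<tau> (n + j) i u - step (real j * \<tau>) (Cf (real (n + j) * \<tau>) - Cf (real n * \<tau>)) (iter \<tau> n) i u\<bar>
     \<le> Q * (real j * \<tau>)\<^sup>2"
  using assms(2)
proof (induction j arbitrary: i u)
  case 0
  then show ?case by (simp add: step_def)
next
  case (Suc j)
  define \<beta> where "\<beta> = Cf (real (n + j) * \<tau>) - Cf (real n * \<tau>)"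
  define \<gamma> where "\<gamma> = Cf (real (n + Suc j) * \<tau>) - Cf (real (n + j) * \<tau>)"
  have le: "real (n + j) * \<tau> \<le> T" "real n * \<tau> \<le> T" "real j * \<tau> \<le> T"
  proof -
    have "real m * \<tau> \<le> T" if "m \<le> n + Suc j" for m
      using mult_right_mono[of "real m" "real (n + Suc j)" \<tau>] that assms(1) Suc.prems by simp
    from this[of "n + j"] this[of n] this[of j]
    show "real (n + j) * \<tau> \<le> T" "real n * \<tau> \<le> T" "real j * \<tau> \<le> T" by auto
  qed
  have b: "\<bar>\<beta>\<bar> \<le> K * (real j * \<tau>)" "\<bar>\<gamma>\<bar> \<le> K * \<tau>"
    using Cf_increment[OF assms(1), of n j] Cf_increment1[OF assms(1), of "n + j"] by (auto simp: \<beta>_def \<gamma>_def)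
  have st: "tame 0 1 M (step (real j * \<tau>) \<beta> (iter \<tau> n) i)" for i
    unfolding \<beta>_def by (rule step_iter_tame0[OF assms(1) le(1)])
  have 1: "\<bar>step \<tau> \<gamma> (iter \<tau> (n + j)) i u - step \<tau> \<gamma> (step (real j * \<tau>) \<beta> (iter \<tau> n)) i u\<bar>
    \<le> (1 + L * \<tau>) * (Q * (real j * \<tau>)\<^sup>2)"
    by (rule stable) (use assms(1) b iter_tame0 le Suc.IH tame_abs_le[OF st] in \<open>auto simp: \<beta>_def\<close>)
  have 2: "\<bar>step \<tau> \<gamma> (step (real j * \<tau>) \<beta> (iter \<tau> n)) i u - step (\<tau> + real j * \<tau>) (\<beta> + \<gamma>) (iter \<tau> n) i u\<bar>
    \<le> Q * (\<tau> * (real j * \<tau>))"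
    by (rule consistent) (use assms(1) b iter_tame0 le st in auto)
  have "iter \<tau> (n + Suc j) = step \<tau> \<gamma> (iter \<tau> (n + j))" by (simp add: \<gamma>_def)
  moreover have "step (\<tau> + real j * \<tau>) (\<beta> + \<gamma>) = step (real (Suc j) * \<tau>) (Cf (real (n + Suc j) * \<tau>) - Cf (real n * \<tau>))"
    by (simp add: \<beta>_def \<gamma>_def algebra_simps)
  ultimately have "\<bar>iter \<tau> (n + Suc j) i u - step (real (Suc j) * \<tau>) (Cf (real (n + Suc j) * \<tau>) - Cf (real n * \<tau>)) (iter \<tau> n) i u\<bar>
    \<le> (1 + L * \<tau>) * (Q * (real j * \<tau>)\<^sup>2) + Q * (\<tau> * (real j * \<tau>))"
    using 1 2 by (simp del: iter.simps)
  also have "\<dots> \<le> Q * (real (Suc j) * \<tau>)\<^sup>2"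
  proof -
    \<comment> \<open>Passing from j^2 to (j + 1)^2 leaves room for 2 j + 1. The new defect takes j
      of it, and L T \<le> 1/2 limits the amplification of the old error to j/2.\<close>
    have "L * (real j * \<tau>) \<le> 1 / 2" using mult_left_mono[OF le(3) nonneg(2)] T by linarith
    from mult_left_mono[OF this, of "real j"] have "L * \<tau> * (real j)\<^sup>2 \<le> real j / 2" by (simp add: power2_eq_square mult_ac)
    then have "(1 + L * \<tau>) * (real j)\<^sup>2 + real j \<le> (real (Suc j))\<^sup>2"
      by (simp add: power2_eq_square algebra_simps)
    then have "Q * \<tau>\<^sup>2 * ((1 + L * \<tau>) * (real j)\<^sup>2 + real j) \<le> Q * \<tau>\<^sup>2 * (real (Suc j))\<^sup>2"
      using nonneg by (intro mult_left_mono) auto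
    then show ?thesis by (simp add: power2_eq_square algebra_simps)
  qed
  finally show ?case .
qed

text \<open>Two half steps differ from one full step by Q \<tau>^2, which is
  \<open>iter_local\<close> for two steps. Summation gives a global error of first order in \<tau>;
  the factor 2 absorbs the amplification by stability, again because L T \<le> 1/2.\<close>

lemma iter_refine:
  assumes "0 \<le> \<tau>"
  shows "real n * \<tau> \<le> T \<Longrightarrow> \<bar>iter \<tau> n i u - iter (\<tau> / 2) (2 * n) i u\<bar> \<le> 2 * Q * (real n * \<tau>) * \<tau>"
proof (induction n arbitrary: i u)
  case 0
  then show ?case by simp
next
  case (Suc n)
  have n: "real n * \<tau> \<le> T" using Suc.prems assms by (simp add: algebra_simps)
  define \<gamma> where "\<gamma> = Cf (real (Suc n) * \<tau>) - Cf (real n * \<tau>)"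
  have b: "\<bar>\<gamma>\<bar> \<le> K * \<tau>" using Cf_increment1[OF assms, of n] by (simp add: \<gamma>_def)
  have 1: "\<bar>step \<tau> \<gamma> (iter \<tau> n) i u - step \<tau> \<gamma> (iter (\<tau> / 2) (2 * n)) i u\<bar>
    \<le> (1 + L * \<tau>) * (2 * Q * (real n * \<tau>) * \<tau>)"
  proof (rule stable)
    show "\<forall>i u. \<bar>iter (\<tau> / 2) (2 * n) i u\<bar> \<le> M"
      using tame_abs_le[OF iter_tame0] n assms by simp
  qed (use assms b iter_tame0 n Suc.IH in auto)
  have e: "real (2 * n + 2) * (\<tau> / 2) = real (Suc n) * \<tau>" "real (2 * n) * (\<tau> / 2) = real n * \<tau>" "real 2 * (\<tau> / 2) = \<tau>"
    by (simp_all add: field_simps)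
  have 2: "\<bar>iter (\<tau> / 2) (2 * n + 2) i u - step \<tau> \<gamma> (iter (\<tau> / 2) (2 * n)) i u\<bar> \<le> Q * \<tau>\<^sup>2"
    using iter_local[of "\<tau> / 2" "2 * n" 2 i u, unfolded e, OF _ Suc.prems] assms unfolding \<gamma>_def by simp
  have "\<bar>iter \<tau> (Suc n) i u - iter (\<tau> / 2) (2 * Suc n) i u\<bar> \<le> (1 + L * \<tau>) * (2 * Q * (real n * \<tau>) * \<tau>) + Q * \<tau>\<^sup>2"
    using 1 2 unfolding \<gamma>_def by (simp add: eval_nat_numeral)
  also have "\<dots> \<le> 2 * Q * (real (Suc n) * \<tau>) * \<tau>"
  proof -
    have "L * (real n * \<tau>) \<le> 1 / 2" using mult_left_mono[OF n nonneg(2)] T by linarith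
    then have "2 * Q * \<tau>\<^sup>2 * (L * (real n * \<tau>)) \<le> 2 * Q * \<tau>\<^sup>2 * (1 / 2)"
      using nonneg by (intro mult_left_mono) auto
    then show ?thesis by (simp add: power2_eq_square algebra_simps)
  qed
  finally show ?case .
qed

definition approx :: "nat \<Rightarrow> real \<Rightarrow> 'i \<Rightarrow> real \<Rightarrow> real" where
  "approx m t = iter (1 / 2 ^ m) (nat \<lfloor>t * 2 ^ m\<rfloor>)"

lemma dyadic_floor:
  assumes "0 \<le> t" shows "real (nat \<lfloor>t * 2 ^ m\<rfloor>) * (1 / 2 ^ m) \<le> t" "t < real (nat \<lfloor>t * 2 ^ m\<rfloor>) * (1 / 2 ^ m) + 1 / 2 ^ m"
proof -
  have "real (nat \<lfloor>t * 2 ^ m\<rfloor>) \<le> t * 2 ^ m" "t * 2 ^ m < real (nat \<lfloor>t * 2 ^ m\<rfloor>) + 1"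
    using assms by (auto simp: of_nat_nat)
  then show "real (nat \<lfloor>t * 2 ^ m\<rfloor>) * (1 / 2 ^ m) \<le> t" "t < real (nat \<lfloor>t * 2 ^ m\<rfloor>) * (1 / 2 ^ m) + 1 / 2 ^ m"
    by (auto simp: field_simps)
qed

lemma approx_tame0: "0 \<le> t \<Longrightarrow> t \<le> T \<Longrightarrow> tame 0 1 M (approx m t i)"
  unfolding approx_def using dyadic_floor(1)[of t m] by (intro iter_tame0) auto

text \<open>The number of steps at level m + 1 is twice that at level m, or one more. The term 2 Q
  is the refinement error for total time at most 1, and \<open>N\<close> accounts for the possible
  extra half step.\<close>

lemma approx_refine:
  assumes "0 \<le> t" "t \<le> T"
  shows "\<bar>approx (Suc m) t i u - approx m t i u\<bar> \<le> (2 * Q + N) / 2 ^ m"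
proof -
  define n where "n = nat \<lfloor>t * 2 ^ m\<rfloor>"
  define \<tau> :: real where "\<tau> = 1 / 2 ^ m"
  have \<tau>: "0 \<le> \<tau>" "1 / 2 ^ Suc m = \<tau> / 2" by (simp_all add: \<tau>_def)
  have nT: "real n * \<tau> \<le> T" using dyadic_floor(1)[OF assms(1), of m] assms by (simp add: n_def \<tau>_def)
  have a: "approx m t = iter \<tau> n" by (simp add: approx_def n_def \<tau>_def)
  have "\<lfloor>t * 2 ^ Suc m\<rfloor> = 2 * \<lfloor>t * 2 ^ m\<rfloor> \<or> \<lfloor>t * 2 ^ Suc m\<rfloor> = 2 * \<lfloor>t * 2 ^ m\<rfloor> + 1"
    by simp linarith
  moreover have "0 \<le> \<lfloor>t * 2 ^ m\<rfloor>" using assms by simp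
  ultimately have "nat \<lfloor>t * 2 ^ Suc m\<rfloor> = 2 * n \<or> nat \<lfloor>t * 2 ^ Suc m\<rfloor> = Suc (2 * n)"
    unfolding n_def by linarith
  then have b: "approx (Suc m) t = iter (\<tau> / 2) (2 * n) \<or> approx (Suc m) t = iter (\<tau> / 2) (Suc (2 * n))"
    unfolding approx_def \<tau> by metis
  have r: "\<bar>iter \<tau> n i u - iter (\<tau> / 2) (2 * n) i u\<bar> \<le> 2 * Q * \<tau>"
  proof -
    have "2 * Q * (real n * \<tau>) * \<tau> \<le> 2 * Q * 1 * \<tau>"
      using nT T \<tau> nonneg by (intro mult_right_mono mult_left_mono) auto
    then show ?thesis using iter_refine[OF \<tau>(1) nT, of i u] by simp
  qed
  have s: "\<bar>iter (\<tau> / 2) (Suc (2 * n)) i u - iter (\<tau> / 2) (2 * n) i u\<bar> \<le> N * (\<tau> / 2)"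
    unfolding iter.simps by (rule near) (use \<tau> nT Cf_increment1[of "\<tau> / 2" "2 * n"] iter_tame0 in auto)
  have "N * (\<tau> / 2) \<le> N * \<tau>" using nonneg \<tau> by (intro mult_left_mono) auto
  moreover have "0 \<le> N * \<tau>" using nonneg \<tau> by simp
  ultimately have "\<bar>approx (Suc m) t i u - approx m t i u\<bar> \<le> 2 * Q * \<tau> + N * \<tau>"
    using b r s unfolding a by (smt (verit, best))
  then show ?thesis by (simp add: \<tau>_def field_simps)
qed

text \<open>The limit is chosen through its rate of convergence, which does not depend on
  \<open>u\<close>; uniformity is thus part of the definition. The value is arbitrary outside the
  time interval.\<close>

definition sol :: "real \<Rightarrow> 'i \<Rightarrow> real \<Rightarrow> real" where
  "sol t i u = (SOME l. \<forall>m. \<bar>approx m t i u - l\<bar> \<le> 2 * (2 * Q + N) / 2 ^ m)"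

lemma approx_sol:
  assumes "0 \<le> t" "t \<le> T" shows "\<bar>approx m t i u - sol t i u\<bar> \<le> 2 * (2 * Q + N) / 2 ^ m"
proof -
  have "\<exists>l. \<forall>m. \<bar>approx m t i u - l\<bar> \<le> 2 * (2 * Q + N) / 2 ^ m"
    by (rule geometric_Cauchy_limit) (rule approx_refine[OF assms])
  from someI_ex[OF this] show ?thesis unfolding sol_def by blast
qed

lemma approx_uniform_limit:
  assumes "0 \<le> t" "t \<le> T" shows "uniform_limit UNIV (\<lambda>m. approx m t i) (sol t i) sequentially"
proof (rule uniform_limitI)
  fix e :: real assume e: "0 < e"
  have "(\<lambda>m. 2 * (2 * Q + N) / 2 ^ m) \<longlonglongrightarrow> 0" by (rule LIMSEQ_divide_realpow_zero) simp
  from order_tendstoD(2)[OF this e] show "\<forall>\<^sub>F m in sequentially. \<forall>u\<in>UNIV. dist (approx m t i u) (sol t i u) < e"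
    by eventually_elim (use approx_sol[OF assms] in \<open>auto simp: dist_real_def intro: le_less_trans\<close>)
qed

lemma approx_LIMSEQ: "0 \<le> t \<Longrightarrow> t \<le> T \<Longrightarrow> (\<lambda>m. approx m t i u) \<longlonglongrightarrow> sol t i u"
  using tendsto_uniform_limitI[OF approx_uniform_limit UNIV_I] .

lemma sol_0: "sol 0 i u = w0 i u"
proof -
  have "(\<lambda>m. approx m 0 i u) \<longlonglongrightarrow> sol 0 i u"
    using approx_LIMSEQ T by simp
  then show ?thesis by (simp add: approx_def LIMSEQ_const_iff)
qed

lemma iter_periodic:
  assumes "\<And>i u. w0 i (u + p) = w0 i u" shows "iter \<tau> n i (u + p) = iter \<tau> n i u"
proof (induction n arbitrary: i u)
  case (Suc n)
  have "iter \<tau> n i (u + p + x) = iter \<tau> n i (u + x)" for i x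
    using Suc[of i "u + x"] by (simp add: add_ac)
  then show ?case using Suc by (simp add: step_def)
qed (use assms in simp)

lemma sol_periodic:
  assumes "\<And>i u. w0 i (u + p) = w0 i u" "0 \<le> t" "t \<le> T" shows "sol t i (u + p) = sol t i u"
proof -
  have "(\<lambda>m. approx m t i u) \<longlonglongrightarrow> sol t i u" for u
    using approx_LIMSEQ assms by simp
  from this[of u] this[of "u + p"] show ?thesis
    by (simp add: approx_def iter_periodic[OF assms(1)] LIMSEQ_unique)
qed

text \<open>The first derivatives of the initial data obey the bound M0 \<le> M, whatever constants
  bound the higher ones; a small weight accommodates those, and the least of finitely many weights
  serves all components.\<close>

lemma w0_tame: "\<exists>e>0. e \<le> 1 \<and> (\<forall>i. tame n e M (w0 i))"
proof -
  have "\<exists>e>0. e \<le> 1 \<and> tame n e M (w0 i)" for i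
  proof -
    obtain B where "tame n 1 B (w0 i)" using w0_smooth by blast
    then obtain w' where w': "\<And>u. (w0 i has_real_derivative w' u) (at u)" "dbound n 1 B w'"
      by (auto simp: tame_def)
    obtain w'' where w'': "\<And>u. (w0 i has_real_derivative w'' u) (at u)" "\<And>u. \<bar>w'' u\<bar> \<le> M0"
      using w0[of i] unfolding tame_def by auto
    have le: "M0 \<le> M" using bound_le_M[of 0] T by simp
    have "w' = w''" using w'(1) w''(1) DERIV_unique by blast
    then have "\<bar>w' u\<bar> \<le> M0" for u using w''(2)[of u] by simp
    then have "\<bar>w' u\<bar> \<le> M" for u using le order_trans by blast
    from dbound_shrink[OF w'(2) this] M obtain e where "0 < e" "e \<le> 1" "dbound n e M w'" by auto
    moreover have "\<bar>w0 i u\<bar> \<le> M" for u using tame_abs_le[OF w0[of i], of u] le by linarith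
    ultimately show ?thesis using w'(1) tameI by blast
  qed
  then obtain f where f: "\<And>i. 0 < f i" "\<And>i. f i \<le> 1" "\<And>i. tame n (f i) M (w0 i)" by metis
  define e where "e = Min (range f)"
  have e: "0 < e" "e \<le> f i" for i using f(1) by (auto simp: e_def)
  then show ?thesis using f tame_mono by (metis order_refl order_trans)
qed

text \<open>A discrete Gronwall argument: each step divides the weight by 1 + A \<tau>, and total
  time at most T keeps it above e0 exp(-A T). The constant \<open>A\<close> depends on
  \<open>n\<close>, but \<open>T\<close> does not, so one life span serves all orders of
  differentiability.\<close>

lemma iter_tame: "\<exists>e>0. e \<le> 1 \<and> (\<forall>\<tau> j i. 0 \<le> \<tau> \<longrightarrow> \<tau> \<le> 1 \<longrightarrow> real j * \<tau> \<le> T \<longrightarrow> tame n e M (iter \<tau> j i))"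
proof -
  obtain e0 where e0: "0 < e0" "e0 \<le> 1" "\<And>i. tame n e0 M (w0 i)" using w0_tame by blast
  from step_tame[OF M, of n] obtain A where A: "0 \<le> A"
    "\<And>w \<delta> \<gamma> e i. 0 \<le> \<delta> \<Longrightarrow> \<delta> \<le> 1 \<Longrightarrow> \<bar>\<gamma>\<bar> \<le> K * \<delta> \<Longrightarrow> 0 < e \<Longrightarrow> e \<le> 1 \<Longrightarrow>
     (\<forall>i. tame n e M (w i)) \<Longrightarrow> (\<forall>i. tame 0 1 M (step \<delta> \<gamma> w i)) \<Longrightarrow>
     tame n (e / (1 + A * \<delta>)) M (step \<delta> \<gamma> w i)" by blast
  have *: "tame n (e0 / (1 + A * \<tau>) ^ j) M (iter \<tau> j i)" if "0 \<le> \<tau>" "\<tau> \<le> 1" "real j * \<tau> \<le> T" for \<tau> j i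
    using that(3)
  proof (induction j arbitrary: i)
    case 0
    then show ?case using e0 by simp
  next
    case (Suc j)
    have j: "real j * \<tau> \<le> T" using Suc.prems that(1) by (simp add: algebra_simps)
    have p: "1 \<le> (1 + A * \<tau>) ^ j" using A(1) that(1) by simp
    have "tame n (e0 / (1 + A * \<tau>) ^ j / (1 + A * \<tau>)) M (iter \<tau> (Suc j) i)"
      unfolding iter.simps
    proof (rule A(2))
      show "\<forall>i. tame 0 1 M (step \<tau> (Cf (real (Suc j) * \<tau>) - Cf (real j * \<tau>)) (iter \<tau> j) i)"
        using iter_tame0[OF that(1) Suc.prems] by simp
      show "e0 / (1 + A * \<tau>) ^ j \<le> 1" using p e0 by (simp add: field_simps)
      show "0 < e0 / (1 + A * \<tau>) ^ j" using p e0 by simp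
    qed (use that Cf_increment1 Suc.IH j in auto)
    then show ?case by (simp add: field_simps)
  qed
  show ?thesis
  proof (intro exI[of _ "e0 / exp (A * T)"] conjI allI impI)
    have "1 \<le> exp (A * T)" using A(1) T(1) by simp
    with e0(2) have "e0 \<le> exp (A * T)" by (rule order_trans)
    then show "e0 / exp (A * T) \<le> 1" by simp
    fix \<tau> j i assume a: "0 \<le> \<tau>" "\<tau> \<le> 1" "real j * \<tau> \<le> T"
    have "(1 + A * \<tau>) ^ j \<le> exp (A * \<tau>) ^ j" using A(1) a by (intro power_mono) auto
    also have "\<dots> = exp (A * (real j * \<tau>))" by (simp add: exp_of_nat_mult[symmetric] mult_ac)
    also have "\<dots> \<le> exp (A * T)" using a A(1) by (simp add: mult_left_mono)
    finally have "(1 + A * \<tau>) ^ j \<le> exp (A * T)" .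
    moreover have "0 < (1 + A * \<tau>) ^ j" using A(1) a by (simp add: add_pos_nonneg)
    ultimately have "e0 / exp (A * T) \<le> e0 / (1 + A * \<tau>) ^ j" using e0 by (intro divide_left_mono) auto
    then show "tame n (e0 / exp (A * T)) M (iter \<tau> j i)"
      using tame_mono[OF *[OF a]] e0 by simp
  qed (use e0 in auto)
qed

lemma sol_tame: "\<exists>e>0. e \<le> 1 \<and> (\<forall>t i. 0 \<le> t \<longrightarrow> t \<le> T \<longrightarrow> tame n e M (sol t i))"
proof -
  obtain e where e: "0 < e" "e \<le> 1"
    "\<And>\<tau> j i. 0 \<le> \<tau> \<Longrightarrow> \<tau> \<le> 1 \<Longrightarrow> real j * \<tau> \<le> T \<Longrightarrow> tame (Suc n) e M (iter \<tau> j i)"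
    using iter_tame[of "Suc n"] by blast
  have "tame n e M (sol t i)" if t: "0 \<le> t" "t \<le> T" for t i
  proof (rule tame_uniform_limit[OF _ approx_uniform_limit[OF t]])
    show "tame (Suc n) e M (approx m t i)" for m
      unfolding approx_def using dyadic_floor(1)[OF t(1), of m] t by (intro e(3)) auto
  qed
  then show ?thesis using e by blast
qed

lemma sol_tame0: "0 \<le> t \<Longrightarrow> t \<le> T \<Longrightarrow> tame 0 1 M (sol t i)"
proof -
  assume t: "0 \<le> t" "t \<le> T"
  obtain e where "tame 0 e M (sol t i)" using sol_tame[of 0] t by blast
  then show ?thesis by (simp add: tame_def)
qed

text \<open>The limit of \<open>iter_local\<close> along the dyadic times below \<open>s\<close> and
  \<open>t\<close>. It is the integrated form of the differential equation: from time
  \<open>s\<close> on, \<open>sol\<close> follows a single step up to an error quadratic in t -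
  s.\<close>

lemma sol_local:
  assumes "0 \<le> s" "s \<le> t" "t \<le> T"
  shows "\<bar>sol t i u - step (t - s) (Cf t - Cf s) (sol s) i u\<bar> \<le> Q * (t - s)\<^sup>2"
proof -
  define n where "n m = nat \<lfloor>s * 2 ^ m\<rfloor>" for m :: nat
  define n' where "n' m = nat \<lfloor>t * 2 ^ m\<rfloor>" for m :: nat
  define \<sigma> where "\<sigma> m = real (n m) * (1 / 2 ^ m)" for m :: nat
  define \<sigma>' where "\<sigma>' m = real (n' m) * (1 / 2 ^ m)" for m :: nat
  have t0: "0 \<le> t" "s \<le> T" using assms by auto
  have sm: "\<sigma> m \<le> s" "s < \<sigma> m + 1 / 2 ^ m" "\<sigma>' m \<le> t" "t < \<sigma>' m + 1 / 2 ^ m" for m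
    using dyadic_floor[OF assms(1), of m] dyadic_floor[OF t0(1), of m] by (simp_all add: \<sigma>_def \<sigma>'_def n_def n'_def)
  have nn: "n m \<le> n' m" for m unfolding n_def n'_def using assms by (intro nat_mono floor_mono mult_right_mono) auto
  have p: "(\<lambda>m. c / 2 ^ m) \<longlonglongrightarrow> 0" for c :: real by (rule LIMSEQ_divide_realpow_zero) simp
  have lims: "\<sigma> \<longlonglongrightarrow> s" "\<sigma>' \<longlonglongrightarrow> t"
  proof -
    have "(\<lambda>m. s - 1 / 2 ^ m) \<longlonglongrightarrow> s" "(\<lambda>m. t - 1 / 2 ^ m) \<longlonglongrightarrow> t"
      using tendsto_diff[OF tendsto_const p[of 1], of s] tendsto_diff[OF tendsto_const p[of 1], of t] by auto
    note p1 = this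
    have "s - 1 / 2 ^ m \<le> \<sigma> m" "t - 1 / 2 ^ m \<le> \<sigma>' m" for m using sm[of m] by linarith+
    then show "\<sigma> \<longlonglongrightarrow> s" "\<sigma>' \<longlonglongrightarrow> t"
      using tendsto_sandwich[OF _ _ p1(1) tendsto_const, of \<sigma>] tendsto_sandwich[OF _ _ p1(2) tendsto_const, of \<sigma>'] sm
      by (auto intro!: always_eventually)
  qed
  have Cf_lim: "(\<lambda>m. Cf (f m)) \<longlonglongrightarrow> Cf x" if "f \<longlonglongrightarrow> x" for f x
  proof -
    have "(\<lambda>m. K * \<bar>f m - x\<bar>) \<longlonglongrightarrow> 0"
      using tendsto_mult_right_zero[OF tendsto_rabs_zero[OF LIM_zero[OF that]]] .
    then have "(\<lambda>m. Cf (f m) - Cf x) \<longlonglongrightarrow> 0"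
      by (rule Lim_null_comparison[rotated]) (use Cf in \<open>auto intro!: always_eventually\<close>)
    then show ?thesis by (rule LIM_zero_cancel)
  qed
  define \<delta> where "\<delta> m = \<sigma>' m - \<sigma> m" for m
  define \<gamma> where "\<gamma> m = Cf (\<sigma>' m) - Cf (\<sigma> m)" for m
  have \<delta>_eq: "\<delta> m = real (n' m - n m) * (1 / 2 ^ m)" for m
    using nn[of m] by (simp add: \<delta>_def \<sigma>_def \<sigma>'_def of_nat_diff field_simps)
  have \<delta>0: "0 \<le> \<delta> m" for m by (simp add: \<delta>_eq)
  have \<gamma>: "\<bar>\<gamma> m\<bar> \<le> K * \<delta> m" for m using Cf[of "\<sigma>' m" "\<sigma> m"] \<delta>0[of m] by (simp add: \<gamma>_def \<delta>_def)
  have 1: "\<bar>approx m t i u - step (\<delta> m) (\<gamma> m) (approx m s) i u\<bar> \<le> Q * (\<delta> m)\<^sup>2" for m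
  proof -
    have "real (n m + (n' m - n m)) * (1 / 2 ^ m) \<le> T" using sm(3)[of m] assms nn[of m] by (simp add: \<sigma>'_def)
    from iter_local[OF _ this, of i u] show ?thesis using nn[of m]
      unfolding \<delta>_eq by (simp add: approx_def \<gamma>_def \<sigma>_def \<sigma>'_def flip: n_def n'_def)
  qed
  have 2: "\<bar>step (\<delta> m) (\<gamma> m) (approx m s) i u - step (\<delta> m) (\<gamma> m) (sol s) i u\<bar> \<le> (1 + L * \<delta> m) * (2 * (2 * Q + N) / 2 ^ m)" for m
    by (rule stable) (use \<delta>0 \<gamma> approx_tame0 assms t0 approx_sol tame_abs_le[OF sol_tame0] in auto)
  have \<delta>lim: "\<delta> \<longlonglongrightarrow> t - s" "\<gamma> \<longlonglongrightarrow> Cf t - Cf s"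
    unfolding \<delta>_def \<gamma>_def by (intro tendsto_intros Cf_lim lims)+
  \<comment> \<open>The limit is taken in two stages: stability first replaces the approximate state
    at time \<open>s\<close> by its limit, then continuity of \<open>sol s\<close> handles the
    convergence of the step parameters.\<close>
  have "(\<lambda>m. step (\<delta> m) (\<gamma> m) (approx m s) i u - step (\<delta> m) (\<gamma> m) (sol s) i u) \<longlonglongrightarrow> 0"
  proof (rule Lim_null_comparison)
    show "(\<lambda>m. (1 + L * \<delta> m) * (2 * (2 * Q + N) / 2 ^ m)) \<longlonglongrightarrow> 0"
      using tendsto_mult[OF tendsto_add[OF tendsto_const tendsto_mult[OF tendsto_const \<delta>lim(1)]] p] by simp
  qed (use 2 in \<open>auto intro!: always_eventually\<close>)
  moreover have "(\<lambda>m. step (\<delta> m) (\<gamma> m) (sol s) i u) \<longlonglongrightarrow> step (t - s) (Cf t - Cf s) (sol s) i u"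
  proof -
    have "isCont (sol s i) x" for x
      using sol_tame0[OF assms(1) t0(2), of i] DERIV_isCont unfolding tame_def by blast
    then have "(\<lambda>m. sol s i (u + \<delta> m * l)) \<longlonglongrightarrow> sol s i (u + (t - s) * l)" for l
      by (intro isCont_tendsto_compose[of _ "sol s i"] tendsto_add tendsto_mult tendsto_const \<delta>lim)
    then show ?thesis unfolding step_def by (intro tendsto_add tendsto_mult tendsto_const \<delta>lim)
  qed
  ultimately have "(\<lambda>m. step (\<delta> m) (\<gamma> m) (approx m s) i u) \<longlonglongrightarrow> step (t - s) (Cf t - Cf s) (sol s) i u"
    by (rule Lim_transform[rotated])
  moreover have "(\<lambda>m. approx m t i u) \<longlonglongrightarrow> sol t i u"
    using approx_LIMSEQ t0 assms by simp
  ultimately have "(\<lambda>m. \<bar>approx m t i u - step (\<delta> m) (\<gamma> m) (approx m s) i u\<bar>) \<longlonglongrightarrow> \<bar>sol t i u - step (t - s) (Cf t - Cf s) (sol s) i u\<bar>"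
    by (intro tendsto_intros)
  moreover have "(\<lambda>m. Q * (\<delta> m)\<^sup>2) \<longlonglongrightarrow> Q * (t - s)\<^sup>2" by (intro tendsto_intros \<delta>lim)
  ultimately show ?thesis using 1 by (intro LIMSEQ_le) auto
qed

lemma sol_time_Lipschitz:
  assumes "0 \<le> s" "s \<le> t" "t \<le> T"
  shows "\<bar>sol t i u - sol s i u\<bar> \<le> (Q + N) * (t - s)"
proof -
  have "\<bar>Cf t - Cf s\<bar> \<le> K * (t - s)" using Cf[of t s] assms by simp
  then have "\<bar>step (t - s) (Cf t - Cf s) (sol s) i u - sol s i u\<bar> \<le> N * (t - s)"
    using assms sol_tame0 by (intro near) auto
  moreover have "(t - s)\<^sup>2 \<le> t - s"
    unfolding power2_eq_square using assms T by (intro mult_left_le) auto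
  then have "Q * (t - s)\<^sup>2 \<le> Q * (t - s)" using nonneg by (intro mult_left_mono) auto
  ultimately show ?thesis using sol_local[OF assms, of i u] by (simp add: distrib_right)
qed

end

section \<open>Existence and uniqueness for diagonal systems\<close>

lemma nice_continuous_on:
  "nice H \<Longrightarrow> (\<And>j. continuous_on S (w j)) \<Longrightarrow> continuous_on S (\<lambda>x. H (\<lambda>j. w j x))"
proof (induction rule: nice.induct)
  case (nice_comp H \<psi>)
  have "continuous_on UNIV (\<psi> 0)"
    using nice_comp.hyps(2)[of 0] by (auto intro!: continuous_at_imp_continuous_on DERIV_isCont)
  from continuous_on_compose2[OF this nice_comp.IH[OF nice_comp.prems]] show ?case by simp
qed (auto intro!: continuous_intros)

text \<open>Separate continuity does not imply joint continuity; a Lipschitz bound in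
  \<open>u\<close> that is uniform in \<open>t\<close> closes the gap.\<close>

lemma continuous_on_Lipschitz_fst:
  fixes f :: "real \<Rightarrow> real \<Rightarrow> 'a::real_normed_vector"
  assumes t: "\<And>u. continuous_on I (f u)" and u: "\<And>u v t. t \<in> I \<Longrightarrow> norm (f u t - f v t) \<le> B * \<bar>u - v\<bar>"
  shows "continuous_on (UNIV \<times> I) (\<lambda>(u, t). f u t)"
  unfolding continuous_on_def
proof
  fix x :: "real \<times> real" assume x: "x \<in> UNIV \<times> I"
  let ?F = "at x within UNIV \<times> I"
  have "continuous_on (UNIV \<times> I) (\<lambda>y. f (fst x) (snd y))"
    by (rule continuous_on_compose2[OF t continuous_on_snd]) auto
  then have 1: "((\<lambda>y. f (fst x) (snd y)) \<longlongrightarrow> f (fst x) (snd x)) ?F"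
    using x unfolding continuous_on_def by blast
  have "((\<lambda>y. B * \<bar>fst y - fst x\<bar> + norm (f (fst x) (snd y) - f (fst x) (snd x))) \<longlongrightarrow>
      B * \<bar>fst x - fst x\<bar> + norm (f (fst x) (snd x) - f (fst x) (snd x))) ?F"
    by (intro tendsto_add tendsto_mult tendsto_rabs tendsto_norm tendsto_diff tendsto_const tendsto_fst tendsto_ident_at 1)
  then have 2: "((\<lambda>y. B * \<bar>fst y - fst x\<bar> + norm (f (fst x) (snd y) - f (fst x) (snd x))) \<longlongrightarrow> 0) ?F" by simp
  have "((\<lambda>y. f (fst y) (snd y) - f (fst x) (snd x)) \<longlongrightarrow> 0) ?F"
  proof (rule Lim_null_comparison[OF _ 2])
    have "norm (f (fst y) (snd y) - f (fst x) (snd x)) \<le> B * \<bar>fst y - fst x\<bar> + norm (f (fst x) (snd y) - f (fst x) (snd x))"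
      if "snd y \<in> I" for y
      using u[OF that, of "fst y" "fst x"]
        norm_triangle_ineq[of "f (fst y) (snd y) - f (fst x) (snd y)" "f (fst x) (snd y) - f (fst x) (snd x)"] by simp
    then show "\<forall>\<^sub>F y in ?F. norm (f (fst y) (snd y) - f (fst x) (snd x))
       \<le> B * \<bar>fst y - fst x\<bar> + norm (f (fst x) (snd y) - f (fst x) (snd x))"
      by (auto simp: eventually_at_filter intro!: always_eventually)
  qed
  then show "((\<lambda>(u, t). f u t) \<longlongrightarrow> (case x of (u, t) \<Rightarrow> f u t)) ?F"
    by (simp add: case_prod_beta LIM_zero_cancel)
qed

text \<open>The error term is anchored at the earlier of the two times, so continuity of the
  coefficients is what makes the derivative two-sided.\<close>

lemma derivative_from_local_expansion:
  fixes g D \<kappa> Cf :: "real \<Rightarrow> real"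
  assumes g: "\<And>s t. 0 \<le> s \<Longrightarrow> s \<le> t \<Longrightarrow> t \<le> T \<Longrightarrow>
      \<bar>g t - g s - (t - s) * D s - (Cf t - Cf s) * \<kappa> s\<bar> \<le> Q * (t - s)\<^sup>2"
    and cont: "continuous_on {0..T} D" "continuous_on {0..T} \<kappa>"
    and Cf: "\<And>s t. \<bar>Cf s - Cf t\<bar> \<le> K * \<bar>s - t\<bar>"
    and t: "t \<in> {0..T}" and c: "(Cf has_real_derivative c) (at t within {0..T})"
  shows "(g has_real_derivative D t + c * \<kappa> t) (at t within {0..T})"
proof -
  let ?F = "at t within {0..T}"
  define err where "err s = Q * \<bar>s - t\<bar> + \<bar>D s - D t\<bar> + K * \<bar>\<kappa> s - \<kappa> t\<bar>" for s
  have K: "0 \<le> K" using Cf[of 0 1] by simp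
  have "(err \<longlongrightarrow> Q * \<bar>t - t\<bar> + \<bar>D t - D t\<bar> + K * \<bar>\<kappa> t - \<kappa> t\<bar>) ?F"
    unfolding err_def using cont t
    by (intro tendsto_add tendsto_mult tendsto_rabs tendsto_diff tendsto_const tendsto_ident_at) (auto simp: continuous_on_def)
  then have err: "(err \<longlongrightarrow> 0) ?F" by simp
  have bound: "\<bar>(g s - g t) / (s - t) - D t - (Cf s - Cf t) / (s - t) * \<kappa> t\<bar> \<le> err s"
    if s: "s \<in> {0..T}" "s \<noteq> t" for s
  proof -
    have "\<bar>g s - g t - (s - t) * D t - (Cf s - Cf t) * \<kappa> t\<bar> \<le> \<bar>s - t\<bar> * err s"
    proof (cases "t \<le> s")
      case True
      have "\<bar>g s - g t - (s - t) * D t - (Cf s - Cf t) * \<kappa> t\<bar> \<le> \<bar>s - t\<bar> * (Q * \<bar>s - t\<bar>)"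
        using g[of t s] True s t by (simp add: power2_eq_square mult_ac)
      also have "\<dots> \<le> \<bar>s - t\<bar> * err s" using K by (intro mult_left_mono) (auto simp: err_def)
      finally show ?thesis .
    next
      case False
      have 1: "\<bar>g t - g s - (t - s) * D s - (Cf t - Cf s) * \<kappa> s\<bar> \<le> \<bar>s - t\<bar> * (Q * \<bar>s - t\<bar>)"
        using g[of s t] False s t by (simp add: power2_eq_square mult_ac)
      have 2: "\<bar>(s - t) * (D s - D t)\<bar> \<le> \<bar>s - t\<bar> * \<bar>D s - D t\<bar>" by (simp add: abs_mult)
      have 3: "\<bar>(Cf s - Cf t) * (\<kappa> s - \<kappa> t)\<bar> \<le> K * \<bar>s - t\<bar> * \<bar>\<kappa> s - \<kappa> t\<bar>"
        unfolding abs_mult by (intro mult_right_mono Cf) simp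
      have "g s - g t - (s - t) * D t - (Cf s - Cf t) * \<kappa> t =
          - (g t - g s - (t - s) * D s - (Cf t - Cf s) * \<kappa> s) + (s - t) * (D s - D t) + (Cf s - Cf t) * (\<kappa> s - \<kappa> t)"
        by (simp add: algebra_simps)
      also have "\<bar>\<dots>\<bar> \<le> \<bar>s - t\<bar> * (Q * \<bar>s - t\<bar>) + \<bar>s - t\<bar> * \<bar>D s - D t\<bar> + K * \<bar>s - t\<bar> * \<bar>\<kappa> s - \<kappa> t\<bar>"
        by (intro order_trans[OF abs_triangle_ineq] add_mono 2 3) (use 1 in \<open>simp add: abs_minus_commute\<close>)
      finally show ?thesis by (simp add: err_def algebra_simps)
    qed
    then have "\<bar>g s - g t - (s - t) * D t - (Cf s - Cf t) * \<kappa> t\<bar> / \<bar>s - t\<bar> \<le> err s"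
      using s by (simp add: field_simps)
    also have "\<bar>g s - g t - (s - t) * D t - (Cf s - Cf t) * \<kappa> t\<bar> / \<bar>s - t\<bar> =
      \<bar>(g s - g t) / (s - t) - D t - (Cf s - Cf t) / (s - t) * \<kappa> t\<bar>"
    proof -
      have "(g s - g t - (s - t) * D t - (Cf s - Cf t) * \<kappa> t) / (s - t) =
        (g s - g t) / (s - t) - D t - (Cf s - Cf t) / (s - t) * \<kappa> t"
      proof -
        have "(x - r * D t - y * \<kappa> t) / r = x / r - D t - y / r * \<kappa> t" if "r \<noteq> 0" for x y r
          using that by (simp add: diff_divide_distrib)
        then show ?thesis using s by simp
      qed
      then show ?thesis by (simp add: abs_divide[symmetric])
    qed
    finally show ?thesis .
  qed
  have "((\<lambda>s. (g s - g t) / (s - t) - D t - (Cf s - Cf t) / (s - t) * \<kappa> t) \<longlongrightarrow> 0) ?F"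
    by (rule Lim_null_comparison[OF _ err]) (use bound in \<open>auto simp: eventually_at_filter intro!: always_eventually\<close>)
  moreover have "((\<lambda>s. D t + (Cf s - Cf t) / (s - t) * \<kappa> t) \<longlongrightarrow> D t + c * \<kappa> t) ?F"
    using c unfolding has_field_derivative_iff by (intro tendsto_add tendsto_mult tendsto_const)
  ultimately have "((\<lambda>s. (g s - g t) / (s - t) - D t - (Cf s - Cf t) / (s - t) * \<kappa> t
     + (D t + (Cf s - Cf t) / (s - t) * \<kappa> t)) \<longlongrightarrow> 0 + (D t + c * \<kappa> t)) ?F"
    by (rule tendsto_add)
  then show ?thesis unfolding has_field_derivative_iff by (simp add: algebra_simps)
qed

context diagonal_scheme begin

lemma sol_space_regular:
  "\<exists>B\<ge>0. \<forall>t i. 0 \<le> t \<longrightarrow> t \<le> T \<longrightarrow> (\<forall>u. (sol t i has_real_derivative deriv (sol t i) u) (at u)) \<and>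
     (\<forall>u. \<bar>deriv (sol t i) u\<bar> \<le> M) \<and> (\<forall>u v. \<bar>deriv (sol t i) u - deriv (sol t i) v\<bar> \<le> B * \<bar>u - v\<bar>)"
proof -
  obtain e where e: "0 < e" "e \<le> 1" "\<And>t i. 0 \<le> t \<Longrightarrow> t \<le> T \<Longrightarrow> tame 1 e M (sol t i)"
    using sol_tame[of 1] by blast
  show ?thesis
  proof (intro exI[of _ "M / e"] conjI allI impI)
    show "0 \<le> M / e" using M e by simp
    fix t i u v assume t: "0 \<le> t" "t \<le> T"
    obtain f' where f': "\<And>u. (sol t i has_real_derivative f' u) (at u)" "dbound 1 e M f'"
      using e(3)[OF t, of i] unfolding tame_def by blast
    have [simp]: "deriv (sol t i) = f'" using f'(1) by (auto intro: DERIV_imp_deriv)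
    show "(sol t i has_real_derivative deriv (sol t i) u) (at u)" using f' by simp
    show "\<bar>deriv (sol t i) u\<bar> \<le> M" using dbound_abs_le[OF f'(2)] by simp
    show "\<bar>deriv (sol t i) u - deriv (sol t i) v\<bar> \<le> M / e * \<bar>u - v\<bar>"
      using dbound_Lipschitz[OF f'(2)[unfolded One_nat_def]] by simp
  qed
qed

lemma sol_continuous_time: "continuous_on {0..T} (\<lambda>t. sol t i u)"
proof (rule lipschitz_on_continuous_on)
  show "(Q + N)-lipschitz_on {0..T} (\<lambda>t. sol t i u)"
  proof (rule lipschitz_onI)
    fix s t assume "s \<in> {0..T}" "t \<in> {0..T}"
    then show "dist (sol s i u) (sol t i u) \<le> (Q + N) * dist s t"
      using sol_time_Lipschitz[of s t i u] sol_time_Lipschitz[of t s i u] by (auto simp: dist_real_def abs_if split: if_splits)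
  qed (use nonneg in auto)
qed

lemma sol_continuous: "continuous_on (UNIV \<times> {0..T}) (\<lambda>(u, t). sol t i u)"
proof (rule continuous_on_Lipschitz_fst[OF sol_continuous_time])
  show "norm (sol t i u - sol t i v) \<le> M * \<bar>u - v\<bar>" if "t \<in> {0..T}" for u v t
    using tame_Lipschitz[OF sol_tame0] that by auto
qed

text \<open>Interpolation again: \<open>sol\<close> is Lipschitz in time and its space derivative is
  Lipschitz in \<open>u\<close>, so the space derivative is Hoelder continuous in time with exponent
  1/2. The summand 1 keeps the bound on the difference strictly positive.\<close>

lemma deriv_sol_continuous_time: "continuous_on {0..T} (\<lambda>t. deriv (sol t i) u)"
proof -
  obtain B where B: "0 \<le> B" "\<And>t i u. 0 \<le> t \<Longrightarrow> t \<le> T \<Longrightarrow> (sol t i has_real_derivative deriv (sol t i) u) (at u)"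
    "\<And>t i u v. 0 \<le> t \<Longrightarrow> t \<le> T \<Longrightarrow> \<bar>deriv (sol t i) u - deriv (sol t i) v\<bar> \<le> B * \<bar>u - v\<bar>"
    using sol_space_regular by metis
  have est: "\<bar>deriv (sol s i) u - deriv (sol t i) u\<bar> \<le> (2 + 2 * B) * sqrt ((Q + N + 1) * \<bar>s - t\<bar>)"
    if st: "s \<in> {0..T}" "t \<in> {0..T}" "s \<noteq> t" for s t
  proof (rule derivative_bound_by_interpolation[where f = "\<lambda>u. sol s i u - sol t i u" and f' = "\<lambda>u. deriv (sol s i) u - deriv (sol t i) u"])
    show "((\<lambda>u. sol s i u - sol t i u) has_real_derivative deriv (sol s i) u - deriv (sol t i) u) (at u)" for u
      using st by (intro DERIV_diff B) auto
    show "\<bar>deriv (sol s i) x - deriv (sol t i) x - (deriv (sol s i) y - deriv (sol t i) y)\<bar> \<le> 2 * B * \<bar>x - y\<bar>" for x y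
    proof -
      have "\<bar>deriv (sol s i) x - deriv (sol s i) y\<bar> \<le> B * \<bar>x - y\<bar>" "\<bar>deriv (sol t i) x - deriv (sol t i) y\<bar> \<le> B * \<bar>x - y\<bar>"
        using B(3) st by auto
      then show ?thesis by linarith
    qed
    show "\<bar>sol s i u - sol t i u\<bar> \<le> (Q + N + 1) * \<bar>s - t\<bar>" for u
      using sol_time_Lipschitz[of s t i u] sol_time_Lipschitz[of t s i u] st
      by (auto simp: abs_if algebra_simps split: if_splits)
    show "0 < (Q + N + 1) * \<bar>s - t\<bar>" using st nonneg by simp
  qed
  show ?thesis unfolding continuous_on_def
  proof
    fix t assume t: "t \<in> {0..T}"
    have "((\<lambda>s. (2 + 2 * B) * sqrt ((Q + N + 1) * \<bar>s - t\<bar>)) \<longlongrightarrow> (2 + 2 * B) * sqrt ((Q + N + 1) * \<bar>t - t\<bar>)) (at t within {0..T})"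
      by (intro tendsto_mult tendsto_real_sqrt tendsto_rabs tendsto_diff tendsto_const tendsto_ident_at)
    then have "((\<lambda>s. (2 + 2 * B) * sqrt ((Q + N + 1) * \<bar>s - t\<bar>)) \<longlongrightarrow> 0) (at t within {0..T})" by simp
    then have "((\<lambda>s. deriv (sol s i) u - deriv (sol t i) u) \<longlongrightarrow> 0) (at t within {0..T})"
      by (rule Lim_null_comparison[rotated])
        (use est t in \<open>auto simp: eventually_at_filter intro!: always_eventually\<close>)
    then show "((\<lambda>s. deriv (sol s i) u) \<longlongrightarrow> deriv (sol t i) u) (at t within {0..T})"
      by (rule LIM_zero_cancel)
  qed
qed

lemma deriv_sol_continuous: "continuous_on (UNIV \<times> {0..T}) (\<lambda>(u, t). deriv (sol t i) u)"
proof -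
  obtain B where "\<And>t i u v. 0 \<le> t \<Longrightarrow> t \<le> T \<Longrightarrow> \<bar>deriv (sol t i) u - deriv (sol t i) v\<bar> \<le> B * \<bar>u - v\<bar>"
    using sol_space_regular by metis
  then show ?thesis by (intro continuous_on_Lipschitz_fst[OF deriv_sol_continuous_time, where B = B]) auto
qed

text \<open>The step in \<open>sol_local\<close> still contains a shifted value of
  \<open>sol s\<close>. A Taylor estimate in \<open>u\<close>, based on the Lipschitz bound for the
  space derivative, replaces the shift by the transport term and adds B \<Lambda>^2 to the quadratic
  constant.\<close>

lemma sol_has_time_derivative:
  assumes t: "t \<in> {0..T}" and c: "(Cf has_real_derivative c) (at t within {0..T})"
  shows "((\<lambda>t. sol t i u) has_real_derivative
    (lam i (\<lambda>j. sol t j u) * deriv (sol t i) u + h i (\<lambda>j. sol t j u)) + c * k i (\<lambda>j. sol t j u)) (at t within {0..T})"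
proof -
  obtain B where B: "0 \<le> B" "\<And>t i u. 0 \<le> t \<Longrightarrow> t \<le> T \<Longrightarrow> (sol t i has_real_derivative deriv (sol t i) u) (at u)"
    "\<And>t i u v. 0 \<le> t \<Longrightarrow> t \<le> T \<Longrightarrow> \<bar>deriv (sol t i) u - deriv (sol t i) v\<bar> \<le> B * \<bar>u - v\<bar>"
    using sol_space_regular by metis
  obtain \<Lambda> where \<Lambda>: "0 \<le> \<Lambda>" "\<And>i. blip M \<Lambda> (lam i)" using coeff_blip[of M] by blast
  have cont: "continuous_on {0..T} (\<lambda>t. H (\<lambda>j. sol t j u))" if "nice H" for H
    by (rule nice_continuous_on[OF that]) (rule sol_continuous_time)
  show ?thesis
  proof (rule derivative_from_local_expansion[where Q = "Q + B * \<Lambda>\<^sup>2", OF _ _ _ Cf t c])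
    show "continuous_on {0..T} (\<lambda>t. lam i (\<lambda>j. sol t j u) * deriv (sol t i) u + h i (\<lambda>j. sol t j u))"
      by (rule continuous_on_add[OF continuous_on_mult[OF cont deriv_sol_continuous_time] cont]) (rule nice)+
    show "continuous_on {0..T} (\<lambda>t. k i (\<lambda>j. sol t j u))"
      by (rule cont) (rule nice)
  next
    fix s t assume st: "0 \<le> s" "s \<le> t" "t \<le> T"
    define l where "l = lam i (\<lambda>j. sol s j u)"
    define f' where "f' = deriv (sol s i)"
    have s: "s \<le> T" using st by simp
    have l: "\<bar>l\<bar> \<le> \<Lambda>" unfolding l_def
      by (rule blip_abs_le[OF \<Lambda>(2)]) (rule tame_abs_le[OF sol_tame0[OF st(1) s]])
    have "\<bar>sol s i (u + (t - s) * l) - sol s i u - (t - s) * l * f' u\<bar> \<le> B * \<bar>(t - s) * l\<bar>\<^sup>2"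
    proof -
      define g where "g x = sol s i x - x * f' u" for x
      let ?S = "closed_segment u (u + (t - s) * l)"
      have "norm (g (u + (t - s) * l) - g u) \<le> (B * \<bar>(t - s) * l\<bar>) * norm (u + (t - s) * l - u)"
      proof (rule field_differentiable_bound[where S = ?S and f' = "\<lambda>x. f' x - f' u"])
        show "(g has_field_derivative f' x - f' u) (at x within ?S)" for x
          unfolding g_def f'_def
          by (rule derivative_eq_intros has_field_derivative_at_within[OF B(2)[OF st(1) s]] refl)+ simp
        show "norm (f' x - f' u) \<le> B * \<bar>(t - s) * l\<bar>" if "x \<in> ?S" for x
        proof -
          have "\<bar>x - u\<bar> \<le> \<bar>(t - s) * l\<bar>" using segment_bound(1)[OF that] by simp
          then have "B * \<bar>x - u\<bar> \<le> B * \<bar>(t - s) * l\<bar>" by (rule mult_left_mono[OF _ B(1)])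
          then show ?thesis using B(3)[OF st(1) s, of i x u] by (simp add: f'_def)
        qed
      qed auto
      then show ?thesis by (simp add: g_def algebra_simps power2_eq_square)
    qed
    also have "B * \<bar>(t - s) * l\<bar>\<^sup>2 \<le> B * \<Lambda>\<^sup>2 * (t - s)\<^sup>2"
    proof -
      have "l\<^sup>2 \<le> \<Lambda>\<^sup>2" using l by (simp add: abs_le_square_iff[symmetric] abs_of_nonneg[OF \<Lambda>(1)])
      then have "B * (t - s)\<^sup>2 * l\<^sup>2 \<le> B * (t - s)\<^sup>2 * \<Lambda>\<^sup>2" using B by (intro mult_left_mono) auto
      then show ?thesis by (simp add: power_mult_distrib mult_ac)
    qed
    finally have 1: "\<bar>sol s i (u + (t - s) * l) - sol s i u - (t - s) * l * f' u\<bar> \<le> B * \<Lambda>\<^sup>2 * (t - s)\<^sup>2" .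
    have 2: "\<bar>sol t i u - (sol s i (u + (t - s) * l) + (t - s) * h i (\<lambda>j. sol s j u) + (Cf t - Cf s) * k i (\<lambda>j. sol s j u))\<bar> \<le> Q * (t - s)\<^sup>2"
      using sol_local[OF st, of i u] by (simp add: step_def l_def)
    have "sol t i u - sol s i u - (t - s) * (l * f' u + h i (\<lambda>j. sol s j u)) - (Cf t - Cf s) * k i (\<lambda>j. sol s j u)
      = (sol t i u - (sol s i (u + (t - s) * l) + (t - s) * h i (\<lambda>j. sol s j u) + (Cf t - Cf s) * k i (\<lambda>j. sol s j u)))
       + (sol s i (u + (t - s) * l) - sol s i u - (t - s) * l * f' u)"
      by (simp add: algebra_simps)
    also have "\<bar>\<dots>\<bar> \<le> Q * (t - s)\<^sup>2 + B * \<Lambda>\<^sup>2 * (t - s)\<^sup>2"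
      using 1 2 by (intro order_trans[OF abs_triangle_ineq] add_mono)
    finally show "\<bar>sol t i u - sol s i u - (t - s) * (lam i (\<lambda>j. sol s j u) * deriv (sol s i) u + h i (\<lambda>j. sol s j u))
      - (Cf t - Cf s) * k i (\<lambda>j. sol s j u)\<bar> \<le> (Q + B * \<Lambda>\<^sup>2) * (t - s)\<^sup>2"
      by (simp add: l_def f'_def distrib_right)
  qed
qed

end

context diagonal_system begin

lemma local_existence:
  fixes w0 :: "'i \<Rightarrow> real \<Rightarrow> real"
  assumes w0: "\<And>i n. \<exists>B. tame n 1 B (w0 i)" and Cf: "\<And>s t. \<bar>Cf s - Cf t\<bar> \<le> K * \<bar>s - t\<bar>" and T0: "0 < T0"
  obtains T W where "0 < T" "T \<le> T0" "\<And>i u. W 0 i u = w0 i u"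
    "\<And>n. \<exists>e M. 0 < e \<and> e \<le> 1 \<and> (\<forall>t\<in>{0..T}. \<forall>i. tame n e M (W t i))"
    "\<And>i. continuous_on (UNIV \<times> {0..T}) (\<lambda>(u, t). W t i u)"
    "\<And>i. continuous_on (UNIV \<times> {0..T}) (\<lambda>(u, t). deriv (W t i) u)"
    "\<And>p t i u. (\<And>i u. w0 i (u + p) = w0 i u) \<Longrightarrow> t \<in> {0..T} \<Longrightarrow> W t i (u + p) = W t i u"
    "\<And>t c i u. t \<in> {0..T} \<Longrightarrow> (Cf has_real_derivative c) (at t within {0..T}) \<Longrightarrow>
      ((\<lambda>t. W t i u) has_real_derivative
        lam i (\<lambda>j. W t j u) * deriv (W t i) u + h i (\<lambda>j. W t j u) + c * k i (\<lambda>j. W t j u)) (at t within {0..T})"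
proof -
  have "\<exists>M\<ge>0. \<forall>i. tame 0 1 M (w0 i)"
    by (rule finite_uniform_bound) (use w0 in \<open>auto elim!: tame_mono\<close>)
  then obtain M0 where M0: "0 \<le> M0" "\<And>i. tame 0 1 M0 (w0 i)" by blast
  define M where "M = M0 + 1"
  obtain C where C: "0 \<le> C" "\<And>w \<delta> \<gamma> a i. 0 \<le> \<delta> \<Longrightarrow> \<bar>\<gamma>\<bar> \<le> K * \<delta> \<Longrightarrow> a \<le> M \<Longrightarrow> (\<forall>i. tame 0 1 a (w i)) \<Longrightarrow>
      tame 0 1 (a + C * \<delta>) (step \<delta> \<gamma> w i)" using step_tame0[of M] by blast
  obtain L where L: "0 \<le> L" "\<And>w z \<delta> \<gamma> E i u. 0 \<le> \<delta> \<Longrightarrow> \<bar>\<gamma>\<bar> \<le> K * \<delta> \<Longrightarrow> (\<forall>i. tame 0 1 M (w i)) \<Longrightarrow>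
      (\<forall>i u. \<bar>z i u\<bar> \<le> M) \<Longrightarrow> (\<forall>i u. \<bar>w i u - z i u\<bar> \<le> E) \<Longrightarrow>
      \<bar>step \<delta> \<gamma> w i u - step \<delta> \<gamma> z i u\<bar> \<le> (1 + L * \<delta>) * E" using step_stable[of M] by blast
  obtain N where N: "0 \<le> N" "\<And>w \<delta> \<gamma> i u. 0 \<le> \<delta> \<Longrightarrow> \<bar>\<gamma>\<bar> \<le> K * \<delta> \<Longrightarrow> (\<forall>i. tame 0 1 M (w i)) \<Longrightarrow>
      \<bar>step \<delta> \<gamma> w i u - w i u\<bar> \<le> N * \<delta>" using step_near[of M] by blast
  obtain Q where Q: "0 \<le> Q" "\<And>w a b \<gamma> \<beta> i u. 0 \<le> a \<Longrightarrow> 0 \<le> b \<Longrightarrow> \<bar>\<beta>\<bar> \<le> K * b \<Longrightarrow> \<bar>\<gamma>\<bar> \<le> K * a \<Longrightarrow>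
      (\<forall>i. tame 0 1 M (w i)) \<Longrightarrow> (\<forall>i. tame 0 1 M (step b \<beta> w i)) \<Longrightarrow>
      \<bar>step a \<gamma> (step b \<beta> w) i u - step (a + b) (\<beta> + \<gamma>) w i u\<bar> \<le> Q * (a * b)"
    using step_consistent[of M] by blast
  \<comment> \<open>The second entry gives T + C T \<le> 1, hence T \<le> 1 and M0 + C T \<le> M, as
    \<open>M\<close> exceeds \<open>M0\<close> by 1; the third gives L T \<le> 1/2. All constants
    are taken for \<open>M\<close>, before \<open>T\<close> is chosen.\<close>
  define T where "T = min T0 (min (1 / (1 + C)) (1 / (2 * (1 + L))))"
  have T: "0 < T" "T \<le> T0" "T \<le> 1 / (1 + C)" "T \<le> 1 / (2 * (1 + L))" using T0 C(1) L(1) by (auto simp: T_def)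
  have TC: "T + C * T \<le> 1" using T(3) C(1) by (simp add: field_simps)
  have TL: "2 * T + 2 * L * T \<le> 1" using T(4) L(1) by (simp add: field_simps)
  interpret diagonal_scheme lam h k K w0 Cf M0 M C L Q N T
  proof unfold_locales
    have "0 \<le> C * T" "0 \<le> L * T" using C L T by auto
    then show "T \<le> 1" "M0 + C * T \<le> M" "L * T \<le> 1 / 2" using TC TL T(1) M_def by auto
  qed (use M0 T Cf w0 C L N Q in \<open>auto simp: M_def\<close>)
  show ?thesis
  proof (rule that[of T sol])
    fix n
    obtain e where "0 < e" "e \<le> 1" "\<forall>t i. 0 \<le> t \<longrightarrow> t \<le> T \<longrightarrow> tame n e M (sol t i)" using sol_tame by blast
    then have "0 < e \<and> e \<le> 1 \<and> (\<forall>t\<in>{0..T}. \<forall>i. tame n e M (sol t i))" by simp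
    then show "\<exists>e M. 0 < e \<and> e \<le> 1 \<and> (\<forall>t\<in>{0..T}. \<forall>i. tame n e M (sol t i))" by blast
  next
    fix p t i u assume "\<And>i u. w0 i (u + p) = w0 i u" "t \<in> {0..T}"
    then show "sol t i (u + p) = sol t i u" by (intro sol_periodic) auto
  next
    fix t c i u assume "t \<in> {0..T}" "(Cf has_real_derivative c) (at t within {0..T})"
    then show "((\<lambda>t. sol t i u) has_real_derivative lam i (\<lambda>j. sol t j u) * deriv (sol t i) u
      + h i (\<lambda>j. sol t j u) + c * k i (\<lambda>j. sol t j u)) (at t within {0..T})"
      by (rule sol_has_time_derivative)
  next
    show "0 < T" "T \<le> T0" by fact+
    fix i u
    show "sol 0 i u = w0 i u" by (rule sol_0)
    show "continuous_on (UNIV \<times> {0..T}) (\<lambda>(u, t). sol t i u)" by (rule sol_continuous)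
    show "continuous_on (UNIV \<times> {0..T}) (\<lambda>(u, t). deriv (sol t i) u)" by (rule deriv_sol_continuous)
  qed
qed

end

section \<open>Periodicity and one-sided maxima\<close>

lemma periodic_int_multiple:
  fixes g :: "real \<Rightarrow> 'a"
  assumes "\<And>u. g (u + p) = g u" shows "g (u + of_int n * p) = g u"
proof -
  have nat: "g (v + real m * p) = g v" for m v
  proof (induction m)
    case (Suc m)
    have "v + real (Suc m) * p = v + real m * p + p" by (simp add: algebra_simps)
    then show ?case using assms[of "v + real m * p"] Suc by metis
  qed simp
  show ?thesis
  proof (cases "0 \<le> n")
    case True
    then show ?thesis using nat[of u "nat n"] by (simp add: of_nat_nat)
  next
    case False
    then show ?thesis using nat[of "u + of_int n * p" "nat (- n)"] by (simp add: of_nat_nat)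
  qed
qed

lemma periodic_reduce:
  fixes p u :: real
  assumes "0 < p" shows "\<exists>n::int. u + of_int n * p \<in> {0..<p}"
proof -
  have "of_int \<lfloor>u / p\<rfloor> * p \<le> u" "u < (of_int \<lfloor>u / p\<rfloor> + 1) * p"
    using assms floor_divide_lower[of p u] floor_divide_upper[of p u] by auto
  then show ?thesis by (intro exI[of _ "- \<lfloor>u / p\<rfloor>"]) (auto simp: algebra_simps)
qed

lemma int_multiple_eq_0:
  fixes p :: real
  assumes "\<bar>of_int n * p\<bar> < p" shows "n = 0"
proof -
  have p: "0 < p" using assms by linarith
  then have "\<bar>of_int n\<bar> * p < 1 * p" using assms by (simp add: abs_mult)
  then have "\<bar>real_of_int n\<bar> < 1" using p mult_less_cancel_right_pos by blast
  then show ?thesis by linarith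
qed

lemma derivative_nonneg_at_left_max:
  fixes f :: "real \<Rightarrow> real"
  assumes "(f has_real_derivative D) (at t within {0..T})" "0 < t" "t \<le> T" "\<And>s. 0 \<le> s \<Longrightarrow> s \<le> t \<Longrightarrow> f s \<le> f t"
  shows "0 \<le> D"
proof -
  have "(f has_real_derivative D) (at t within {0..t})"
    by (rule has_field_derivative_subset[OF assms(1)]) (use assms in auto)
  then have "((\<lambda>s. (f s - f t) / (s - t)) \<longlongrightarrow> D) (at_left t)"
    using at_within_Icc_at_left[OF assms(2)] by (simp add: has_field_derivative_iff)
  moreover have "\<forall>\<^sub>F s in at_left t. s \<in> {0<..<t}"
    using assms(2) by (rule eventually_at_left_real)
  then have "\<forall>\<^sub>F s in at_left t. 0 \<le> (f s - f t) / (s - t)"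
    by eventually_elim (use assms(4) in \<open>auto intro!: divide_nonpos_nonpos\<close>)
  ultimately show ?thesis by (rule tendsto_lowerbound) simp
qed

context diagonal_system begin

text \<open>The maximum is taken over space, time and components at once. Where it is attained, the
  space derivatives of that component agree, so the transport terms differ only through the speeds;
  and every other component differs by no more than the maximal one, so the coupling is controlled
  as well.\<close>

lemma uniqueness:
  fixes W Z Wu Zu :: "real \<Rightarrow> 'i \<Rightarrow> real \<Rightarrow> real"
  assumes W: "\<And>t i u. t \<in> {0..T} \<Longrightarrow> (W t i has_real_derivative Wu t i u) (at u)"
    "\<And>t i u. t \<in> {0..T} \<Longrightarrow> ((\<lambda>t. W t i u) has_real_derivative
        lam i (\<lambda>j. W t j u) * Wu t i u + h i (\<lambda>j. W t j u) + c t * k i (\<lambda>j. W t j u)) (at t within {0..T})"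
    and Z: "\<And>t i u. t \<in> {0..T} \<Longrightarrow> (Z t i has_real_derivative Zu t i u) (at u)"
    "\<And>t i u. t \<in> {0..T} \<Longrightarrow> ((\<lambda>t. Z t i u) has_real_derivative
        lam i (\<lambda>j. Z t j u) * Zu t i u + h i (\<lambda>j. Z t j u) + c t * k i (\<lambda>j. Z t j u)) (at t within {0..T})"
    and cont: "\<And>i. continuous_on ({0..p} \<times> {0..T}) (\<lambda>(u, t). W t i u)"
      "\<And>i. continuous_on ({0..p} \<times> {0..T}) (\<lambda>(u, t). Z t i u)"
      "\<And>i. continuous_on ({0..p} \<times> {0..T}) (\<lambda>(u, t). Wu t i u)"
    and per: "0 < p" "\<And>t i u. t \<in> {0..T} \<Longrightarrow> W t i (u + p) = W t i u" "\<And>t i u. t \<in> {0..T} \<Longrightarrow> Z t i (u + p) = Z t i u"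
    and init: "\<And>i u. W 0 i u = Z 0 i u"
    and c: "\<And>t. t \<in> {0..T} \<Longrightarrow> \<bar>c t\<bar> \<le> c0"
    and t1: "t1 \<in> {0..T}"
  shows "W t1 i1 u1 = Z t1 i1 u1"
proof (rule ccontr)
  assume neq: "W t1 i1 u1 \<noteq> Z t1 i1 u1"
  define S where "S = {0..p} \<times> {0..T}"
  have S: "compact S" "S \<noteq> {}" using per(1) t1 unfolding S_def by (auto intro: compact_Times)
  have bdd: "\<exists>M. \<forall>t\<in>{0..T}. \<forall>u\<in>{0..p}. \<bar>f t u\<bar> \<le> M" if "continuous_on S (\<lambda>(u, t). f t u)" for f :: "real \<Rightarrow> real \<Rightarrow> real"
  proof -
    have "bounded ((\<lambda>(u, t). f t u) ` S)"
      using compact_continuous_image[OF that S(1)] compact_imp_bounded by blast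
    then show ?thesis unfolding bounded_iff S_def by force
  qed
  have "\<exists>M\<ge>0. \<forall>i. \<forall>t\<in>{0..T}. \<forall>u\<in>{0..p}. \<bar>W t i u\<bar> \<le> M \<and> \<bar>Z t i u\<bar> \<le> M \<and> \<bar>Wu t i u\<bar> \<le> M"
  proof (rule finite_uniform_bound)
    fix i
    obtain A B C where "\<forall>t\<in>{0..T}. \<forall>u\<in>{0..p}. \<bar>W t i u\<bar> \<le> A" "\<forall>t\<in>{0..T}. \<forall>u\<in>{0..p}. \<bar>Z t i u\<bar> \<le> B"
       "\<forall>t\<in>{0..T}. \<forall>u\<in>{0..p}. \<bar>Wu t i u\<bar> \<le> C"
      using bdd[of "\<lambda>t. W t i"] bdd[of "\<lambda>t. Z t i"] bdd[of "\<lambda>t. Wu t i"] cont unfolding S_def by blast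
    then show "\<exists>M. \<forall>t\<in>{0..T}. \<forall>u\<in>{0..p}. \<bar>W t i u\<bar> \<le> M \<and> \<bar>Z t i u\<bar> \<le> M \<and> \<bar>Wu t i u\<bar> \<le> M"
      by (intro exI[of _ "max A (max B C)"]) (auto simp: le_max_iff_disj)
  qed force
  then obtain M where M: "0 \<le> M" "\<And>i t u. t \<in> {0..T} \<Longrightarrow> u \<in> {0..p} \<Longrightarrow> \<bar>W t i u\<bar> \<le> M \<and> \<bar>Z t i u\<bar> \<le> M \<and> \<bar>Wu t i u\<bar> \<le> M"
    by blast
  obtain L where L: "0 \<le> L" "\<And>i. blip M L (lam i)" "\<And>i. blip M L (h i)" "\<And>i. blip M L (k i)"
    using coeff_blip[of M] by blast
  have c0: "0 \<le> c0" using c[OF t1] by linarith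
  \<comment> \<open>L M + L + c0 L is the growth rate of the difference, caused by speed, source and
    forcing. The additional 1 makes the damped square strictly decreasing at its maximum.\<close>
  define A where "A = L * M + L + c0 * L + 1"
  define f where "f i u t = exp (- (2 * A * t)) * (W t i u - Z t i u)\<^sup>2" for i u t
  have fcont: "continuous_on S (\<lambda>(u, t). f i u t)" for i
    unfolding f_def case_prod_beta
    by (intro continuous_intros) (use cont[of i] in \<open>auto simp: S_def case_prod_beta\<close>)
  have "\<forall>i. \<exists>x\<in>S. \<forall>y\<in>S. (\<lambda>(u, t). f i u t) y \<le> (\<lambda>(u, t). f i u t) x"
    using continuous_attains_sup[OF S fcont] by blast
  then obtain X where X: "\<And>i. X i \<in> S" "\<And>i y. y \<in> S \<Longrightarrow> (\<lambda>(u, t). f i u t) y \<le> (\<lambda>(u, t). f i u t) (X i)" by metis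
  define v where "v i = (\<lambda>(u, t). f i u t) (X i)" for i
  obtain i0 where i0: "v i0 = Max (range v)"
    using Max_in[of "range v"] by fastforce
  obtain u0 t0 where X0: "X i0 = (u0, t0)" by fastforce
  have ut: "u0 \<in> {0..p}" "t0 \<in> {0..T}" using X(1)[of i0] X0 by (auto simp: S_def)
  have max0: "f i u t \<le> f i0 u0 t0" if "u \<in> {0..p}" "t \<in> {0..T}" for i u t
  proof -
    have "f i u t \<le> v i" using X(2)[of "(u, t)" i] that by (simp add: v_def S_def)
    also have "v i \<le> v i0" unfolding i0 by (rule Max_ge) auto
    finally show ?thesis by (simp add: v_def X0)
  qed
  \<comment> \<open>Periodicity extends the maximum from one period to the whole line, so
    \<open>u0\<close> never counts as a boundary point and the derivative in \<open>u\<close>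
    vanishes there.\<close>
  have max: "f i u t \<le> f i0 u0 t0" if t: "t \<in> {0..T}" for i u t
  proof -
    obtain n :: int where n: "u + of_int n * p \<in> {0..p}"
      using periodic_reduce[OF per(1), of u] by fastforce
    have "f i (u + of_int n * p) t = f i u t"
      unfolding f_def using periodic_int_multiple[of "W t i" p u n] periodic_int_multiple[of "Z t i" p u n] per t by simp
    then show ?thesis using max0[OF n t, of i] by simp
  qed
  define d where "d = W t0 i0 u0 - Z t0 i0 u0"
  have "0 < f i1 u1 t1" using neq by (simp add: f_def)
  also have "\<dots> \<le> f i0 u0 t0" by (rule max[OF t1])
  finally have d0: "d \<noteq> 0" by (auto simp: f_def d_def)
  then have t0: "0 < t0" using init ut by (cases "t0 = 0") (auto simp: d_def)
  have comp: "\<bar>W t0 j u - Z t0 j u\<bar> \<le> \<bar>d\<bar>" for j u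
  proof -
    have "(W t0 j u - Z t0 j u)\<^sup>2 \<le> d\<^sup>2" using max[OF ut(2), of j u] by (simp add: f_def d_def)
    then show ?thesis by (simp add: abs_le_square_iff)
  qed
  have Wu: "Wu t0 i0 u0 = Zu t0 i0 u0"
  proof -
    have "((\<lambda>u. (W t0 i0 u - Z t0 i0 u)\<^sup>2) has_real_derivative 2 * (W t0 i0 u0 - Z t0 i0 u0) * (Wu t0 i0 u0 - Zu t0 i0 u0)) (at u0)"
      by (auto intro!: derivative_eq_intros W(1) Z(1) ut(2))
    then have "2 * (W t0 i0 u0 - Z t0 i0 u0) * (Wu t0 i0 u0 - Zu t0 i0 u0) = 0"
      by (rule DERIV_local_max[where d = 1]) (use comp in \<open>auto simp: d_def abs_le_square_iff\<close>)
    then show ?thesis using d0 by (simp add: d_def)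
  qed
  let ?w = "\<lambda>j. W t0 j u0" and ?z = "\<lambda>j. Z t0 j u0"
  define dt where "dt = (lam i0 ?w * Wu t0 i0 u0 + h i0 ?w + c t0 * k i0 ?w) - (lam i0 ?z * Zu t0 i0 u0 + h i0 ?z + c t0 * k i0 ?z)"
  have bl: "\<bar>g ?w - g ?z\<bar> \<le> L * \<bar>d\<bar>" if "blip M L g" for g
    by (rule blip_diff_le[OF that]) (use M(2)[OF ut(2,1)] comp in auto)
  have "dt = (lam i0 ?w - lam i0 ?z) * Wu t0 i0 u0 + (h i0 ?w - h i0 ?z) + c t0 * (k i0 ?w - k i0 ?z)"
    unfolding dt_def Wu by (simp add: algebra_simps)
  also have "\<bar>\<dots>\<bar> \<le> L * \<bar>d\<bar> * M + L * \<bar>d\<bar> + c0 * (L * \<bar>d\<bar>)"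
  proof (intro order_trans[OF abs_triangle_ineq] add_mono bl L)
    show "\<bar>(lam i0 ?w - lam i0 ?z) * Wu t0 i0 u0\<bar> \<le> L * \<bar>d\<bar> * M"
      unfolding abs_mult using bl[OF L(2)] M(2)[OF ut(2,1)] L by (intro mult_mono) auto
    show "\<bar>c t0 * (k i0 ?w - k i0 ?z)\<bar> \<le> c0 * (L * \<bar>d\<bar>)"
      unfolding abs_mult using bl[OF L(4)] c[OF ut(2)] c0 by (intro mult_mono) auto
  qed
  also have "\<dots> = (A - 1) * \<bar>d\<bar>" by (simp add: A_def algebra_simps)
  finally have dt: "\<bar>dt\<bar> \<le> (A - 1) * \<bar>d\<bar>" .
  have "d * dt \<le> \<bar>d\<bar> * \<bar>dt\<bar>" by (simp add: abs_mult[symmetric])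
  also have "\<dots> \<le> \<bar>d\<bar> * ((A - 1) * \<bar>d\<bar>)" using dt by (intro mult_left_mono) auto
  also have "\<dots> = (A - 1) * d\<^sup>2" by (simp add: power2_eq_square)
  finally have ddt: "d * dt \<le> (A - 1) * d\<^sup>2" .
  have wd: "((\<lambda>t. W t i0 u0 - Z t i0 u0) has_real_derivative dt) (at t0 within {0..T})"
    unfolding dt_def by (intro DERIV_diff W(2) Z(2) ut)
  have "(f i0 u0 has_real_derivative exp (- (2 * A * t0)) * (2 * (d * dt) - 2 * A * d\<^sup>2)) (at t0 within {0..T})"
    unfolding f_def by (rule derivative_eq_intros wd refl)+ (simp add: d_def algebra_simps power2_eq_square)
  \<comment> \<open>The maximum may lie at the final time, so only earlier times are compared; t0 >
    0 holds because the initial values agree.\<close>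
  then have "0 \<le> exp (- (2 * A * t0)) * (2 * (d * dt) - 2 * A * d\<^sup>2)"
    by (rule derivative_nonneg_at_left_max) (use t0 ut max in auto)
  then have "0 \<le> 2 * (d * dt) - 2 * A * d\<^sup>2" by (simp add: zero_le_mult_iff)
  moreover have "2 * (d * dt) - 2 * A * d\<^sup>2 \<le> - 2 * d\<^sup>2" using ddt by (simp add: algebra_simps)
  moreover have "0 < d\<^sup>2" using d0 by simp
  ultimately show False by linarith
qed

end

section \<open>Turning number of simple closed curves\<close>

lemma continuous_between:
  fixes f :: "'a::topological_space \<Rightarrow> real"
  assumes "continuous_on S f" "connected S" "x0 \<in> S" "lo < f x0" "f x0 < hi"
    and avoid: "\<And>x. x \<in> S \<Longrightarrow> f x \<noteq> lo" "\<And>x. x \<in> S \<Longrightarrow> f x \<noteq> hi" and x: "x \<in> S"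
  shows "lo < f x \<and> f x < hi"
proof -
  have c: "connected (f ` S)" using assms(1,2) by (rule connected_continuous_image)
  have "\<not> f x \<le> lo" using connectedD_interval[OF c, of "f x" "f x0" lo] assms by fastforce
  moreover have "\<not> hi \<le> f x" using connectedD_interval[OF c, of "f x0" "f x" hi] assms by fastforce
  ultimately show ?thesis by simp
qed

text \<open>The values are integer multiples of 2 pi, and connectedness forbids a jump between two
  of them. This fixes the ambiguity of every angle that is determined only up to full turns.\<close>

lemma constant_if_cos_eq_1:
  fixes f :: "'a::topological_space \<Rightarrow> real"
  assumes "continuous_on S f" "connected S" "\<And>x. x \<in> S \<Longrightarrow> cos (f x) = 1" "x \<in> S" "y \<in> S"
  shows "f x = f y"
proof -
  have s: "sin (f z) = 0" if "z \<in> S" for z using assms(3)[OF that] sin_cos_squared_add[of "f z"] by simp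
  have av: "f z \<noteq> f y - pi" "f z \<noteq> f y + pi" if "z \<in> S" for z
    using assms(3)[OF that] assms(3)[OF assms(5)] by auto
  have "f y - pi < f x \<and> f x < f y + pi"
    by (rule continuous_between[OF assms(1,2,5) _ _ av assms(4)]) auto
  then have small: "\<bar>f x - f y\<bar> < pi" by (auto simp: abs_less_iff)
  have "cos (f x - f y) = 1" using assms(3)[OF assms(4)] assms(3)[OF assms(5)] s[OF assms(4)] by (simp add: cos_diff)
  then obtain n :: int where n: "f x - f y = of_int n * (2 * pi)" using cos_one_2pi_int by (auto simp: mult.assoc)
  have "\<bar>of_int n * (2 * pi)\<bar> < 2 * pi" using small pi_gt_zero unfolding n by linarith
  then have "n = 0" by (rule int_multiple_eq_0)
  then show ?thesis using n by simp
qed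

text \<open>
  Hopf's argument: the secant direction extends continuously to the triangle of parameters
  \<open>0 \<le> s \<le> t \<le> 2\<pi>\<close> without the corner \<open>(0, 2\<pi>)\<close>, where it has a continuous argument.
  Along the diagonal this argument turns by \<open>2\<pi>d\<close>; along the two other sides, which start
  or end at a lowest point, it turns by at most \<open>\<pi>\<close> each.
\<close>

lemma turning_number_le_1:
  fixes \<gamma> :: "real \<Rightarrow> complex" and v \<theta> :: "real \<Rightarrow> real" and d :: int
  assumes der: "\<And>u. (\<gamma> has_vector_derivative of_real (v u) * cis (\<theta> u)) (at u)"
    and v: "\<And>u. 0 < v u" "continuous_on UNIV v" and \<theta>: "continuous_on UNIV \<theta>"
    and per: "\<And>u. \<gamma> (u + 2 * pi) = \<gamma> u" and turn: "\<theta> (2 * pi) = \<theta> 0 + 2 * pi * d"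
    and low: "\<And>u. Im (\<gamma> 0) \<le> Im (\<gamma> u)" and \<theta>0: "cis (\<theta> 0) = 1"
    and inj: "\<And>s t. 0 \<le> s \<Longrightarrow> s < t \<Longrightarrow> t < 2 * pi \<Longrightarrow> \<gamma> s \<noteq> \<gamma> t"
  shows "d \<le> 1"
proof -
  define w where "w u = of_real (v u) * cis (\<theta> u)" for u
  have wc: "continuous_on UNIV w" unfolding w_def cis_conv_exp by (intro continuous_intros v \<theta>)
  \<comment> \<open>The mean velocity between two parameters: off the diagonal a positive multiple
    of the secant, on the diagonal the velocity itself. As an integral with parameters it is
    continuous on the whole plane.\<close>
  define A where "A z = integral (cbox 0 1) (\<lambda>\<xi>. w (fst z + \<xi> * (snd z - fst z)))" for z :: "real \<times> real"
  have Ac: "continuous_on UNIV A" unfolding A_def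
  proof (rule integral_continuous_on_param)
    show "continuous_on (UNIV \<times> cbox 0 1) (\<lambda>(x, \<xi>). w (fst x + \<xi> * (snd x - fst x)))"
      unfolding case_prod_beta by (rule continuous_on_compose2[OF wc]) (auto intro!: continuous_intros)
  qed
  have Aeq: "(t - s) *\<^sub>R A (s, t) = \<gamma> t - \<gamma> s" for s t
  proof -
    have "((\<lambda>\<xi>. (t - s) *\<^sub>R w (s + \<xi> * (t - s))) has_integral \<gamma> (s + 1 * (t - s)) - \<gamma> (s + 0 * (t - s))) {0..1}"
    proof (rule fundamental_theorem_of_calculus)
      fix \<xi> :: real
      have "((\<lambda>\<xi>. s + \<xi> * (t - s)) has_vector_derivative (t - s)) (at \<xi> within {0..1})"
        by (auto intro!: derivative_eq_intros simp: has_real_derivative_iff_has_vector_derivative[symmetric])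
      from vector_diff_chain_within[OF this has_vector_derivative_at_within[OF der]]
      show "((\<lambda>\<xi>. \<gamma> (s + \<xi> * (t - s))) has_vector_derivative (t - s) *\<^sub>R w (s + \<xi> * (t - s))) (at \<xi> within {0..1})"
        unfolding w_def o_def .
    qed simp
    moreover have "(\<lambda>\<xi>. w (s + \<xi> * (t - s))) integrable_on cbox 0 1"
      by (intro integrable_continuous continuous_on_compose2[OF wc]) (auto intro!: continuous_intros)
    ultimately show ?thesis unfolding A_def by (simp add: integral_unique flip: integral_cmul)
  qed
  have Adiag: "A (s, s) = w s" for s by (simp add: A_def)
  \<comment> \<open>At the corner (0, 2 pi) the curve has closed up and the secant vanishes.
    Removing it by a strict inequality leaves a convex set.\<close>
  define D where "D = {z :: real \<times> real. 0 \<le> fst z \<and> fst z \<le> snd z \<and> snd z \<le> 2 * pi \<and> snd z - fst z < 2 * pi}"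
  have "convex D"
  proof (rule convexI)
    fix x y :: "real \<times> real" and a b :: real
    assume x: "x \<in> D" and y: "y \<in> D" and ab: "0 \<le> a" "0 \<le> b" "a + b = 1"
    have "a * snd x + b * snd y \<le> 2 * pi" using x y ab unfolding D_def by (intro convex_bound_le) auto
    moreover have "a * (snd x - fst x) + b * (snd y - fst y) < 2 * pi"
      using x y ab unfolding D_def by (intro convex_bound_lt) auto
    moreover have "a * fst x \<le> a * snd x" "b * fst y \<le> b * snd y" "0 \<le> a * fst x" "0 \<le> b * fst y"
      using x y ab unfolding D_def by (auto intro: mult_left_mono)
    ultimately show "a *\<^sub>R x + b *\<^sub>R y \<in> D" unfolding D_def by (simp add: algebra_simps)
  qed
  then have "contractible D" by (rule convex_imp_contractible)
  moreover have "A z \<noteq> 0" if "z \<in> D" for z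
  proof -
    obtain s t where z: "z = (s, t)" by fastforce
    have st: "0 \<le> s" "s \<le> t" "t \<le> 2 * pi" "t - s < 2 * pi" using that by (auto simp: D_def z)
    show ?thesis
    proof (cases "s = t")
      case True
      then show ?thesis using v(1)[of t] by (simp add: z Adiag w_def)
    next
      case False
      have "\<gamma> t \<noteq> \<gamma> s"
      proof (cases "t = 2 * pi")
        case True
        then have "\<gamma> 0 \<noteq> \<gamma> s" using inj[of 0 s] False st by auto
        then show ?thesis using per[of 0] True by simp
      next
        case False
        then show ?thesis using inj[of s t] \<open>s \<noteq> t\<close> st by force
      qed
      then show ?thesis using Aeq[of t s] z by auto
    qed
  qed
  ultimately obtain g where g: "continuous_on D g" "\<And>z. z \<in> D \<Longrightarrow> A z = exp (g z)"
    using continuous_logarithm_on_contractible[OF continuous_on_subset[OF Ac]] by (metis subset_UNIV)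
  define a where "a z = Im (g z)" for z
  have ac: "continuous_on S (\<lambda>x. a (f x))" if "continuous_on S f" "f ` S \<subseteq> D" for S :: "real set" and f
    unfolding a_def by (intro continuous_on_Im continuous_on_compose2[OF g(1) that])
  have polar: "Re (A z) = exp (Re (g z)) * cos (a z)" "Im (A z) = exp (Re (g z)) * sin (a z)" if "z \<in> D" for z
    using g(2)[OF that] by (simp_all add: exp_eq_polar a_def)
  define \<alpha> where "\<alpha> = a (0, 0)"
  define \<beta> where "\<beta> = \<alpha> + 2 * pi * d"
  have diag: "(s, s) \<in> D" if "s \<in> {0..2*pi}" for s using that pi_gt_zero by (auto simp: D_def)
  have cis_diag: "cis (a (s, s)) = cis (\<theta> s)" if "s \<in> {0..2*pi}" for s
  proof -
    have "exp (Re (g (s, s))) * cis (a (s, s)) = of_real (v s) * cis (\<theta> s)"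
      using g(2)[OF diag[OF that]] Adiag[of s] by (simp add: exp_eq_polar a_def w_def)
    moreover from this have "exp (Re (g (s, s))) = v s"
      using v(1)[of s] by (metis abs_exp_cancel abs_of_pos norm_cis norm_mult mult.right_neutral norm_of_real)
    ultimately show ?thesis using v(1)[of s] by auto
  qed
  have cos_diag: "cos (a (s, s) - \<theta> s) = 1" if "s \<in> {0..2*pi}" for s
  proof -
    have "cis (a (s, s) - \<theta> s) = 1" using cis_diag[OF that] by (simp flip: cis_divide)
    then show ?thesis by (auto simp: complex_eq_iff)
  qed
  have "a (2 * pi, 2 * pi) = \<beta>"
  proof -
    have "a (2 * pi, 2 * pi) - \<theta> (2 * pi) = a (0, 0) - \<theta> 0"
    proof (rule constant_if_cos_eq_1[of "{0..2*pi}" "\<lambda>s. a (s, s) - \<theta> s"])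
      show "continuous_on {0..2*pi} (\<lambda>s. a (s, s) - \<theta> s)"
        by (intro continuous_intros ac continuous_on_subset[OF \<theta>]) (use diag in auto)
    qed (use cos_diag in auto)
    then show ?thesis using turn by (simp add: \<alpha>_def \<beta>_def)
  qed
  have \<alpha>0: "cos \<alpha> = 1" "sin \<alpha> = 0" using cis_diag[of 0] \<theta>0 by (auto simp: \<alpha>_def complex_eq_iff)
  have \<beta>0: "cos \<beta> = 1" "sin \<beta> = 0"
  proof -
    have "cis \<beta> = cis \<alpha> * cis (2 * pi * d)" unfolding \<beta>_def by (rule cis_mult[symmetric])
    moreover have "cis (2 * pi * d) = 1" by (simp add: complex_eq_iff cos_int_2pin sin_int_2pin)
    ultimately have "cis \<beta> = cis \<alpha>" by (metis mult.right_neutral)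
    then show "cos \<beta> = 1" "sin \<beta> = 0" using \<alpha>0 by (auto simp: complex_eq_iff)
  qed
  have shift: "sin (x - \<alpha>) = sin x" "sin (x - \<beta>) = sin x" "cos (x - \<alpha>) = cos x" "cos (x - \<beta>) = cos x" for x
    using \<alpha>0 \<beta>0 by (simp_all add: sin_diff cos_diff)
  have "isCont (\<lambda>u. Re (w u)) 0" using wc by (auto intro!: continuous_intros simp: continuous_on_eq_continuous_at)
  moreover have "0 < Re (w 0)" using v(1)[of 0] \<theta>0 by (simp add: w_def)
  ultimately have "\<forall>\<^sub>F u in at 0. 0 < Re (w u)" unfolding isCont_def by (rule order_tendstoD(1))
  then obtain \<delta>0 where \<delta>0: "0 < \<delta>0" "\<And>u. u \<noteq> 0 \<Longrightarrow> \<bar>u\<bar> < \<delta>0 \<Longrightarrow> 0 < Re (w u)"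
    unfolding eventually_at by (auto simp: dist_real_def)
  define \<delta> where "\<delta> = min (\<delta>0 / 2) pi"
  have \<delta>: "0 < \<delta>" "\<delta> < 2 * pi" "\<delta> < \<delta>0"
    using \<delta>0(1) pi_gt_zero unfolding \<delta>_def by linarith+
  have \<delta>_pos: "0 < Re (w u)" if "\<bar>u\<bar> \<le> \<delta>" for u
    using \<delta>0(2)[of u] \<open>0 < Re (w 0)\<close> that \<delta>(3) by (cases "u = 0") auto
  have Rder: "((\<lambda>u. Re (\<gamma> u)) has_real_derivative Re (w u)) (at u)" for u
    using bounded_linear.has_vector_derivative[OF bounded_linear_Re der[of u]]
    by (simp add: has_real_derivative_iff_has_vector_derivative w_def)
  \<comment> \<open>A segment that cuts off the missing corner. By periodicity its secants run from
    \<gamma>(s) to \<gamma>(s - \<delta>), backwards along an arc that moves to the right, and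
    therefore point to the left.\<close>
  have corner: "(s, s + 2 * pi - \<delta>) \<in> D \<and> cos (a (s, s + 2 * pi - \<delta>)) < 0" if s: "s \<in> {0..\<delta>}" for s
  proof -
    have D: "(s, s + 2 * pi - \<delta>) \<in> D" using s \<delta> by (auto simp: D_def)
    have "Re (\<gamma> (s - \<delta>)) < Re (\<gamma> s)"
    proof (rule DERIV_pos_imp_increasing[where f = "\<lambda>u. Re (\<gamma> u)"])
      fix x assume "s - \<delta> \<le> x" "x \<le> s"
      then have "0 < Re (w x)" using s by (intro \<delta>_pos) auto
      then show "\<exists>y. ((\<lambda>u. Re (\<gamma> u)) has_real_derivative y) (at x) \<and> 0 < y" using Rder by blast
    qed (use \<delta> in simp)
    moreover have "\<gamma> (s + 2 * pi - \<delta>) = \<gamma> (s - \<delta>)" using per[of "s - \<delta>"] by (simp add: algebra_simps)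
    moreover have "(2 * pi - \<delta>) * Re (A (s, s + 2 * pi - \<delta>)) = Re (\<gamma> (s + 2 * pi - \<delta>)) - Re (\<gamma> s)"
      using arg_cong[OF Aeq[of "s + 2 * pi - \<delta>" s], of Re] by simp
    ultimately have "(2 * pi - \<delta>) * Re (A (s, s + 2 * pi - \<delta>)) < 0" by simp
    then have "Re (A (s, s + 2 * pi - \<delta>)) < 0" using \<delta> by (simp add: mult_less_0_iff)
    then show ?thesis using D polar(1)[OF D] by (simp add: mult_less_0_iff)
  qed
  \<comment> \<open>No secant starting at the lowest point \<gamma>(0) points downwards, so the
    argument cannot cross a value at which the sine is -1.\<close>
  have 1: "\<alpha> - pi / 2 < a (0, 2 * pi - \<delta>) \<and> a (0, 2 * pi - \<delta>) < \<alpha> + 3 * pi / 2"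
  proof (rule continuous_between[where f = "\<lambda>t. a (0, t)" and S = "{0..<2*pi}" and ?x0.0 = 0])
    have D: "(0, t) \<in> D" if "t \<in> {0..<2*pi}" for t using that by (auto simp: D_def)
    show "continuous_on {0..<2*pi} (\<lambda>t. a (0, t))" by (rule ac) (auto intro!: continuous_intros D)
    have s: "0 \<le> sin (a (0, t) - \<alpha>)" if t: "t \<in> {0..<2*pi}" for t
    proof (cases "t = 0")
      case False
      have "t * Im (A (0, t)) = Im (\<gamma> t) - Im (\<gamma> 0)" using arg_cong[OF Aeq[of t 0], of Im] by simp
      then have "0 \<le> t * Im (A (0, t))" using low[of t] by simp
      then have "0 \<le> Im (A (0, t))" using t False by (simp add: zero_le_mult_iff)
      then show ?thesis unfolding shift using polar(2)[OF D[OF t]] by (simp add: zero_le_mult_iff)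
    qed (simp add: \<alpha>_def)
    have "sin (\<alpha> - pi / 2 - \<alpha>) = -1" "sin (\<alpha> + 3 * pi / 2 - \<alpha>) = -1" using sin_3over2_pi by (simp_all add: mult.commute)
    with s show "a (0, t) \<noteq> \<alpha> - pi / 2" "a (0, t) \<noteq> \<alpha> + 3 * pi / 2" if "t \<in> {0..<2*pi}" for t
      using that by (metis neg_0_le_iff_le not_one_le_zero)+
  qed (use \<delta> in \<open>auto simp: \<alpha>_def\<close>)
  \<comment> \<open>Secants that end at the lowest point never point upwards, which confines the
    argument on the other side of the triangle.\<close>
  have 2: "\<beta> - 3 * pi / 2 < a (\<delta>, 2 * pi) \<and> a (\<delta>, 2 * pi) < \<beta> + pi / 2"
  proof (rule continuous_between[where f = "\<lambda>s. a (s, 2 * pi)" and S = "{0<..2*pi}" and ?x0.0 = "2 * pi"])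
    have D: "(s, 2 * pi) \<in> D" if "s \<in> {0<..2*pi}" for s using that by (auto simp: D_def)
    show "continuous_on {0<..2*pi} (\<lambda>s. a (s, 2 * pi))" by (rule ac) (auto intro!: continuous_intros D)
    have s: "sin (a (s, 2 * pi) - \<beta>) \<le> 0" if s: "s \<in> {0<..2*pi}" for s
    proof (cases "s = 2 * pi")
      case False
      have "(2 * pi - s) * Im (A (s, 2 * pi)) = Im (\<gamma> (2 * pi)) - Im (\<gamma> s)" using arg_cong[OF Aeq[of "2 * pi" s], of Im] by simp
      then have "(2 * pi - s) * Im (A (s, 2 * pi)) \<le> 0" using low[of s] per[of 0] by simp
      then have "Im (A (s, 2 * pi)) \<le> 0" using s False by (simp add: mult_le_0_iff)
      then show ?thesis unfolding shift using polar(2)[OF D[OF s]] by (simp add: mult_le_0_iff)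
    qed (simp add: \<open>a (2 * pi, 2 * pi) = \<beta>\<close>)
    have "sin (\<beta> - 3 * pi / 2 - \<beta>) = 1" "sin (\<beta> + pi / 2 - \<beta>) = 1" using sin_3over2_pi by (simp_all add: mult.commute)
    with s show "a (s, 2 * pi) \<noteq> \<beta> - 3 * pi / 2" "a (s, 2 * pi) \<noteq> \<beta> + pi / 2" if "s \<in> {0<..2*pi}" for s
      using that by (metis not_one_le_zero)+
  qed (use \<delta> \<open>a (2 * pi, 2 * pi) = \<beta>\<close> in auto)
  \<comment> \<open>The secant at the start of the cut points to the left; this selects the left
    half of the range just found, and the cut then stays within it.\<close>
  have "\<alpha> + pi / 2 < a (0, 2 * pi - \<delta>)"
  proof (rule ccontr)
    assume "\<not> \<alpha> + pi / 2 < a (0, 2 * pi - \<delta>)"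
    then have "0 \<le> cos (a (0, 2 * pi - \<delta>) - \<alpha>)" using 1 by (intro cos_ge_zero) auto
    then show False using corner[of 0] \<delta> by (simp add: shift)
  qed
  have 3: "\<alpha> + pi / 2 < a (\<delta>, \<delta> + 2 * pi - \<delta>) \<and> a (\<delta>, \<delta> + 2 * pi - \<delta>) < \<alpha> + 3 * pi / 2"
  proof (rule continuous_between[where f = "\<lambda>s. a (s, s + 2 * pi - \<delta>)" and S = "{0..\<delta>}" and ?x0.0 = 0])
    show "continuous_on {0..\<delta>} (\<lambda>s. a (s, s + 2 * pi - \<delta>))"
      by (rule ac) (use corner in \<open>auto intro!: continuous_intros\<close>)
    have "cos (\<alpha> + pi / 2 - \<alpha>) = 0" "cos (\<alpha> + 3 * pi / 2 - \<alpha>) = 0" using cos_3over2_pi by (simp_all add: mult.commute)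
    with corner show "a (s, s + 2 * pi - \<delta>) \<noteq> \<alpha> + pi / 2" "a (s, s + 2 * pi - \<delta>) \<noteq> \<alpha> + 3 * pi / 2" if "s \<in> {0..\<delta>}" for s
      using that by (metis shift(3) less_irrefl)+
  qed (use \<delta> 1 \<open>\<alpha> + pi / 2 < a (0, 2 * pi - \<delta>)\<close> in auto)
  then have "a (\<delta>, 2 * pi) < \<alpha> + 3 * pi / 2" by simp
  then have "2 * pi * d < 3 * pi" using 2 unfolding \<beta>_def by linarith
  then have "2 * real_of_int d < 3" using mult_less_cancel_right_pos[of pi "2 * real_of_int d" 3] by (simp add: mult_ac)
  then show ?thesis by linarith
qed

lemma periodic_inj_onD:
  fixes p :: real
  assumes "inj_on \<gamma> {0..<p}" "\<And>u. \<gamma> (u + p) = \<gamma> u" "0 < p" "\<gamma> s = \<gamma> t"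
  shows "\<exists>n::int. s = t + of_int n * p"
proof -
  obtain m n :: int where mn: "s + of_int m * p \<in> {0..<p}" "t + of_int n * p \<in> {0..<p}"
    using periodic_reduce[OF assms(3)] by meson
  have "\<gamma> (s + of_int m * p) = \<gamma> (t + of_int n * p)"
    using assms(4) periodic_int_multiple[of \<gamma> p, OF assms(2)] by simp
  then have "s + of_int m * p = t + of_int n * p" using inj_onD[OF assms(1)] mn by blast
  then show ?thesis by (intro exI[of _ "n - m"]) (simp add: algebra_simps)
qed

text \<open>A lowest point is moved to parameter 0. The tangent there is horizontal; if it pointed
  to the left, the increasing angle would make the curve descend right afterwards. Positivity of the
  turning number is immediate from monotonicity.\<close>

lemma turning_number_eq_1:
  fixes \<gamma> :: "real \<Rightarrow> complex" and v \<theta> :: "real \<Rightarrow> real" and d :: int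
  assumes der: "\<And>u. (\<gamma> has_vector_derivative of_real (v u) * cis (\<theta> u)) (at u)"
    and v: "\<And>u. 0 < v u" "continuous_on UNIV v" and \<theta>: "continuous_on UNIV \<theta>" "strict_mono \<theta>"
    and per: "\<And>u. \<gamma> (u + 2 * pi) = \<gamma> u" and turn: "\<And>u. \<theta> (u + 2 * pi) = \<theta> u + 2 * pi * d"
    and inj: "inj_on \<gamma> {0..<2 * pi}"
  shows "d = 1"
proof -
  have Ider: "((\<lambda>u. Im (\<gamma> u)) has_real_derivative v u * sin (\<theta> u)) (at u)" for u
    using bounded_linear.has_vector_derivative[OF bounded_linear_Im der[of u]]
    by (simp add: has_real_derivative_iff_has_vector_derivative)
  have "continuous_on {0..2*pi} (\<lambda>u. Im (\<gamma> u))"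
    using Ider by (auto intro!: continuous_at_imp_continuous_on DERIV_isCont)
  then obtain u0 where u0: "\<And>u. u \<in> {0..2*pi} \<Longrightarrow> Im (\<gamma> u0) \<le> Im (\<gamma> u)"
    using continuous_attains_inf[of "{0..2*pi}" "\<lambda>u. Im (\<gamma> u)"] by fastforce
  have low: "Im (\<gamma> u0) \<le> Im (\<gamma> u)" for u
  proof -
    obtain n :: int where "u + of_int n * (2 * pi) \<in> {0..<2 * pi}" using periodic_reduce[of "2 * pi" u] by auto
    then show ?thesis using u0[of "u + of_int n * (2 * pi)"] periodic_int_multiple[of \<gamma> "2 * pi" u n, OF per] by simp
  qed
  have "v u0 * sin (\<theta> u0) = 0" by (rule DERIV_local_min[OF Ider, of 1]) (use low in auto)
  then have sin0: "sin (\<theta> u0) = 0" using v(1)[of u0] by simp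
  have cos0: "cos (\<theta> u0) = 1"
  proof (rule ccontr)
    assume "cos (\<theta> u0) \<noteq> 1"
    then have c: "cos (\<theta> u0) = -1" using sin0 sin_cos_squared_add[of "\<theta> u0"] by (simp add: power2_eq_1_iff)
    have "isCont \<theta> u0" using \<theta>(1) by (simp add: continuous_on_eq_continuous_at)
    then have "\<forall>\<^sub>F u in at u0. \<theta> u < \<theta> u0 + pi" unfolding isCont_def by (rule order_tendstoD(2)) simp
    then obtain e where e: "0 < e" "\<And>u. u \<noteq> u0 \<Longrightarrow> \<bar>u - u0\<bar> < e \<Longrightarrow> \<theta> u < \<theta> u0 + pi"
      unfolding eventually_at by (auto simp: dist_real_def)
    have "Im (\<gamma> (u0 + e)) < Im (\<gamma> u0)"
    proof (rule DERIV_neg_imp_decreasing_open[where f = "\<lambda>u. Im (\<gamma> u)"])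
      fix u assume u: "u0 < u" "u < u0 + e"
      have "0 < sin (\<theta> u - \<theta> u0)" using e(2)[of u] u strict_monoD[OF \<theta>(2) u(1)] by (intro sin_gt_zero) auto
      then have "sin (\<theta> u) < 0" using c sin0 by (simp add: sin_diff)
      then show "\<exists>y. ((\<lambda>u. Im (\<gamma> u)) has_real_derivative y) (at u) \<and> y < 0"
        using Ider v(1)[of u] by (intro exI[of _ "v u * sin (\<theta> u)"]) (auto intro: mult_pos_neg)
    qed (use e Ider in \<open>auto intro!: continuous_at_imp_continuous_on DERIV_isCont\<close>)
    then show False using low[of "u0 + e"] by simp
  qed
  have "d \<le> 1"
  proof (rule turning_number_le_1[where \<gamma> = "\<lambda>u. \<gamma> (u + u0)" and v = "\<lambda>u. v (u + u0)" and \<theta> = "\<lambda>u. \<theta> (u + u0)"])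
    fix u s t :: real
    show "((\<lambda>u. \<gamma> (u + u0)) has_vector_derivative of_real (v (u + u0)) * cis (\<theta> (u + u0))) (at u)"
    proof -
      have "((\<lambda>u. u + u0) has_vector_derivative 1) (at u)"
        by (auto intro!: derivative_eq_intros simp: has_real_derivative_iff_has_vector_derivative[symmetric])
      from vector_diff_chain_at[OF this der[of "u + u0"]] show ?thesis by (simp add: o_def)
    qed
    show "\<gamma> (u + 2 * pi + u0) = \<gamma> (u + u0)" using per[of "u + u0"] by (simp add: algebra_simps)
    show "\<theta> (2 * pi + u0) = \<theta> (0 + u0) + 2 * pi * d" using turn[of u0] by (simp add: add.commute)
    show "cis (\<theta> (0 + u0)) = 1" using sin0 cos0 by (simp add: complex_eq_iff)
    assume st: "0 \<le> s" "s < t" "t < 2 * pi"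
    show "\<gamma> (s + u0) \<noteq> \<gamma> (t + u0)"
    proof
      assume "\<gamma> (s + u0) = \<gamma> (t + u0)"
      from periodic_inj_onD[OF inj per _ this] obtain n :: int where "s + u0 = t + u0 + of_int n * (2 * pi)" by auto
      then have n: "s - t = of_int n * (2 * pi)" by simp
      have "\<bar>s - t\<bar> < 2 * pi" using st by linarith
      then have "n = 0" unfolding n by (rule int_multiple_eq_0)
      then show False using n st by simp
    qed
  qed (use v low in \<open>auto intro!: continuous_on_compose2[OF v(2)] continuous_on_compose2[OF \<theta>(1)] continuous_intros\<close>)
  moreover have "0 < d"
  proof -
    have "\<theta> 0 < \<theta> (0 + 2 * pi)" by (rule strict_monoD[OF \<theta>(2)]) simp
    then have "0 < 2 * pi * real_of_int d" unfolding turn by simp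
    then show ?thesis by (simp add: zero_less_mult_iff)
  qed
  ultimately show ?thesis by simp
qed

section \<open>Curves with monotone tangent angle\<close>

definition edir :: "real \<Rightarrow> real^2" where "edir a = vector [cos a, sin a]"

lemma edir_nth [simp]: "edir a $ 1 = cos a" "edir a $ 2 = sin a"
  by (simp_all add: edir_def)

lemma rot90_nth [simp]: "rot90 x $ 1 = - x $ 2" "rot90 x $ 2 = x $ 1"
  by (simp_all add: rot90_def)

lemma inner_real2: "(x :: real^2) \<bullet> y = x $ 1 * y $ 1 + x $ 2 * y $ 2"
  by (simp add: inner_vec_def sum_2)

lemma vec2_eq_iff: "(x :: real^2) = y \<longleftrightarrow> x $ 1 = y $ 1 \<and> x $ 2 = y $ 2"
  by (simp add: vec_eq_iff forall_2)

lemma inner_edir_edir [simp]: "edir a \<bullet> edir b = cos (a - b)"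
  by (simp add: inner_real2 cos_diff)

lemma inner_edir_rot90 [simp]: "edir a \<bullet> rot90 (edir b) = sin (a - b)"
  by (simp add: inner_real2 sin_diff)

lemma inner_rot90_rot90 [simp]: "rot90 x \<bullet> rot90 y = x \<bullet> y"
  by (simp add: inner_real2)

lemma norm_edir [simp]: "norm (edir a) = 1"
  by (simp add: norm_eq_sqrt_inner)

lemma norm_rot90 [simp]: "norm (rot90 x) = norm x"
  by (simp add: norm_eq_sqrt_inner)

lemma unit_vector_edir:
  fixes x :: "real^2" assumes "norm x = 1" shows "\<exists>a. x = edir a"
proof -
  have "(x $ 1)\<^sup>2 + (x $ 2)\<^sup>2 = 1"
    using assms by (simp add: norm_eq_sqrt_inner inner_real2 power2_eq_square)
  then obtain a where "x $ 1 = cos a" "x $ 2 = sin a" using sincos_total_2pi by metis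
  then show ?thesis by (auto simp: vec2_eq_iff)
qed

lemma rot90_scaleR: "rot90 (c *\<^sub>R x) = c *\<^sub>R rot90 x"
  by (simp add: vec2_eq_iff)

lemma rot90_rot90: "rot90 (rot90 x) = - x"
  by (simp add: vec2_eq_iff)

lemma edir_eq: "edir a = cos a *\<^sub>R axis 1 1 + sin a *\<^sub>R axis 2 1"
  by (simp add: vec2_eq_iff axis_def)

lemma bounded_linear_rot90: "bounded_linear rot90"
  unfolding linear_conv_bounded_linear[symmetric] by (intro linearI) (simp_all add: vec2_eq_iff)

lemma continuous_on_edir:
  fixes f :: "'a::t2_space \<Rightarrow> real"
  shows "continuous_on S f \<Longrightarrow> continuous_on S (\<lambda>x. edir (f x))"
  unfolding edir_eq by (intro continuous_intros)

lemma continuous_on_rot90: "continuous_on S f \<Longrightarrow> continuous_on S (\<lambda>x. rot90 (f x))"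
  using bounded_linear.continuous_on[OF bounded_linear_rot90] .

locale convex_loop =
  fixes \<gamma> :: "real \<Rightarrow> real^2" and v \<theta> :: "real \<Rightarrow> real"
  assumes der: "\<And>u. (\<gamma> has_vector_derivative v u *\<^sub>R edir (\<theta> u)) (at u)"
    and v: "\<And>u. 0 < v u" and \<theta>: "continuous_on UNIV \<theta>" "strict_mono \<theta>"
    and per: "\<And>u. \<gamma> (u + 2 * pi) = \<gamma> u" and turn: "\<And>u. \<theta> (u + 2 * pi) = \<theta> u + 2 * pi"
begin

abbreviation normal :: "real \<Rightarrow> real^2" where "normal u \<equiv> rot90 (edir (\<theta> u))"

lemma \<gamma>_continuous: "continuous_on S \<gamma>"
  using der by (auto intro!: continuous_at_imp_continuous_on has_vector_derivative_continuous)

lemma normal_continuous: "continuous_on S normal"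
  by (intro continuous_on_rot90 continuous_on_edir continuous_on_subset[OF \<theta>(1)]) simp

text \<open>The signed distance of \<gamma>(w) from the tangent line at \<open>u\<close> has
  derivative v(w) sin(\<theta>(w) - \<theta>(u)). It grows until the tangent has turned by pi and
  falls afterwards, and it vanishes at both ends of the period.\<close>

lemma support_strict:
  assumes "u < w" "w < u + 2 * pi" shows "0 < (\<gamma> w - \<gamma> u) \<bullet> normal u"
proof -
  define \<phi> where "\<phi> w = (\<gamma> w - \<gamma> u) \<bullet> normal u" for w
  have d: "(\<phi> has_real_derivative v w * sin (\<theta> w - \<theta> u)) (at w)" for w
  proof -
    have "((\<lambda>w. (\<gamma> w - \<gamma> u) \<bullet> normal u) has_vector_derivative (v w *\<^sub>R edir (\<theta> w) - 0) \<bullet> normal u) (at w)"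
      by (rule bounded_linear.has_vector_derivative[OF bounded_linear_inner_left])
        (intro has_vector_derivative_diff der has_vector_derivative_const)
    then show ?thesis by (simp add: \<phi>_def[abs_def] has_real_derivative_iff_has_vector_derivative)
  qed
  obtain m where m: "u \<le> m" "m \<le> u + 2 * pi" "\<theta> m = \<theta> u + pi"
    using IVT'[of \<theta> u "\<theta> u + pi" "u + 2 * pi"] turn[of u] continuous_on_subset[OF \<theta>(1)] by auto
  have mono: "\<theta> x < \<theta> y" if "x < y" for x y using that strict_monoD[OF \<theta>(2)] by blast
  have inc: "\<exists>y. (\<phi> has_real_derivative y) (at x) \<and> 0 < y" if "u < x" "x < m" for x
    using d[of x] v[of x] mono[OF that(1)] mono[OF that(2)] m(3)
    by (intro exI[of _ "v x * sin (\<theta> x - \<theta> u)"] conjI mult_pos_pos sin_gt_zero) auto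
  have dec: "\<exists>y. (\<phi> has_real_derivative y) (at x) \<and> y < 0" if "m < x" "x < u + 2 * pi" for x
  proof -
    have "0 < sin (\<theta> x - \<theta> u - pi)"
      using mono[OF that(1)] mono[OF that(2)] m(3) turn[of u] by (intro sin_gt_zero) auto
    then have "sin (\<theta> x - \<theta> u) < 0" by (simp add: sin_diff)
    then show ?thesis using d[of x] v[of x]
      by (intro exI[of _ "v x * sin (\<theta> x - \<theta> u)"] conjI mult_pos_neg) auto
  qed
  have c: "continuous_on S \<phi>" for S using d by (auto intro!: continuous_at_imp_continuous_on DERIV_isCont)
  have 0: "\<phi> u = 0" "\<phi> (u + 2 * pi) = 0" using per[of u] by (auto simp: \<phi>_def)
  show ?thesis
  proof (cases "w \<le> m")
    case True
    have "\<phi> u < \<phi> w" by (rule DERIV_pos_imp_increasing_open[OF assms(1) _ c]) (use inc True in auto)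
    then show ?thesis using 0 by (simp add: \<phi>_def)
  next
    case False
    have "\<phi> (u + 2 * pi) < \<phi> w" by (rule DERIV_neg_imp_decreasing_open[OF assms(2) _ c]) (use dec False in auto)
    then show ?thesis using 0 by (simp add: \<phi>_def)
  qed
qed

lemma reduce: "\<exists>n::int. w + of_int n * (2 * pi) \<in> {u..<u + 2 * pi}"
proof -
  obtain n :: int where "w - u + of_int n * (2 * pi) \<in> {0..<2 * pi}" using periodic_reduce[of "2 * pi" "w - u"] by auto
  then show ?thesis by (intro exI[of _ n]) (auto simp: algebra_simps)
qed

lemma \<gamma>_int: "\<gamma> (u + of_int n * (2 * pi)) = \<gamma> u"
  by (rule periodic_int_multiple[of \<gamma>]) (rule per)

lemma edir_int: "edir (\<theta> (u + of_int n * (2 * pi))) = edir (\<theta> u)"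
proof (rule periodic_int_multiple[of "\<lambda>u. edir (\<theta> u)"])
  show "edir (\<theta> (u + 2 * pi)) = edir (\<theta> u)" for u by (simp add: edir_def turn)
qed

lemma support: "0 \<le> (\<gamma> w - \<gamma> u) \<bullet> normal u" "(\<gamma> w - \<gamma> u) \<bullet> normal u = 0 \<Longrightarrow> \<gamma> w = \<gamma> u"
proof -
  obtain n :: int where n: "w + of_int n * (2 * pi) \<in> {u..<u + 2 * pi}" using reduce by blast
  have "w + of_int n * (2 * pi) = u \<or> 0 < (\<gamma> (w + of_int n * (2 * pi)) - \<gamma> u) \<bullet> normal u"
    using n support_strict[of u "w + of_int n * (2 * pi)"] by fastforce
  then have "\<gamma> w = \<gamma> u \<or> 0 < (\<gamma> w - \<gamma> u) \<bullet> normal u" using \<gamma>_int by metis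
  then show "0 \<le> (\<gamma> w - \<gamma> u) \<bullet> normal u" "(\<gamma> w - \<gamma> u) \<bullet> normal u = 0 \<Longrightarrow> \<gamma> w = \<gamma> u" by auto
qed

lemma inj_on_period: "inj_on \<gamma> {0..<2 * pi}"
proof (rule linorder_inj_onI)
  fix u w :: real assume "u < w" "u \<in> {0..<2 * pi}" "w \<in> {0..<2 * pi}"
  then show "\<gamma> u \<noteq> \<gamma> w" using support_strict[of u w] by auto
qed auto

text \<open>The intersection of the half-planes to the left of the tangent lines. Its frontier will
  be the curve, so that its interior is the enclosed region.\<close>

definition body :: "(real^2) set" where "body = {x. \<forall>u. 0 \<le> (x - \<gamma> u) \<bullet> normal u}"

lemma convex_body: "convex body"
proof -
  have "body = (\<Inter>u. {x. \<gamma> u \<bullet> normal u \<le> x \<bullet> normal u})" by (auto simp: body_def inner_diff_left)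
  moreover have "convex {x. \<gamma> u \<bullet> normal u \<le> x \<bullet> normal u}" for u
    using convex_halfspace_ge[where a = "normal u" and b = "\<gamma> u \<bullet> normal u"] by (simp add: inner_commute)
  ultimately show ?thesis by (auto intro: convex_INT)
qed

lemma closed_body: "closed body"
proof -
  have "body = (\<Inter>u. {x. \<gamma> u \<bullet> normal u \<le> x \<bullet> normal u})" by (auto simp: body_def inner_diff_left)
  moreover have "closed {x. \<gamma> u \<bullet> normal u \<le> x \<bullet> normal u}" for u
    by (intro closed_Collect_le continuous_intros)
  ultimately show ?thesis by auto
qed

lemma range_\<gamma>: "range \<gamma> = \<gamma> ` {0..2 * pi}"
proof -
  have "\<gamma> w \<in> \<gamma> ` {0..2 * pi}" for w
  proof -
    obtain n :: int where n: "w + of_int n * (2 * pi) \<in> {0..<0 + 2 * pi}" using reduce[of w 0] by blast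
    then show ?thesis using \<gamma>_int[of w n] by (intro image_eqI[of _ _ "w + of_int n * (2 * pi)"]) auto
  qed
  then show ?thesis by auto
qed

lemma direction_attained: "\<exists>u. edir a = edir (\<theta> u)"
proof -
  obtain n :: int where n: "a + of_int n * (2 * pi) - \<theta> 0 \<in> {0..<2 * pi}"
    using periodic_reduce[of "2 * pi" "a - \<theta> 0"] by (auto simp: algebra_simps)
  then obtain u where "\<theta> u = a + of_int n * (2 * pi)"
    using IVT'[of \<theta> 0 "a + of_int n * (2 * pi)" "2 * pi"] turn[of 0] continuous_on_subset[OF \<theta>(1)] by auto
  moreover have "edir (a + of_int n * (2 * pi)) = edir a"
    by (rule periodic_int_multiple[of edir]) (simp add: edir_def)
  ultimately show ?thesis by metis
qed

lemma bounded_body: "bounded body"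
proof -
  have "bounded (range \<gamma>)"
    unfolding range_\<gamma> by (intro compact_imp_bounded compact_continuous_image \<gamma>_continuous compact_Icc)
  then obtain B where B: "\<And>u. norm (\<gamma> u) \<le> B" unfolding bounded_iff by blast
  have "norm x \<le> B" if x: "x \<in> body" for x
  proof (cases "x = 0")
    case False
    \<comment> \<open>A tangent direction whose normal is -x/|x|: the corresponding half-plane
      bounds the norm of \<open>x\<close> by the norm of a point of the curve.\<close>
    define m where "m = (1 / norm x) *\<^sub>R rot90 x"
    have "norm m = 1" using False by (simp add: m_def)
    then obtain u where u: "m = edir (\<theta> u)" using unit_vector_edir direction_attained by metis
    have "normal u = (- 1 / norm x) *\<^sub>R x" unfolding u[symmetric] m_def by (simp add: rot90_scaleR rot90_rot90)
    then have "x \<bullet> normal u = - norm x" using False by (simp add: dot_square_norm power2_eq_square)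
    moreover have "- (\<gamma> u \<bullet> normal u) \<le> norm (\<gamma> u)"
      using Cauchy_Schwarz_ineq2[of "\<gamma> u" "normal u"] by simp
    ultimately show ?thesis using x B[of u] unfolding body_def inner_diff_left by (smt (verit) mem_Collect_eq)
  next
    case True
    then show ?thesis using order_trans[OF norm_ge_zero B] by simp
  qed
  then show ?thesis unfolding bounded_iff by blast
qed

lemma interior_body: "interior body = {x. \<forall>u. 0 < (x - \<gamma> u) \<bullet> normal u}"
proof (intro set_eqI iffI CollectI allI)
  fix x u assume x: "x \<in> interior body"
  then obtain e where e: "0 < e" "ball x e \<subseteq> body" using mem_interior by blast
  have "x - (e / 2) *\<^sub>R normal u \<in> ball x e" using e by (simp add: dist_norm)
  with e have "0 \<le> (x - (e / 2) *\<^sub>R normal u - \<gamma> u) \<bullet> normal u" unfolding body_def by blast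
  then show "0 < (x - \<gamma> u) \<bullet> normal u" using e by (simp add: inner_diff_left)
next
  fix x assume x: "x \<in> {x. \<forall>u. 0 < (x - \<gamma> u) \<bullet> normal u}"
  have "continuous_on {0..2*pi} (\<lambda>u. (x - \<gamma> u) \<bullet> normal u)"
    by (intro continuous_intros normal_continuous \<gamma>_continuous)
  then obtain u0 where u0: "\<And>u. u \<in> {0..2*pi} \<Longrightarrow> (x - \<gamma> u0) \<bullet> normal u0 \<le> (x - \<gamma> u) \<bullet> normal u"
    using continuous_attains_inf[of "{0..2*pi}" "\<lambda>u. (x - \<gamma> u) \<bullet> normal u"] by fastforce
  define e where "e = (x - \<gamma> u0) \<bullet> normal u0"
  have e: "0 < e" using x by (simp add: e_def)
  have le: "e \<le> (x - \<gamma> w) \<bullet> normal w" for w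
  proof -
    obtain n :: int where n: "w + of_int n * (2 * pi) \<in> {0..<0 + 2 * pi}" using reduce[of w 0] by blast
    then show ?thesis using u0[of "w + of_int n * (2 * pi)"] \<gamma>_int[of w n] edir_int[of w n] by (simp add: e_def)
  qed
  have "ball x e \<subseteq> body"
  proof
    fix y assume y: "y \<in> ball x e"
    have "0 \<le> (y - \<gamma> w) \<bullet> normal w" for w
    proof -
      have "\<bar>(y - x) \<bullet> normal w\<bar> \<le> norm (y - x) * 1"
        using Cauchy_Schwarz_ineq2[of "y - x" "normal w"] by simp
      then show ?thesis using le[of w] y by (simp add: dist_norm norm_minus_commute inner_diff_left)
    qed
    then show "y \<in> body" by (simp add: body_def)
  qed
  then show "x \<in> interior body" using e mem_interior by blast
qed

text \<open>The open half-plane together with the single point \<gamma>(u) is convex and contains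
  the curve, hence also its convex hull. A point of \<open>body\<close> outside the hull would be
  separated from the curve by a line parallel to one of the tangents, and would then violate the
  inequality for that tangent.\<close>

lemma body_support_eq:
  assumes "x \<in> body" "(x - \<gamma> u) \<bullet> normal u = 0" shows "x = \<gamma> u"
proof -
  define S where "S = insert (\<gamma> u) {x. 0 < (x - \<gamma> u) \<bullet> normal u}"
  have S: "0 \<le> (z - \<gamma> u) \<bullet> normal u" "(z - \<gamma> u) \<bullet> normal u = 0 \<Longrightarrow> z = \<gamma> u" if "z \<in> S" for z
    using that by (auto simp: S_def)
  have "convex S"
  proof (rule convexI)
    fix y z :: "real^2" and a b :: real
    assume y: "y \<in> S" and z: "z \<in> S" and ab: "0 \<le> a" "0 \<le> b" "a + b = 1"
    have "a *\<^sub>R y + b *\<^sub>R z - \<gamma> u = a *\<^sub>R (y - \<gamma> u) + b *\<^sub>R (z - \<gamma> u)"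
    proof -
      have "\<gamma> u = a *\<^sub>R \<gamma> u + b *\<^sub>R \<gamma> u" using ab(3) by (simp flip: scaleR_add_left)
      then show ?thesis unfolding scaleR_diff_right by (metis add_diff_add)
    qed
    then have eq: "(a *\<^sub>R y + b *\<^sub>R z - \<gamma> u) \<bullet> normal u = a * ((y - \<gamma> u) \<bullet> normal u) + b * ((z - \<gamma> u) \<bullet> normal u)"
      by (simp add: inner_add_left)
    show "a *\<^sub>R y + b *\<^sub>R z \<in> S"
    proof (cases "a * ((y - \<gamma> u) \<bullet> normal u) + b * ((z - \<gamma> u) \<bullet> normal u) = 0")
      case True
      then have "a = 0 \<or> y = \<gamma> u" "b = 0 \<or> z = \<gamma> u"
        using S[OF y] S[OF z] ab by (auto simp: add_nonneg_eq_0_iff)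
      then have "a *\<^sub>R y + b *\<^sub>R z = \<gamma> u" using ab(3) by (auto simp flip: scaleR_add_left)
      then show ?thesis by (simp add: S_def)
    next
      case False
      moreover have "0 \<le> a * ((y - \<gamma> u) \<bullet> normal u)" "0 \<le> b * ((z - \<gamma> u) \<bullet> normal u)"
        using S(1)[OF y] S(1)[OF z] ab by auto
      ultimately show ?thesis using eq by (simp add: S_def)
    qed
  qed
  moreover have "range \<gamma> \<subseteq> S" using support[of _ u] by (fastforce simp: S_def less_le)
  ultimately have sub: "convex hull range \<gamma> \<subseteq> S" by (intro hull_minimal)
  have "x \<in> convex hull range \<gamma>"
  proof (rule ccontr)
    assume "x \<notin> convex hull range \<gamma>"
    moreover have "closed (convex hull range \<gamma>)"
      unfolding range_\<gamma> by (intro compact_imp_closed compact_convex_hull compact_continuous_image \<gamma>_continuous compact_Icc)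
    ultimately obtain m b where m: "m \<bullet> x < b" "\<And>y. y \<in> convex hull range \<gamma> \<Longrightarrow> b < m \<bullet> y"
      using separating_hyperplane_closed_point[OF convex_convex_hull] by metis
    have mg: "m \<bullet> x < m \<bullet> \<gamma> w" for w using m(1) m(2)[of "\<gamma> w"] hull_inc[of "\<gamma> w"] by fastforce
    then have m0: "m \<noteq> 0" by auto
    define m' where "m' = (- 1 / norm m) *\<^sub>R rot90 m"
    have "norm m' = 1" using m0 by (simp add: m'_def)
    then obtain w where w: "m' = edir (\<theta> w)" using unit_vector_edir direction_attained by metis
    have "normal w = (1 / norm m) *\<^sub>R m" unfolding w[symmetric] m'_def rot90_scaleR rot90_rot90 by simp
    then have "(x - \<gamma> w) \<bullet> normal w = (1 / norm m) * (m \<bullet> x - m \<bullet> \<gamma> w)"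
      by (simp add: inner_diff_left inner_diff_right inner_commute[of _ m] diff_divide_distrib)
    also have "\<dots> < 0" using mg[of w] m0 by (intro mult_pos_neg) auto
    finally show False using assms(1) by (auto simp: body_def dest!: spec[of _ w])
  qed
  then show ?thesis using sub S(2) assms(2) by blast
qed

text \<open>The inside of the frontier of a bounded convex set is its interior, so it is enough to
  recognise the curve as the frontier of \<open>body\<close>; the Jordan curve theorem is
  bypassed.\<close>

lemma inside_range: "inside (range \<gamma>) = {x. \<forall>u. 0 < (x - \<gamma> u) \<bullet> normal u}"
proof -
  have "frontier body = range \<gamma>"
  proof -
    have "x \<in> range \<gamma>" if "x \<in> body" "x \<notin> interior body" for x
    proof -
      from that(2) obtain u where "\<not> 0 < (x - \<gamma> u) \<bullet> normal u" unfolding interior_body by blast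
      moreover from that(1) have "0 \<le> (x - \<gamma> u) \<bullet> normal u" by (auto simp: body_def)
      ultimately obtain u where "\<not> 0 < (x - \<gamma> u) \<bullet> normal u" "0 \<le> (x - \<gamma> u) \<bullet> normal u"
        by blast
      then show ?thesis using body_support_eq[OF that(1), of u] by auto
    qed
    moreover have "\<gamma> u \<in> body" "\<gamma> u \<notin> interior body" for u
      using support(1) unfolding interior_body by (auto simp: body_def intro!: exI[of _ u])
    ultimately show ?thesis using closed_body by (auto simp: frontier_def)
  qed
  then show ?thesis using inside_frontier_eq_interior[OF bounded_body convex_body] interior_body by simp
qed

text \<open>Moving along the normal at \<open>u\<close> increases the distance from every tangent
  line whose normal forms an acute angle with it. The other tangent lines belong to a compact set of
  parameters without \<open>u\<close> and u + 2 pi; there the distance of \<gamma>(u) has a positive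
  minimum, which limits \<epsilon>.\<close>

lemma inward: "\<forall>\<^sub>F \<epsilon> in at_right (0::real). \<gamma> u + \<epsilon> *\<^sub>R normal u \<in> inside (range \<gamma>)"
proof -
  define S where "S = {u..u + 2 * pi} \<inter> {w. cos (\<theta> u - \<theta> w) \<le> 0}"
  have "closed {w. cos (\<theta> u - \<theta> w) \<le> 0}" by (intro closed_Collect_le continuous_intros \<theta>)
  then have "compact S" unfolding S_def by (intro compact_Int_closed compact_Icc)
  have pos: "0 < (\<gamma> u - \<gamma> w) \<bullet> normal w" if "w \<in> S" for w
  proof -
    have "w \<noteq> u" "w \<noteq> u + 2 * pi" using that by (auto simp: S_def turn)
    then have "w < u + 2 * pi" "u + 2 * pi < w + 2 * pi" using that by (auto simp: S_def)
    from support_strict[OF this] show ?thesis by (simp add: per)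
  qed
  have "\<exists>\<delta>>0. \<forall>w\<in>S. \<delta> \<le> (\<gamma> u - \<gamma> w) \<bullet> normal w"
  proof (cases "S = {}")
    case False
    have "continuous_on S (\<lambda>w. (\<gamma> u - \<gamma> w) \<bullet> normal w)" by (intro continuous_intros normal_continuous \<gamma>_continuous)
    from continuous_attains_inf[OF \<open>compact S\<close> False this] show ?thesis using pos by metis
  qed (auto intro: exI[of _ 1])
  then obtain \<delta> where \<delta>: "0 < \<delta>" "\<And>w. w \<in> S \<Longrightarrow> \<delta> \<le> (\<gamma> u - \<gamma> w) \<bullet> normal w" by blast
  have *: "0 < (\<gamma> u + \<epsilon> *\<^sub>R normal u - \<gamma> w) \<bullet> normal w" if \<epsilon>: "0 < \<epsilon>" "\<epsilon> < \<delta>" and w: "w \<in> {u..u + 2 * pi}" for \<epsilon> w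
  proof -
    have eq: "(\<gamma> u + \<epsilon> *\<^sub>R normal u - \<gamma> w) \<bullet> normal w = (\<gamma> u - \<gamma> w) \<bullet> normal w + \<epsilon> * cos (\<theta> u - \<theta> w)"
      by (simp add: inner_diff_left inner_add_left)
    show ?thesis
    proof (cases "w \<in> S")
      case True
      have "\<epsilon> * (- cos (\<theta> u - \<theta> w)) \<le> \<epsilon> * 1" using \<epsilon> by (intro mult_left_mono) (auto simp: cos_ge_minus_one minus_le_iff)
      then show ?thesis using eq \<delta>(2)[OF True] \<epsilon> by simp
    next
      case False
      then have "0 < \<epsilon> * cos (\<theta> u - \<theta> w)" using w \<epsilon> by (auto simp: S_def)
      then show ?thesis using eq support(1)[of u w] by simp
    qed
  qed
  have "\<gamma> u + \<epsilon> *\<^sub>R normal u \<in> inside (range \<gamma>)" if \<epsilon>: "0 < \<epsilon>" "\<epsilon> < \<delta>" for \<epsilon>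
    unfolding inside_range
  proof (intro CollectI allI)
    fix w
    obtain n :: int where n: "w + of_int n * (2 * pi) \<in> {u..<u + 2 * pi}" using reduce by blast
    then show "0 < (\<gamma> u + \<epsilon> *\<^sub>R normal u - \<gamma> w) \<bullet> normal w"
      using *[OF \<epsilon>, of "w + of_int n * (2 * pi)"] \<gamma>_int[of w n] edir_int[of w n] by simp
  qed
  then show ?thesis using \<delta>(1) unfolding eventually_at_right_field by blast
qed

lemma outward:
  assumes "0 < \<epsilon>" shows "\<gamma> u - \<epsilon> *\<^sub>R normal u \<notin> inside (range \<gamma>)"
proof -
  have "(\<gamma> u - \<epsilon> *\<^sub>R normal u - \<gamma> u) \<bullet> normal u = - \<epsilon>" by simp
  then show ?thesis using assms unfolding inside_range by (smt (verit) mem_Collect_eq)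
qed

end

section \<open>Calculus along a moving frame\<close>

lemmas has_vector_derivative_rot90 = bounded_linear.has_vector_derivative[OF bounded_linear_rot90]

lemma has_vector_derivative_edir:
  assumes "(\<theta> has_real_derivative k) (at x within S)"
  shows "((\<lambda>x. edir (\<theta> x)) has_vector_derivative k *\<^sub>R rot90 (edir (\<theta> x))) (at x within S)"
proof -
  have "((\<lambda>x. cos (\<theta> x)) has_real_derivative - sin (\<theta> x) * k) (at x within S)"
    "((\<lambda>x. sin (\<theta> x)) has_real_derivative cos (\<theta> x) * k) (at x within S)"
    by (auto intro!: derivative_eq_intros assms)
  then have "((\<lambda>x. cos (\<theta> x) *\<^sub>R axis 1 1 + sin (\<theta> x) *\<^sub>R axis 2 1 :: real^2) has_vector_derivative
     (cos (\<theta> x) *\<^sub>R 0 + (- sin (\<theta> x) * k) *\<^sub>R axis 1 1) + (sin (\<theta> x) *\<^sub>R 0 + (cos (\<theta> x) * k) *\<^sub>R axis 2 1))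
     (at x within S)"
    by (intro has_vector_derivative_add has_vector_derivative_scaleR has_vector_derivative_const)
  moreover have "(cos (\<theta> x) *\<^sub>R 0 + (- sin (\<theta> x) * k) *\<^sub>R axis 1 1) + (sin (\<theta> x) *\<^sub>R 0 + (cos (\<theta> x) * k) *\<^sub>R axis 2 1)
     = k *\<^sub>R rot90 (edir (\<theta> x))" by (simp add: vec2_eq_iff axis_def)
  ultimately show ?thesis by (simp only: edir_eq)
qed

lemma nth_has_real_derivative:
  fixes f :: "real \<Rightarrow> real^2"
  assumes "(f has_vector_derivative d) (at x within S)"
  shows "((\<lambda>x. f x $ i) has_real_derivative d $ i) (at x within S)"
  using bounded_linear.has_vector_derivative[OF bounded_linear_vec_nth assms]
  by (simp add: has_real_derivative_iff_has_vector_derivative)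

lemma has_vector_derivative_normal:
  assumes "(f has_real_derivative k) (at x within S)"
  shows "((\<lambda>x. rot90 (edir (f x))) has_vector_derivative - (k *\<^sub>R edir (f x))) (at x within S)"
  using has_vector_derivative_rot90[OF has_vector_derivative_edir[OF assms]] by (simp add: rot90_scaleR rot90_rot90)

lemma has_real_derivative_speed:
  assumes "(f has_real_derivative f') (at x within S)" "(h has_real_derivative h') (at x within S)"
  shows "((\<lambda>x. exp (h x - (f x)\<^sup>2 / 2)) has_real_derivative exp (h x - (f x)\<^sup>2 / 2) * (h' - f x * f')) (at x within S)"
  by (rule derivative_eq_intros assms refl | simp)+

lemma has_real_derivative_inner:
  fixes f g :: "real \<Rightarrow> 'a::real_inner"
  assumes "(f has_vector_derivative f') (at x within S)" "(g has_vector_derivative g') (at x within S)"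
  shows "((\<lambda>x. f x \<bullet> g x) has_real_derivative f x \<bullet> g' + f' \<bullet> g x) (at x within S)"
  using bounded_bilinear.has_vector_derivative[OF bounded_bilinear_inner assms]
  by (simp add: has_real_derivative_iff_has_vector_derivative)

lemma real2_frame: "(x :: real^2) = (x \<bullet> edir a) *\<^sub>R edir a + (x \<bullet> rot90 (edir a)) *\<^sub>R rot90 (edir a)"
proof -
  have c: "cos a * cos a = 1 - sin a * sin a" using sin_cos_squared_add[of a] by (simp add: power2_eq_square)
  have d: "cos a * (cos a * y) = y - sin a * (sin a * y)" for y
    using arg_cong[OF c, of "\<lambda>z. z * y"] by (simp add: algebra_simps)
  show ?thesis by (simp add: vec2_eq_iff inner_real2 algebra_simps d)
qed

text \<open>A nowhere vanishing map into the plane has a continuous logarithm on a contractible set.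
  It is applied to the velocity of one curve and to the space derivative of a solution on a whole
  space-time strip, where it makes the angle jointly continuous.\<close>

lemma polar_lift:
  fixes \<Gamma> :: "'a::real_normed_vector \<Rightarrow> real^2"
  assumes "continuous_on S \<Gamma>" "contractible S" "\<And>x. x \<in> S \<Longrightarrow> \<Gamma> x \<noteq> 0"
  shows "\<exists>l \<theta>. continuous_on S l \<and> continuous_on S \<theta> \<and> (\<forall>x\<in>S. \<Gamma> x = exp (l x) *\<^sub>R edir (\<theta> x))"
proof -
  define h where "h x = Complex (\<Gamma> x $ 1) (\<Gamma> x $ 2)" for x
  have "continuous_on S h" unfolding h_def Complex_eq by (intro continuous_intros assms)
  moreover have "h x \<noteq> 0" if "x \<in> S" for x using assms(3)[OF that] by (simp add: h_def vec2_eq_iff complex_eq_iff)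
  ultimately obtain g where g: "continuous_on S g" "\<And>x. x \<in> S \<Longrightarrow> h x = exp (g x)"
    using continuous_logarithm_on_contractible[OF _ assms(2)] by metis
  have "\<Gamma> x = exp (Re (g x)) *\<^sub>R edir (Im (g x))" if "x \<in> S" for x
    using g(2)[OF that] by (simp add: h_def vec2_eq_iff complex_eq_iff Re_exp Im_exp)
  then show ?thesis using g(1) by (intro exI[of _ "\<lambda>x. Re (g x)"] exI[of _ "\<lambda>x. Im (g x)"]) (auto intro!: continuous_intros)
qed

text \<open>Near \<open>x\<close> the angle is recovered through arcsin from the normal component at \<open>x\<close>, so a
  continuous angle of a differentiable curve is differentiable.\<close>

lemma polar_derivative:
  assumes d: "(\<Gamma> has_vector_derivative D) (at x within S)" and x: "x \<in> S"
    and eq: "\<And>w. w \<in> S \<Longrightarrow> \<Gamma> w = exp (l w) *\<^sub>R edir (\<theta> w)" and cont: "continuous_on S \<theta>"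
  shows "(l has_real_derivative exp (- l x) * (D \<bullet> edir (\<theta> x))) (at x within S)"
    and "(\<theta> has_real_derivative exp (- l x) * (D \<bullet> rot90 (edir (\<theta> x)))) (at x within S)"
proof -
  have l_eq: "l w = ln (\<Gamma> w \<bullet> \<Gamma> w) / 2" if "w \<in> S" for w
  proof -
    have "\<Gamma> w \<bullet> \<Gamma> w = exp (2 * l w)" by (simp add: eq[OF that] flip: exp_add)
    then show ?thesis by simp
  qed
  have pos: "0 < \<Gamma> x \<bullet> \<Gamma> x" by (simp add: eq[OF x])
  have "((\<lambda>w. \<Gamma> w \<bullet> \<Gamma> w) has_real_derivative \<Gamma> x \<bullet> D + D \<bullet> \<Gamma> x) (at x within S)"
    by (rule has_real_derivative_inner[OF d d])
  then have "((\<lambda>w. ln (\<Gamma> w \<bullet> \<Gamma> w) / 2) has_real_derivative (\<Gamma> x \<bullet> D + D \<bullet> \<Gamma> x) / (\<Gamma> x \<bullet> \<Gamma> x) / 2) (at x within S)"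
    using pos by (auto intro!: derivative_eq_intros simp: field_simps)
  moreover have "(\<Gamma> x \<bullet> D + D \<bullet> \<Gamma> x) / (\<Gamma> x \<bullet> \<Gamma> x) / 2 = exp (- l x) * (D \<bullet> edir (\<theta> x))"
    by (simp add: eq[OF x] inner_commute[of _ D] exp_minus field_simps)
  ultimately have "((\<lambda>w. ln (\<Gamma> w \<bullet> \<Gamma> w) / 2) has_real_derivative exp (- l x) * (D \<bullet> edir (\<theta> x))) (at x within S)" by simp
  then show l': "(l has_real_derivative exp (- l x) * (D \<bullet> edir (\<theta> x))) (at x within S)"
    by (rule has_field_derivative_transform_within[OF _ zero_less_one x]) (simp add: l_eq)
  let ?N = "rot90 (edir (\<theta> x))"
  define f where "f w = exp (- l w) * (\<Gamma> w \<bullet> ?N)" for w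
  have fx: "f x = 0" by (simp add: f_def eq[OF x])
  have inn: "((\<lambda>w. \<Gamma> w \<bullet> ?N) has_real_derivative D \<bullet> ?N) (at x within S)"
    using has_real_derivative_inner[OF d has_vector_derivative_const[of ?N]] by simp
  have "(f has_real_derivative exp (- l x) * (D \<bullet> ?N)) (at x within S)"
    unfolding f_def by (rule derivative_eq_intros l' inn refl)+ (simp add: eq[OF x])
  then have "((\<lambda>w. arcsin (f w)) has_real_derivative inverse (sqrt (1 - (f x)\<^sup>2)) * (exp (- l x) * (D \<bullet> ?N))) (at x within S)"
    by (rule DERIV_chain2[OF DERIV_arcsin, rotated 2]) (simp_all add: fx)
  from DERIV_add[OF this DERIV_const[of "\<theta> x"]] have as: "((\<lambda>w. arcsin (f w) + \<theta> x) has_real_derivative exp (- l x) * (D \<bullet> ?N)) (at x within S)"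
    using fx by simp
  have "(\<theta> \<longlongrightarrow> \<theta> x) (at x within S)" using cont x by (simp add: continuous_on_def)
  then have "\<forall>\<^sub>F w in at x within S. dist (\<theta> w) (\<theta> x) < pi / 2" by (rule tendstoD) simp
  then obtain \<delta> where \<delta>: "0 < \<delta>" "\<And>w. w \<in> S \<Longrightarrow> w \<noteq> x \<Longrightarrow> dist w x < \<delta> \<Longrightarrow> \<bar>\<theta> w - \<theta> x\<bar> < pi / 2"
    unfolding eventually_at by (auto simp: dist_real_def)
  have "arcsin (f w) + \<theta> x = \<theta> w" if "w \<in> S" "dist w x < \<delta>" for w
  proof -
    have "\<bar>\<theta> w - \<theta> x\<bar> \<le> pi / 2" using \<delta>(2)[OF that(1) _ that(2)] by (cases "w = x") auto
    then have "arcsin (sin (\<theta> w - \<theta> x)) = \<theta> w - \<theta> x" by (intro arcsin_sin) linarith+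
    moreover have "f w = sin (\<theta> w - \<theta> x)" by (simp add: f_def eq[OF that(1)] exp_minus)
    ultimately show ?thesis by simp
  qed
  then show "(\<theta> has_real_derivative exp (- l x) * (D \<bullet> ?N)) (at x within S)"
    by (intro has_field_derivative_transform_within[OF as \<delta>(1) x]) auto
qed

lemma edir_eq_iff_cos: "edir a = edir b \<longleftrightarrow> cos (a - b) = 1"
proof
  assume "edir a = edir b"
  then have "edir a \<bullet> edir b = edir b \<bullet> edir b" by simp
  then show "cos (a - b) = 1" by simp
next
  assume "cos (a - b) = 1"
  then have "(edir a - edir b) \<bullet> (edir a - edir b) = 0"
    using cos_minus[of "a - b"] by (simp add: inner_diff_left inner_diff_right)
  then show "edir a = edir b" by simp
qed

section \<open>Smooth functions with bounded derivatives\<close>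

definition bsmooth :: "(real \<Rightarrow> real) \<Rightarrow> bool" where
  "bsmooth g \<longleftrightarrow> (\<forall>n. \<exists>B. dbound n 1 B g)"

lemma bsmooth_tame: assumes "bsmooth g" shows "\<exists>B. tame n 1 B g"
proof -
  obtain B where B: "dbound (Suc n) 1 B g" using assms unfolding bsmooth_def by blast
  then obtain g' where "\<And>u. (g has_real_derivative g' u) (at u)" "dbound n 1 B g'" by auto
  then show ?thesis using tameI[of g B g' n 1] dbound_abs_le[OF B] by blast
qed

lemma bsmoothI:
  assumes "\<And>u. \<bar>g u\<bar> \<le> B" "\<And>u. (g has_real_derivative g' u) (at u)" "bsmooth g'"
  shows "bsmooth g"
  unfolding bsmooth_def
proof
  fix n
  obtain B' where "dbound n 1 B' g'" using assms(3) unfolding bsmooth_def by blast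
  then have "dbound n 1 (max B B' / 1) g'" by (rule dbound_mono) auto
  then have "dbound (Suc n) 1 (max B B') g" by (rule dbound_SucI[rotated 2]) (use assms in \<open>auto simp: le_max_iff_disj\<close>)
  then show "\<exists>B. dbound n 1 B g" using dbound_Suc_imp by blast
qed

lemma bsmooth_add: "bsmooth f \<Longrightarrow> bsmooth g \<Longrightarrow> bsmooth (\<lambda>u. f u + g u)"
  unfolding bsmooth_def using dbound_add by meson

lemma bsmooth_mult: "bsmooth f \<Longrightarrow> bsmooth g \<Longrightarrow> bsmooth (\<lambda>u. f u * g u)"
  unfolding bsmooth_def using dbound_mult[of 1] by (meson zero_less_one)

lemma bsmooth_const: "bsmooth (\<lambda>u. a)"
  unfolding bsmooth_def using dbound_const[of a "\<bar>a\<bar>" 1] by auto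

lemma bsmooth_diff: "bsmooth f \<Longrightarrow> bsmooth g \<Longrightarrow> bsmooth (\<lambda>u. f u - g u)"
  using bsmooth_add[OF _ bsmooth_mult[OF bsmooth_const[of "-1"]], of f g] by simp

text \<open>The derivative of 1/p is -p' (1/p)^2, so a bound of each order follows from bounds of
  the preceding order.\<close>

lemma bsmooth_inverse:
  assumes p: "bsmooth p" "\<And>u. (p has_real_derivative p' u) (at u)" "bsmooth p'" "\<And>u. \<delta> \<le> p u" "0 < \<delta>"
  shows "bsmooth (\<lambda>u. 1 / p u)"
  unfolding bsmooth_def
proof
  fix n show "\<exists>B. dbound n 1 B (\<lambda>u. 1 / p u)"
  proof (induction n)
    case 0
    have "\<bar>1 / p u\<bar> \<le> 1 / \<delta>" for u using p(4)[of u] p(5) by (auto simp: divide_left_mono)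
    then show ?case by auto
  next
    case (Suc n)
    then obtain B where B: "dbound n 1 B (\<lambda>u. 1 / p u)" by blast
    obtain B' where B': "dbound n 1 B' p'" using p(3) unfolding bsmooth_def by blast
    have "dbound n 1 (\<bar>-1\<bar> * (2 ^ n * B' * (2 ^ n * B * B))) (\<lambda>u. - 1 * (p' u * (1 / p u * (1 / p u))))"
      by (intro dbound_cmult dbound_mult B B') auto
    then have 1: "dbound n 1 (max (1 / \<delta>) (\<bar>-1\<bar> * (2 ^ n * B' * (2 ^ n * B * B))) / 1) (\<lambda>u. - 1 * (p' u * (1 / p u * (1 / p u))))"
      by (rule dbound_mono) auto
    have "dbound (Suc n) 1 (max (1 / \<delta>) (\<bar>-1\<bar> * (2 ^ n * B' * (2 ^ n * B * B)))) (\<lambda>u. 1 / p u)"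
    proof (rule dbound_SucI[OF _ _ 1])
      fix u
      have pu: "0 < p u" using p(4)[of u] p(5) by linarith
      have "\<bar>1 / p u\<bar> \<le> 1 / \<delta>" using p(4)[of u] p(5) by (auto simp: divide_left_mono)
      then show "\<bar>1 / p u\<bar> \<le> max (1 / \<delta>) (\<bar>-1\<bar> * (2 ^ n * B' * (2 ^ n * B * B)))" by simp
      show "((\<lambda>u. 1 / p u) has_real_derivative - 1 * (p' u * (1 / p u * (1 / p u)))) (at u)"
        using pu by (auto intro!: derivative_eq_intros p(2))
    qed
    then show ?case by blast
  qed
qed

lemma periodic_continuous_bounded:
  fixes g :: "real \<Rightarrow> 'a::real_normed_vector"
  assumes "continuous_on UNIV g" "0 < p" "\<And>u. g (u + p) = g u"
  shows "\<exists>B. \<forall>u. norm (g u) \<le> B"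
proof -
  have "bounded (g ` {0..p})"
    by (intro compact_imp_bounded compact_continuous_image continuous_on_subset[OF assms(1)]) auto
  then obtain B where B: "\<And>u. u \<in> {0..p} \<Longrightarrow> norm (g u) \<le> B" unfolding bounded_iff by blast
  have "norm (g u) \<le> B" for u
  proof -
    obtain n :: int where n: "u + of_int n * p \<in> {0..<p}" using periodic_reduce[OF assms(2)] by blast
    then have "norm (g (u + of_int n * p)) \<le> B" by (intro B) auto
    then show ?thesis using periodic_int_multiple[of g p u n, OF assms(3)] by simp
  qed
  then show ?thesis by blast
qed

lemma bsmooth_sequence:
  assumes "\<And>n u. (G n has_real_derivative G (Suc n) u) (at u)" "0 < p" "\<And>n u. G n (u + p) = G n u"
  shows "bsmooth (G k)"
  unfolding bsmooth_def
proof
  fix n show "\<exists>B. dbound n 1 B (G k)"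
  proof (induction n arbitrary: k)
    case 0
    have "continuous_on UNIV (G k)" using assms(1) by (auto intro!: continuous_at_imp_continuous_on DERIV_isCont)
    from periodic_continuous_bounded[OF this assms(2,3)] show ?case by auto
  next
    case (Suc n)
    obtain B where B: "dbound n 1 B (G (Suc k))" using Suc by blast
    obtain B' where B': "dbound 0 1 B' (G k)"
    proof -
      have "continuous_on UNIV (G k)" using assms(1) by (auto intro!: continuous_at_imp_continuous_on DERIV_isCont)
      from periodic_continuous_bounded[OF this assms(2,3)] that show ?thesis by auto
    qed
    have "dbound n 1 (max B' B / 1) (G (Suc k))" by (rule dbound_mono[OF B]) auto
    then have "dbound (Suc n) 1 (max B' B) (G k)"
      by (rule dbound_SucI[rotated 2]) (use assms(1) B' in \<open>auto simp: le_max_iff_disj\<close>)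
    then show ?case by blast
  qed
qed

lemma periodic_vector_derivative:
  assumes "\<And>u. (g has_vector_derivative g' u) (at u)" "\<And>u. g (u + p) = g u"
  shows "g' (u + p) = g' u"
proof -
  have "((\<lambda>u. u + p) has_vector_derivative 1) (at u)"
    by (auto intro!: derivative_eq_intros simp: has_real_derivative_iff_has_vector_derivative[symmetric])
  from vector_diff_chain_at[OF this assms(1)] have "(g has_vector_derivative g' (u + p)) (at u)"
    by (simp add: o_def assms(2))
  then show ?thesis using assms(1) vector_derivative_unique_at by blast
qed

abbreviation iter_deriv :: "nat \<Rightarrow> (real \<Rightarrow> 'a::real_normed_vector) \<Rightarrow> real \<Rightarrow> 'a" where
  "iter_deriv n g \<equiv> ((\<lambda>h x. vector_derivative h (at x)) ^^ n) g"

lemma smooth_on_circle_sequence: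
  assumes "smooth_on_circle g"
  shows "(iter_deriv n g has_vector_derivative iter_deriv (Suc n) g u) (at u)"
    and "iter_deriv n g (u + 2 * pi) = iter_deriv n g u"
proof -
  show d: "(iter_deriv n g has_vector_derivative iter_deriv (Suc n) g u) (at u)" for n u
    using assms vector_derivative_works unfolding smooth_on_circle_def smooth_def by auto
  show "iter_deriv n g (u + 2 * pi) = iter_deriv n g u"
  proof (induction n arbitrary: u)
    case 0
    then show ?case using assms periodic_fun_simple.plus_period unfolding smooth_on_circle_def by fastforce
  next
    case (Suc n)
    show ?case by (rule periodic_vector_derivative[OF d Suc])
  qed
qed

lemma smooth_on_circle_bsmooth: "smooth_on_circle f \<Longrightarrow> bsmooth f"
  using bsmooth_sequence[of "\<lambda>n. iter_deriv n f" "2 * pi" 0] smooth_on_circle_sequence[of f]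
  by (simp add: has_real_derivative_iff_has_vector_derivative)

lemma smooth_on_circle_component_bsmooth:
  fixes F :: "real \<Rightarrow> real^2"
  assumes "smooth_on_circle F" shows "bsmooth (\<lambda>u. iter_deriv k F u $ i)"
proof (rule bsmooth_sequence[of "\<lambda>n u. iter_deriv n F u $ i" "2 * pi" k])
  show "((\<lambda>u. iter_deriv n F u $ i) has_real_derivative iter_deriv (Suc n) F u $ i) (at u)" for n u
    using bounded_linear.has_vector_derivative[OF bounded_linear_vec_nth smooth_on_circle_sequence(1)[OF assms]]
    by (simp add: has_real_derivative_iff_has_vector_derivative)
qed (use smooth_on_circle_sequence(2)[OF assms] in auto)

lemma smooth_if_sequence:
  assumes "\<And>n u. (D n has_vector_derivative D (Suc n) u) (at u)" "D 0 = g"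
  shows "smooth g"
proof -
  have "iter_deriv n g = D n" for n
  proof (induction n)
    case (Suc n)
    then show ?case by (simp add: vector_derivative_at[OF assms(1)])
  qed (simp add: assms)
  then show ?thesis unfolding smooth_def using assms(1) by (auto intro: differentiableI_vector)
qed

text \<open>\<open>dbound\<close> only asserts that suitable derivatives exist; uniqueness of
  derivatives identifies them with the iterates of \<open>deriv\<close>.\<close>

lemma deriv_sequence:
  assumes "\<And>n. \<exists>e M. dbound n e M g"
  shows "((deriv ^^ n) g has_real_derivative (deriv ^^ Suc n) g u) (at u)"
  using assms
proof (induction n arbitrary: g)
  case 0
  from 0[of 1] obtain g' where "\<And>u. (g has_real_derivative g' u) (at u)" by auto
  then show ?case using DERIV_imp_deriv by (metis comp_apply funpow_0 funpow.simps(2))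
next
  case (Suc n)
  have "\<exists>e M. dbound m e M (deriv g)" for m
  proof -
    from Suc.prems[of "Suc m"] obtain e M g' where g': "\<And>u. (g has_real_derivative g' u) (at u)" "dbound m e (M / e) g'" by auto
    have "deriv g = g'" using g'(1) by (auto intro: DERIV_imp_deriv)
    then show ?thesis using g'(2) by blast
  qed
  from Suc.IH[OF this] show ?case by (simp add: funpow_swap1)
qed

section \<open>Frame, curvature and orientation of a curve\<close>

lemma curve_frame:
  assumes der: "\<And>u. (\<gamma> has_vector_derivative v u *\<^sub>R edir (\<theta> u)) (at u)" and v: "\<And>u. 0 < v u"
  shows "speed \<gamma> = v" "unit_tangent \<gamma> = (\<lambda>u. edir (\<theta> u))" "arc_deriv \<gamma> g u = (1 / v u) *\<^sub>R vector_derivative g (at u)"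
    and "inner_normal \<gamma> u = rot90 (edir (\<theta> u)) \<or> inner_normal \<gamma> u = - rot90 (edir (\<theta> u))"
proof -
  have d: "vector_derivative \<gamma> (at u) = v u *\<^sub>R edir (\<theta> u)" for u by (rule vector_derivative_at[OF der])
  show s: "speed \<gamma> = v" using v by (auto simp: speed_def d less_imp_le)
  then show "arc_deriv \<gamma> g u = (1 / v u) *\<^sub>R vector_derivative g (at u)" by (simp add: arc_deriv_def)
  have "unit_tangent \<gamma> u = edir (\<theta> u)" for u using v[of u] by (simp add: unit_tangent_def arc_deriv_def s d)
  then show T: "unit_tangent \<gamma> = (\<lambda>u. edir (\<theta> u))" by blast
  show "inner_normal \<gamma> u = rot90 (edir (\<theta> u)) \<or> inner_normal \<gamma> u = - rot90 (edir (\<theta> u))"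
    by (auto simp: inner_normal_def T Let_def)
qed

text \<open>The sign chosen for the normal enters the curvature as well and cancels in the product.
  The right-hand side of the equation can thus be evaluated for every regular curve in polar
  form.\<close>

lemma curve_curvature:
  assumes der: "\<And>u. (\<gamma> has_vector_derivative v u *\<^sub>R edir (\<theta> u)) (at u)" and v: "\<And>u. 0 < v u"
    and \<kappa>: "(\<theta> has_real_derivative \<kappa>) (at u)"
  shows "curvature \<gamma> u = \<kappa> / v u * (rot90 (edir (\<theta> u)) \<bullet> inner_normal \<gamma> u)"
    and "curvature \<gamma> u *\<^sub>R inner_normal \<gamma> u = (\<kappa> / v u) *\<^sub>R rot90 (edir (\<theta> u))"
proof -
  note f = curve_frame[OF der v]
  have "vector_derivative (\<lambda>u. edir (\<theta> u)) (at u) = \<kappa> *\<^sub>R rot90 (edir (\<theta> u))"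
    by (rule vector_derivative_at[OF has_vector_derivative_edir[OF \<kappa>]])
  then show 1: "curvature \<gamma> u = \<kappa> / v u * (rot90 (edir (\<theta> u)) \<bullet> inner_normal \<gamma> u)"
    by (simp add: curvature_def f(2,3))
  show "curvature \<gamma> u *\<^sub>R inner_normal \<gamma> u = (\<kappa> / v u) *\<^sub>R rot90 (edir (\<theta> u))"
    unfolding 1 using f(4)[of u] by auto
qed

lemma strict_mono_if_pos_derivative:
  assumes "\<And>u. (\<theta> has_real_derivative \<kappa> u) (at u)" "\<And>u. 0 < \<kappa> u" shows "strict_mono \<theta>"
  by (rule strict_monoI, rule DERIV_pos_imp_increasing) (use assms in auto)

lemma continuous_on_if_derivative:
  "(\<And>u. (\<theta> has_real_derivative \<kappa> u) (at u)) \<Longrightarrow> continuous_on S \<theta>"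
  by (auto intro!: continuous_at_imp_continuous_on DERIV_isCont)

lemma inj_on_reflect:
  fixes p :: real
  assumes "inj_on g {0..<p}" "\<And>u. g (u + p) = g u" "0 < p"
  shows "inj_on (\<lambda>u. g (- u)) {0..<p}"
proof (rule inj_onI)
  fix a b assume ab: "a \<in> {0..<p}" "b \<in> {0..<p}" "g (- a) = g (- b)"
  obtain n :: int where "- a = - b + of_int n * p" using periodic_inj_onD[OF assms ab(3)] by blast
  then have n: "b - a = of_int n * p" by simp
  have "\<bar>b - a\<bar> < p" using ab(1,2) by auto
  then have "n = 0" unfolding n by (rule int_multiple_eq_0)
  then show "a = b" using n by simp
qed

lemma has_vector_derivative_reflect:
  assumes "\<And>u. (g has_vector_derivative g' u) (at u)"
  shows "((\<lambda>u. g (- u)) has_vector_derivative - g' (- u)) (at u)"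
proof -
  have "((\<lambda>u. - u) has_vector_derivative - 1) (at (u::real))"
    by (auto intro!: derivative_eq_intros simp: has_real_derivative_iff_has_vector_derivative[symmetric])
  from vector_diff_chain_at[OF this assms] show ?thesis by (simp add: o_def)
qed

lemma has_real_derivative_reflect:
  assumes "\<And>u. (g has_real_derivative g' u) (at u)"
  shows "((\<lambda>u. g (- u)) has_real_derivative - g' (- u)) (at u)"
  using has_vector_derivative_reflect[of g g'] assms by (simp add: has_real_derivative_iff_has_vector_derivative)

lemma edir_add_pi: "edir (a + pi) = - edir a"
  by (simp add: vec2_eq_iff)

lemma rot90_minus: "rot90 (- x) = - rot90 x"
  by (simp add: vec2_eq_iff)

text \<open>The sign \<open>s\<close> is the orientation; \<open>s = - 1\<close> is reduced to \<open>s = 1\<close> by reversing the curve.\<close>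

locale oriented_loop =
  fixes \<gamma> :: "real \<Rightarrow> real^2" and v \<theta> \<kappa> :: "real \<Rightarrow> real" and s :: real
  assumes der: "\<And>u. (\<gamma> has_vector_derivative v u *\<^sub>R edir (\<theta> u)) (at u)" and v: "\<And>u. 0 < v u"
    and \<kappa>: "\<And>u. (\<theta> has_real_derivative \<kappa> u) (at u)" "\<And>u. 0 < s * \<kappa> u" and s: "s = 1 \<or> s = -1"
    and per: "\<And>u. \<gamma> (u + 2 * pi) = \<gamma> u" and turn: "\<And>u. \<theta> (u + 2 * pi) = \<theta> u + 2 * pi * s"
begin

lemma pos_convex_loop: "s = 1 \<Longrightarrow> convex_loop \<gamma> v \<theta>"
  by unfold_locales
    (use der v \<kappa> per turn in \<open>auto intro!: strict_mono_if_pos_derivative continuous_on_if_derivative\<close>)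

text \<open>Reversing the parameter turns the tangent around, which adds pi to its angle, and makes
  the angle increasing.\<close>

lemma neg_convex_loop:
  assumes "s = -1" shows "convex_loop (\<lambda>u. \<gamma> (- u)) (\<lambda>u. v (- u)) (\<lambda>u. \<theta> (- u) + pi)"
proof unfold_locales
  fix u
  show "((\<lambda>u. \<gamma> (- u)) has_vector_derivative v (- u) *\<^sub>R edir (\<theta> (- u) + pi)) (at u)"
    using has_vector_derivative_reflect[OF der] by (simp add: edir_add_pi)
  show "0 < v (- u)" by (rule v)
  show "\<gamma> (- (u + 2 * pi)) = \<gamma> (- u)" using per[of "- u - 2 * pi"] by simp
  show "\<theta> (- (u + 2 * pi)) + pi = \<theta> (- u) + pi + 2 * pi" using turn[of "- u - 2 * pi"] assms by simp
  have "((\<lambda>u. \<theta> (- u) + pi) has_real_derivative - \<kappa> (- u)) (at u)" for u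
    using DERIV_add[OF has_real_derivative_reflect[OF \<kappa>(1)] DERIV_const] by simp
  then show "strict_mono (\<lambda>u. \<theta> (- u) + pi)" "continuous_on UNIV (\<lambda>u. \<theta> (- u) + pi)"
    using \<kappa>(2) assms by (auto intro!: strict_mono_if_pos_derivative[where \<kappa> = "\<lambda>u. - \<kappa> (- u)"] continuous_on_if_derivative)
qed

lemma inj_on_period: "inj_on \<gamma> {0..<2 * pi}"
proof (cases "s = 1")
  case True
  then show ?thesis using convex_loop.inj_on_period[OF pos_convex_loop] by simp
next
  case False
  then interpret convex_loop "\<lambda>u. \<gamma> (- u)" "\<lambda>u. v (- u)" "\<lambda>u. \<theta> (- u) + pi" using neg_convex_loop s by simp
  show ?thesis using inj_on_reflect[OF inj_on_period per] by simp
qed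

lemma inner_normal_eq: "inner_normal \<gamma> u = s *\<^sub>R rot90 (edir (\<theta> u))"
proof (cases "s = 1")
  case True
  then show ?thesis using convex_loop.inward[OF pos_convex_loop, of u]
    by (simp add: inner_normal_def curve_frame(2)[OF der v])
next
  case False
  have T: "unit_tangent \<gamma> = (\<lambda>u. edir (\<theta> u))" by (rule curve_frame(2)[OF der v])
  have s1: "s = -1" using False s by simp
  then interpret convex_loop "\<lambda>u. \<gamma> (- u)" "\<lambda>u. v (- u)" "\<lambda>u. \<theta> (- u) + pi" by (rule neg_convex_loop)
  have r: "range (\<lambda>u. \<gamma> (- u)) = range \<gamma>" by (auto simp: image_def) (metis minus_minus)
  have "\<gamma> u + \<epsilon> *\<^sub>R rot90 (edir (\<theta> u)) \<notin> inside (range \<gamma>)" if "0 < \<epsilon>" for \<epsilon>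
    using outward[OF that, of "- u"] by (simp add: r edir_add_pi rot90_minus)
  then have "\<forall>\<^sub>F \<epsilon> in at_right (0::real). \<not> \<gamma> u + \<epsilon> *\<^sub>R rot90 (edir (\<theta> u)) \<in> inside (range \<gamma>)"
    unfolding eventually_at_right_field by (intro exI[of _ 1]) auto
  then have "\<not> (\<forall>\<^sub>F \<epsilon> in at_right (0::real). \<gamma> u + \<epsilon> *\<^sub>R rot90 (edir (\<theta> u)) \<in> inside (range \<gamma>))"
    using eventually_happens'[OF trivial_limit_at_right_real eventually_conj] by blast
  then show ?thesis using s1 unfolding inner_normal_def T Let_def by simp
qed

lemma curvature_pos: "0 < curvature \<gamma> u"
  unfolding curve_curvature(1)[OF der v \<kappa>(1)] inner_normal_eq using \<kappa>(2)[of u] v[of u]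
  by (simp add: mult.commute)

lemma regular: "regular \<gamma>"
proof -
  have "v u *\<^sub>R edir (\<theta> u) \<noteq> 0" for u
  proof -
    have "norm (v u *\<^sub>R edir (\<theta> u)) = v u" using v[of u] by simp
    then show ?thesis using v[of u] by (metis less_irrefl norm_zero)
  qed
  then show ?thesis unfolding regular_def
    using der vector_derivative_at[OF der] by (auto intro: differentiableI_vector)
qed

end

lemma turning_number_pos:
  assumes der: "\<And>u. (\<gamma> has_vector_derivative v u *\<^sub>R edir (\<theta> u)) (at u)" and v: "\<And>u. 0 < v u" "continuous_on UNIV v"
    and \<kappa>: "\<And>u. (\<theta> has_real_derivative \<kappa> u) (at u)" "\<And>u. 0 < \<kappa> u"
    and per: "\<And>u. \<gamma> (u + 2 * pi) = \<gamma> u" and turn: "\<And>u. \<theta> (u + 2 * pi) = \<theta> u + 2 * pi * of_int d"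
    and inj: "inj_on \<gamma> {0..<2 * pi}"
  shows "d = 1"
proof (rule turning_number_eq_1[where \<gamma> = "\<lambda>u. Complex (\<gamma> u $ 1) (\<gamma> u $ 2)" and v = v and \<theta> = \<theta>])
  have c: "((\<lambda>u. \<gamma> u $ i) has_vector_derivative (v u *\<^sub>R edir (\<theta> u)) $ i) (at u)" for u i
    by (rule bounded_linear.has_vector_derivative[OF bounded_linear_vec_nth der])
  show "((\<lambda>u. Complex (\<gamma> u $ 1) (\<gamma> u $ 2)) has_vector_derivative of_real (v u) * cis (\<theta> u)) (at u)" for u
    using c[of 1 u] c[of 2 u] by (simp add: has_real_derivative_iff_has_vector_derivative has_vector_derivative_complex_iff)
  show "inj_on (\<lambda>u. Complex (\<gamma> u $ 1) (\<gamma> u $ 2)) {0..<2 * pi}"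
    using inj by (auto simp: inj_on_def vec2_eq_iff)
qed (use v turn \<kappa> per in \<open>auto intro!: strict_mono_if_pos_derivative continuous_on_if_derivative\<close>)

text \<open>Positive curvature with respect to the inner normal only says that the derivative of the
  tangent angle never vanishes; continuity then gives it a constant sign \<open>s\<close>. The
  turning number equals \<open>s\<close> by Hopf's result, applied to the reversed curve if s =
  -1.\<close>

lemma initial_curve:
  assumes "strictly_convex_closed_curve F"
  shows "\<exists>l \<theta> \<kappa> s. oriented_loop F (\<lambda>u. exp (l u)) \<theta> \<kappa> s \<and> bsmooth l \<and> bsmooth (\<lambda>u. \<theta> u - s * u) \<and>
    bsmooth (\<lambda>u. F u $ 1) \<and> bsmooth (\<lambda>u. F u $ 2) \<and>
    (\<forall>u. l (u + 2 * pi) = l u)"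
proof -
  have sm: "smooth_on_circle F" and reg: "regular F" and inj: "inj_on F {0..<2 * pi}" and cp: "\<And>u. 0 < curvature F u"
    using assms by (auto simp: strictly_convex_closed_curve_def)
  define F1 where "F1 = iter_deriv 1 F"
  define F2 where "F2 = iter_deriv 2 F"
  have d: "(F has_vector_derivative F1 u) (at u)" "(F1 has_vector_derivative F2 u) (at u)" for u
    using smooth_on_circle_sequence(1)[OF sm, of 0 u] smooth_on_circle_sequence(1)[OF sm, of 1 u]
    unfolding F1_def F2_def numeral_2_eq_2 One_nat_def by simp_all
  have per: "F (u + 2 * pi) = F u" "F1 (u + 2 * pi) = F1 u" "F2 (u + 2 * pi) = F2 u" for u
    using smooth_on_circle_sequence(2)[OF sm, of 0 u] smooth_on_circle_sequence(2)[OF sm, of 1 u] smooth_on_circle_sequence(2)[OF sm, of 2 u]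
    unfolding F1_def F2_def by simp_all
  have bs: "bsmooth (\<lambda>u. F u $ i)" "bsmooth (\<lambda>u. F1 u $ i)" "bsmooth (\<lambda>u. F2 u $ i)" for i
    using smooth_on_circle_component_bsmooth[OF sm, of 0 i] smooth_on_circle_component_bsmooth[OF sm, of 1 i]
      smooth_on_circle_component_bsmooth[OF sm, of 2 i] unfolding F1_def F2_def by simp_all
  have c1: "continuous_on UNIV F1" using d(2) by (auto intro!: continuous_at_imp_continuous_on has_vector_derivative_continuous)
  have n0: "F1 u \<noteq> 0" for u using reg vector_derivative_at[OF d(1)] unfolding regular_def by metis
  obtain l \<theta> where l: "continuous_on UNIV l" "continuous_on UNIV \<theta>" "\<And>u. F1 u = exp (l u) *\<^sub>R edir (\<theta> u)"
    using polar_lift[OF c1 convex_imp_contractible[OF convex_UNIV]] n0 by auto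
  define \<kappa> where "\<kappa> u = exp (- l u) * (F2 u \<bullet> rot90 (edir (\<theta> u)))" for u
  define l' where "l' u = exp (- l u) * (F2 u \<bullet> edir (\<theta> u))" for u
  have ld: "(l has_real_derivative l' u) (at u)" "(\<theta> has_real_derivative \<kappa> u) (at u)" for u
    unfolding \<kappa>_def l'_def using polar_derivative[OF d(2) UNIV_I l(3) l(2)] by auto
  have der: "(F has_vector_derivative exp (l u) *\<^sub>R edir (\<theta> u)) (at u)" for u using d(1) l(3) by simp
  have lper: "l (u + 2 * pi) = l u" for u
  proof -
    have "norm (F1 (u + 2 * pi)) = norm (F1 u)" by (simp add: per)
    then show ?thesis unfolding l(3) by simp
  qed
  then have eper: "edir (\<theta> (u + 2 * pi)) = edir (\<theta> u)" for u using per(2)[of u] unfolding l(3) by simp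
  \<comment> \<open>Logarithm and angle are not visibly smooth. Their derivatives, however, are
    polynomials in the components of the first two derivatives of \<open>F\<close>, divided by the
    squared speed \<open>q\<close>.\<close>
  define q where "q u = F1 u $ 1 * F1 u $ 1 + F1 u $ 2 * F1 u $ 2" for u
  have q: "q u = exp (2 * l u)" for u
  proof -
    have "q u = F1 u \<bullet> F1 u" by (simp add: q_def inner_real2)
    then show ?thesis by (simp add: l(3) flip: exp_add)
  qed
  obtain B where B: "\<And>u. \<bar>l u\<bar> \<le> B" using periodic_continuous_bounded[OF l(1), of "2 * pi"] lper by auto
  have bq: "bsmooth (\<lambda>u. 1 / q u)"
  proof (rule bsmooth_inverse)
    show "bsmooth q" unfolding q_def[abs_def] by (intro bsmooth_add bsmooth_mult bs)
    have "((\<lambda>u. F1 u $ i) has_real_derivative F2 u $ i) (at u)" for u i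
      using bounded_linear.has_vector_derivative[OF bounded_linear_vec_nth d(2)]
      by (simp add: has_real_derivative_iff_has_vector_derivative)
    then show "(q has_real_derivative (F1 u $ 1 * F2 u $ 1 + F2 u $ 1 * F1 u $ 1) + (F1 u $ 2 * F2 u $ 2 + F2 u $ 2 * F1 u $ 2)) (at u)" for u
      unfolding q_def[abs_def] by (auto intro!: derivative_eq_intros)
    show "bsmooth (\<lambda>u. (F1 u $ 1 * F2 u $ 1 + F2 u $ 1 * F1 u $ 1) + (F1 u $ 2 * F2 u $ 2 + F2 u $ 2 * F1 u $ 2))"
      by (intro bsmooth_add bsmooth_mult bs)
    show "exp (- (2 * B)) \<le> q u" for u using B[of u] by (simp add: q)
  qed simp
  have ex: "exp (l u) * (1 / q u) = exp (- l u)" for u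
  proof -
    have "exp (- l u) * exp (2 * l u) = exp (l u)" by (simp flip: exp_add)
    then show ?thesis by (simp add: q field_simps)
  qed
  have \<kappa>eq: "\<kappa> = (\<lambda>u. (F2 u $ 2 * F1 u $ 1 - F2 u $ 1 * F1 u $ 2) * (1 / q u))"
    unfolding \<kappa>_def ex[symmetric] by (simp add: fun_eq_iff inner_real2 l(3) algebra_simps)
  have l'eq: "l' = (\<lambda>u. (F2 u $ 1 * F1 u $ 1 + F2 u $ 2 * F1 u $ 2) * (1 / q u))"
    unfolding l'_def ex[symmetric] by (simp add: fun_eq_iff inner_real2 l(3) algebra_simps)
  have b\<kappa>: "bsmooth \<kappa>" unfolding \<kappa>eq by (intro bsmooth_mult bsmooth_diff bs bq)
  have bl': "bsmooth l'" unfolding l'eq by (intro bsmooth_mult bsmooth_add bs bq)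
  have bl: "bsmooth l" by (rule bsmoothI[OF B ld(1) bl'])
  have \<kappa>c: "continuous_on S \<kappa>" for S
  proof -
    obtain M where "dbound (Suc 0) 1 M \<kappa>" using b\<kappa> unfolding bsmooth_def by blast
    then obtain \<kappa>' where "\<And>u. (\<kappa> has_real_derivative \<kappa>' u) (at u)" by auto
    then show ?thesis by (rule continuous_on_if_derivative)
  qed
  have cc: "curvature F u = \<kappa> u / exp (l u) * (rot90 (edir (\<theta> u)) \<bullet> inner_normal F u)" for u
    using curve_curvature(1)[OF der _ ld(2)] by simp
  have \<kappa>0: "\<kappa> u \<noteq> 0" for u using cp[of u] cc[of u] by auto
  define s where "s = sgn (\<kappa> 0)"
  have s: "s = 1 \<or> s = -1" using \<kappa>0[of 0] by (auto simp: s_def sgn_if)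
  have s\<kappa>: "0 < s * \<kappa> u" for u
  proof (rule ccontr)
    assume "\<not> 0 < s * \<kappa> u"
    then have "s * \<kappa> u \<le> 0" by simp
    have "connected (\<kappa> ` UNIV)" by (intro connected_continuous_image \<kappa>c connected_UNIV)
    moreover have "\<kappa> u \<le> 0 \<and> 0 \<le> \<kappa> 0 \<or> \<kappa> 0 \<le> 0 \<and> 0 \<le> \<kappa> u"
      using \<open>s * \<kappa> u \<le> 0\<close> by (auto simp: s_def sgn_if split: if_splits)
    ultimately have "0 \<in> \<kappa> ` UNIV" by (meson connectedD_interval rangeI)
    then show False using \<kappa>0 by auto
  qed
  have "cos (\<theta> (u + 2 * pi) - \<theta> u) = 1" for u using eper edir_eq_iff_cos by blast
  then have const: "\<theta> (u + 2 * pi) - \<theta> u = \<theta> (0 + 2 * pi) - \<theta> 0" for u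
    by (intro constant_if_cos_eq_1[of UNIV "\<lambda>u. \<theta> (u + 2 * pi) - \<theta> u"] continuous_intros continuous_on_compose2[OF l(2)] l(2)) auto
  obtain d :: int where d0: "\<theta> (0 + 2 * pi) - \<theta> 0 = 2 * pi * d"
    using \<open>\<And>u. cos (\<theta> (u + 2 * pi) - \<theta> u) = 1\<close>[of 0] cos_one_2pi_int by (auto simp: mult_ac)
  have turn: "\<theta> (u + 2 * pi) = \<theta> u + 2 * pi * d" for u using const[of u] d0 by simp
  have ds: "real_of_int d = s"
  proof (cases "s = 1")
    case True
    have "d = 1"
      by (rule turning_number_pos[OF der _ _ ld(2) _ per(1) turn inj])
        (use s\<kappa> True in \<open>auto intro!: continuous_intros l(1)\<close>)
    then show ?thesis using True by simp
  next
    case False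
    then have s1: "s = -1" using s by simp
    have "- d = 1"
    proof (rule turning_number_pos[where \<gamma> = "\<lambda>u. F (- u)" and v = "\<lambda>u. exp (l (- u))" and \<theta> = "\<lambda>u. \<theta> (- u) + pi" and \<kappa> = "\<lambda>u. - \<kappa> (- u)"])
      fix u
      show "((\<lambda>u. F (- u)) has_vector_derivative exp (l (- u)) *\<^sub>R edir (\<theta> (- u) + pi)) (at u)"
        using has_vector_derivative_reflect[OF der] by (simp add: edir_add_pi)
      show "((\<lambda>u. \<theta> (- u) + pi) has_real_derivative - \<kappa> (- u)) (at u)"
        using DERIV_add[OF has_real_derivative_reflect[OF ld(2)] DERIV_const] by simp
      show "0 < - \<kappa> (- u)" using s\<kappa>[of "- u"] s1 by simp
      show "F (- (u + 2 * pi)) = F (- u)" using per(1)[of "- u - 2 * pi"] by simp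
      show "\<theta> (- (u + 2 * pi)) + pi = \<theta> (- u) + pi + 2 * pi * real_of_int (- d)"
        using turn[of "- u - 2 * pi"] by simp
      show "continuous_on UNIV (\<lambda>u. exp (l (- u)))"
        by (intro continuous_intros continuous_on_compose2[OF l(1)]) auto
      show "inj_on (\<lambda>u. F (- u)) {0..<2 * pi}"
        by (rule inj_on_reflect[OF inj per(1)]) simp
    qed simp
    then show ?thesis using s1 by simp
  qed
  have "oriented_loop F (\<lambda>u. exp (l u)) \<theta> \<kappa> s"
    by unfold_locales (use der ld(2) s\<kappa> s per(1) turn ds in auto)
  \<comment> \<open>\<theta> itself is unbounded; subtracting s u removes the full turn per period
    and leaves a periodic function.\<close>
  moreover have "bsmooth (\<lambda>u. \<theta> u - s * u)"
  proof -
    have d: "((\<lambda>u. \<theta> u - s * u) has_real_derivative \<kappa> u - s) (at u)" for u by (auto intro!: derivative_eq_intros ld(2))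
    obtain B where "\<And>u. \<bar>\<theta> u - s * u\<bar> \<le> B"
      using periodic_continuous_bounded[of "\<lambda>u. \<theta> u - s * u" "2 * pi", OF continuous_on_if_derivative[OF d]] turn ds
      by (auto simp: algebra_simps)
    then show ?thesis by (rule bsmoothI[OF _ d bsmooth_diff[OF b\<kappa> bsmooth_const]])
  qed
  ultimately show ?thesis using bl bs(1) lper by blast
qed

section \<open>The first-order system of a normal flow\<close>

text \<open>
  \<open>Fwd\<close> and \<open>Bwd\<close> stand for the Riemann invariants \<open>\<sigma> \<plusminus> (\<theta> - s u)\<close> of a normal flow with normal speed \<open>\<sigma>\<close>
  and tangent angle \<open>\<theta>\<close>, and \<open>Len\<close> for the third invariant \<open>ln |\<partial>P/\<partial>u| + \<sigma>\<^sup>2/2\<close>. Carrying \<open>cos (s u)\<close> and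
  \<open>sin (s u)\<close> along as components that do not change in time makes the system autonomous and all
  its components periodic.
\<close>

datatype comp = Fwd | Bwd | Len | PosX | PosY | Cos | Sin

instance comp :: finite
proof
  have "(UNIV :: comp set) = {Fwd, Bwd, Len, PosX, PosY, Cos, Sin}" using comp.exhaust by blast
  then show "finite (UNIV :: comp set)" by (metis finite.emptyI finite_insert)
qed

text \<open>On the state of a curve these functions recover the normal speed, the periodic part
  \<theta> - s u of the angle, the inverse speed 1/v, cos \<theta>, sin \<theta>, and the inner
  product of position and normal.\<close>

definition csig :: "(comp \<Rightarrow> real) \<Rightarrow> real" where "csig x = (x Fwd + x Bwd) * (1 / 2)"
definition cphi :: "(comp \<Rightarrow> real) \<Rightarrow> real" where "cphi x = (x Fwd - x Bwd) * (1 / 2)"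
definition cslow :: "(comp \<Rightarrow> real) \<Rightarrow> real" where "cslow x = exp (csig x * csig x * (1 / 2) - x Len)"
definition ccos :: "(comp \<Rightarrow> real) \<Rightarrow> real" where "ccos x = x Cos * cos (cphi x) - x Sin * sin (cphi x)"
definition csin :: "(comp \<Rightarrow> real) \<Rightarrow> real" where "csin x = x Sin * cos (cphi x) + x Cos * sin (cphi x)"
definition csup :: "(comp \<Rightarrow> real) \<Rightarrow> real" where "csup x = x PosY * ccos x - x PosX * csin x"

definition char_speed :: "comp \<Rightarrow> (comp \<Rightarrow> real) \<Rightarrow> real" where
  "char_speed i = (case i of Fwd \<Rightarrow> (\<lambda>x. cslow x) | Bwd \<Rightarrow> (\<lambda>x. - cslow x) | _ \<Rightarrow> (\<lambda>x. 0))"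

text \<open>The terms s/v arise because \<open>\<theta>\<^sub>u\<close> is the space derivative of
  the periodic part \<theta> - s u plus the constant \<open>s\<close>. The position moves by
  \<sigma> times the normal (-sin \<theta>, cos \<theta>).\<close>

definition source :: "real \<Rightarrow> comp \<Rightarrow> (comp \<Rightarrow> real) \<Rightarrow> real" where
  "source s i = (case i of Fwd \<Rightarrow> (\<lambda>x. s * cslow x) | Bwd \<Rightarrow> (\<lambda>x. s * cslow x)
     | PosX \<Rightarrow> (\<lambda>x. - (csig x * csin x)) | PosY \<Rightarrow> (\<lambda>x. csig x * ccos x) | _ \<Rightarrow> (\<lambda>x. 0))"

definition forcing :: "comp \<Rightarrow> (comp \<Rightarrow> real) \<Rightarrow> real" where
  "forcing i = (case i of Fwd \<Rightarrow> (\<lambda>x. csup x) | Bwd \<Rightarrow> (\<lambda>x. csup x) | Len \<Rightarrow> (\<lambda>x. csig x * csup x) | _ \<Rightarrow> (\<lambda>x. 0))"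

lemma nice_components:
  "nice csig" "nice cphi" "nice cslow" "nice ccos" "nice csin" "nice csup"
proof -
  show 1: "nice csig" unfolding csig_def[abs_def] by (intro nice_mult nice_add nice_proj nice_const)
  show 2: "nice cphi" unfolding cphi_def[abs_def] by (intro nice_mult nice_diff nice_proj nice_const)
  show "nice cslow" unfolding cslow_def[abs_def] by (intro nice_exp nice_diff nice_mult 1 nice_proj nice_const)
  show 3: "nice ccos" unfolding ccos_def[abs_def] by (intro nice_diff nice_mult nice_cos nice_sin 2 nice_proj)
  show 4: "nice csin" unfolding csin_def[abs_def] by (intro nice_add nice_mult nice_cos nice_sin 2 nice_proj)
  show "nice csup" unfolding csup_def[abs_def] by (intro nice_diff nice_mult 3 4 nice_proj)
qed

lemma flow_system: "0 \<le> K \<Longrightarrow> diagonal_system char_speed (source s) forcing K"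
proof
  fix i
  show "nice (char_speed i)" unfolding char_speed_def
    by (cases i) (simp_all add: nice_components nice_minus nice_const)
  show "nice (source s i)" unfolding source_def
    by (cases i) (auto intro!: nice_components nice_minus nice_mult nice_const)
  show "nice (forcing i)" unfolding forcing_def
    by (cases i) (auto intro!: nice_components nice_mult nice_const)
qed

definition state :: "real \<Rightarrow> real \<Rightarrow> real \<Rightarrow> real \<Rightarrow> real \<Rightarrow> real^2 \<Rightarrow> comp \<Rightarrow> real" where
  "state s u \<sigma> \<theta> g P i = (case i of Fwd \<Rightarrow> \<sigma> + (\<theta> - s * u) | Bwd \<Rightarrow> \<sigma> - (\<theta> - s * u) | Len \<Rightarrow> g
     | PosX \<Rightarrow> P $ 1 | PosY \<Rightarrow> P $ 2 | Cos \<Rightarrow> cos (s * u) | Sin \<Rightarrow> sin (s * u))"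

lemma state_simps [simp]:
  "state s u \<sigma> \<theta> g P Fwd = \<sigma> + (\<theta> - s * u)" "state s u \<sigma> \<theta> g P Bwd = \<sigma> - (\<theta> - s * u)"
  "state s u \<sigma> \<theta> g P Len = g" "state s u \<sigma> \<theta> g P PosX = P $ 1" "state s u \<sigma> \<theta> g P PosY = P $ 2"
  "state s u \<sigma> \<theta> g P Cos = cos (s * u)" "state s u \<sigma> \<theta> g P Sin = sin (s * u)"
  by (simp_all add: state_def)

lemma csig_state [simp]: "csig (state s u \<sigma> \<theta> g P) = \<sigma>" by (simp add: csig_def)
lemma cphi_state [simp]: "cphi (state s u \<sigma> \<theta> g P) = \<theta> - s * u" by (simp add: cphi_def)
lemma cslow_state [simp]: "cslow (state s u \<sigma> \<theta> g P) = exp (\<sigma>\<^sup>2 / 2 - g)"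
  by (simp add: cslow_def power2_eq_square)
lemma ccos_state [simp]: "ccos (state s u \<sigma> \<theta> g P) = cos \<theta>"
  using cos_add[of "s * u" "\<theta> - s * u"] by (simp add: ccos_def)
lemma csin_state [simp]: "csin (state s u \<sigma> \<theta> g P) = sin \<theta>"
  using sin_add[of "s * u" "\<theta> - s * u"] by (simp add: csin_def)
lemma csup_state [simp]: "csup (state s u \<sigma> \<theta> g P) = P \<bullet> rot90 (edir \<theta>)"
  by (simp add: csup_def inner_real2)

lemma trig_periodic:
  fixes s :: real
  assumes "s = 1 \<or> s = -1"
  shows "cos (s * (u + 2 * pi)) = cos (s * u)" "sin (s * (u + 2 * pi)) = sin (s * u)"
  using assms cos_periodic[of "- u - 2 * pi"] sin_periodic[of "- u - 2 * pi"] by auto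

text \<open>
  That \<open>\<sigma>\<close>, \<open>\<theta>\<close> and \<open>g\<close> are the normal speed, the tangent angle and \<open>ln |\<partial>P/\<partial>u| + \<sigma>\<^sup>2/2\<close> of the curves is not
  assumed; it propagates from the initial time, see \<open>normal_flow\<close> below.
\<close>

locale frame_flow =
  fixes s T :: real and c :: "real \<Rightarrow> real" and \<sigma> \<theta> g \<sigma>' \<theta>' g' :: "real \<Rightarrow> real \<Rightarrow> real"
    and P P' :: "real \<Rightarrow> real \<Rightarrow> real^2"
  assumes space: "\<And>u t. t \<in> {0..T} \<Longrightarrow> ((\<lambda>x. \<sigma> x t) has_real_derivative \<sigma>' u t) (at u)"
      "\<And>u t. t \<in> {0..T} \<Longrightarrow> ((\<lambda>x. \<theta> x t) has_real_derivative \<theta>' u t) (at u)"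
      "\<And>u t. t \<in> {0..T} \<Longrightarrow> ((\<lambda>x. g x t) has_real_derivative g' u t) (at u)"
      "\<And>u t. t \<in> {0..T} \<Longrightarrow> ((\<lambda>x. P x t) has_vector_derivative P' u t) (at u)"
    and time: "\<And>u t. t \<in> {0..T} \<Longrightarrow> ((\<lambda>\<tau>. \<sigma> u \<tau>) has_real_derivative
        \<theta>' u t * exp ((\<sigma> u t)\<^sup>2 / 2 - g u t) + c t * (P u t \<bullet> rot90 (edir (\<theta> u t)))) (at t within {0..T})"
      "\<And>u t. t \<in> {0..T} \<Longrightarrow> ((\<lambda>\<tau>. \<theta> u \<tau>) has_real_derivative \<sigma>' u t * exp ((\<sigma> u t)\<^sup>2 / 2 - g u t)) (at t within {0..T})"
      "\<And>u t. t \<in> {0..T} \<Longrightarrow> ((\<lambda>\<tau>. g u \<tau>) has_real_derivative c t * (\<sigma> u t * (P u t \<bullet> rot90 (edir (\<theta> u t))))) (at t within {0..T})"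
      "\<And>u t. t \<in> {0..T} \<Longrightarrow> ((\<lambda>\<tau>. P u \<tau>) has_vector_derivative \<sigma> u t *\<^sub>R rot90 (edir (\<theta> u t))) (at t within {0..T})"
    and cont: "continuous_on (UNIV \<times> {0..T}) (\<lambda>(u, t). \<sigma> u t)" "continuous_on (UNIV \<times> {0..T}) (\<lambda>(u, t). \<theta> u t)"
      "continuous_on (UNIV \<times> {0..T}) (\<lambda>(u, t). g u t)" "continuous_on (UNIV \<times> {0..T}) (\<lambda>(u, t). P u t)"
    and cont': "continuous_on (UNIV \<times> {0..T}) (\<lambda>(u, t). \<sigma>' u t)" "continuous_on (UNIV \<times> {0..T}) (\<lambda>(u, t). \<theta>' u t)"
      "continuous_on (UNIV \<times> {0..T}) (\<lambda>(u, t). g' u t)" "continuous_on (UNIV \<times> {0..T}) (\<lambda>(u, t). P' u t)"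
    and per: "\<And>u t. t \<in> {0..T} \<Longrightarrow> \<sigma> (u + 2 * pi) t = \<sigma> u t" "\<And>u t. t \<in> {0..T} \<Longrightarrow> \<theta> (u + 2 * pi) t = \<theta> u t + 2 * pi * s"
      "\<And>u t. t \<in> {0..T} \<Longrightarrow> g (u + 2 * pi) t = g u t" "\<And>u t. t \<in> {0..T} \<Longrightarrow> P (u + 2 * pi) t = P u t"
    and s: "s = 1 \<or> s = -1"
begin

definition Z :: "real \<Rightarrow> comp \<Rightarrow> real \<Rightarrow> real" where
  "Z t i u = state s u (\<sigma> u t) (\<theta> u t) (g u t) (P u t) i"

definition Zu :: "real \<Rightarrow> comp \<Rightarrow> real \<Rightarrow> real" where
  "Zu t i u = (case i of Fwd \<Rightarrow> \<sigma>' u t + (\<theta>' u t - s) | Bwd \<Rightarrow> \<sigma>' u t - (\<theta>' u t - s) | Len \<Rightarrow> g' u t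
     | PosX \<Rightarrow> P' u t $ 1 | PosY \<Rightarrow> P' u t $ 2 | Cos \<Rightarrow> - (sin (s * u) * s) | Sin \<Rightarrow> cos (s * u) * s)"

lemma Z_eq: "(\<lambda>j. Z t j u) = state s u (\<sigma> u t) (\<theta> u t) (g u t) (P u t)"
  by (simp add: Z_def fun_eq_iff)

lemma Z_space: "t \<in> {0..T} \<Longrightarrow> (Z t i has_real_derivative Zu t i u) (at u)"
  unfolding Z_def[abs_def] Zu_def
  by (cases i) (auto intro!: derivative_eq_intros space nth_has_real_derivative[OF space(4)])

lemma Z_time:
  assumes t: "t \<in> {0..T}"
  shows "((\<lambda>t. Z t i u) has_real_derivative
      char_speed i (\<lambda>j. Z t j u) * Zu t i u + source s i (\<lambda>j. Z t j u) + c t * forcing i (\<lambda>j. Z t j u)) (at t within {0..T})"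
proof -
  note d = time[OF t, of u]
  have p: "((\<lambda>\<tau>. P u \<tau> $ 1) has_real_derivative - (\<sigma> u t * sin (\<theta> u t))) (at t within {0..T})"
    "((\<lambda>\<tau>. P u \<tau> $ 2) has_real_derivative \<sigma> u t * cos (\<theta> u t)) (at t within {0..T})"
    using nth_has_real_derivative[OF d(4), of 1] nth_has_real_derivative[OF d(4), of 2] by simp_all
  show ?thesis
  proof (cases i)
    case Fwd
    have "((\<lambda>t. \<sigma> u t + (\<theta> u t - s * u)) has_real_derivative
      (\<theta>' u t * exp ((\<sigma> u t)\<^sup>2 / 2 - g u t) + c t * (P u t \<bullet> rot90 (edir (\<theta> u t)))) + (\<sigma>' u t * exp ((\<sigma> u t)\<^sup>2 / 2 - g u t) - 0)) (at t within {0..T})"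
      by (intro DERIV_add DERIV_diff d DERIV_const)
    then show ?thesis unfolding Z_eq by (simp add: Fwd Z_def Zu_def char_speed_def source_def forcing_def algebra_simps)
  next
    case Bwd
    have "((\<lambda>t. \<sigma> u t - (\<theta> u t - s * u)) has_real_derivative
      (\<theta>' u t * exp ((\<sigma> u t)\<^sup>2 / 2 - g u t) + c t * (P u t \<bullet> rot90 (edir (\<theta> u t)))) - (\<sigma>' u t * exp ((\<sigma> u t)\<^sup>2 / 2 - g u t) - 0)) (at t within {0..T})"
      by (intro DERIV_add DERIV_diff d DERIV_const)
    then show ?thesis unfolding Z_eq by (simp add: Bwd Z_def Zu_def char_speed_def source_def forcing_def algebra_simps)
  next
    case Len
    then show ?thesis unfolding Z_eq using d(3) by (simp add: Z_def char_speed_def source_def forcing_def)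
  next
    case PosX
    then show ?thesis unfolding Z_eq using p(1) by (simp add: Z_def char_speed_def source_def forcing_def)
  next
    case PosY
    then show ?thesis unfolding Z_eq using p(2) by (simp add: Z_def char_speed_def source_def forcing_def)
  qed (simp_all add: Z_def char_speed_def source_def forcing_def)
qed

lemma Z_continuous: "continuous_on (UNIV \<times> {0..T}) (\<lambda>(u, t). Z t i u)"
  using cont unfolding Z_def case_prod_beta by (cases i) (auto intro!: continuous_intros)

lemma Zu_continuous: "continuous_on (UNIV \<times> {0..T}) (\<lambda>(u, t). Zu t i u)"
  using cont' unfolding Zu_def case_prod_beta by (cases i) (auto intro!: continuous_intros)

lemma Z_periodic: "t \<in> {0..T} \<Longrightarrow> Z t i (u + 2 * pi) = Z t i u"
  unfolding Z_def by (cases i) (simp_all add: per trig_periodic[OF s, unfolded distrib_left] distrib_left)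

end

lemma frame_flow_unique:
  assumes 1: "frame_flow s T c \<sigma>1 \<theta>1 g1 \<sigma>1' \<theta>1' g1' P1 P1'" and 2: "frame_flow s T c \<sigma>2 \<theta>2 g2 \<sigma>2' \<theta>2' g2' P2 P2'"
    and init: "\<And>u. \<sigma>1 u 0 = \<sigma>2 u 0" "\<And>u. \<theta>1 u 0 = \<theta>2 u 0" "\<And>u. g1 u 0 = g2 u 0" "\<And>u. P1 u 0 = P2 u 0"
    and c: "\<And>t. t \<in> {0..T} \<Longrightarrow> \<bar>c t\<bar> \<le> c0" and t: "t \<in> {0..T}"
  shows "P1 u t = P2 u t"
proof -
  interpret A: frame_flow s T c \<sigma>1 \<theta>1 g1 \<sigma>1' \<theta>1' g1' P1 P1' by (rule 1)
  interpret B: frame_flow s T c \<sigma>2 \<theta>2 g2 \<sigma>2' \<theta>2' g2' P2 P2' by (rule 2)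
  interpret S: diagonal_system char_speed "source s" forcing 0 by (rule flow_system) simp
  have "A.Z t i u = B.Z t i u" for i
  proof (rule S.uniqueness[OF A.Z_space A.Z_time B.Z_space B.Z_time, where p = "2 * pi" and ?c0.0 = c0])
    show "A.Z 0 i u = B.Z 0 i u" for i u by (simp add: A.Z_def B.Z_def init)
    show "continuous_on ({0..2 * pi} \<times> {0..T}) (\<lambda>(u, t). A.Z t i u)" for i
      by (rule continuous_on_subset[OF A.Z_continuous]) auto
    show "continuous_on ({0..2 * pi} \<times> {0..T}) (\<lambda>(u, t). A.Zu t i u)" for i
      by (rule continuous_on_subset[OF A.Zu_continuous]) auto
    show "continuous_on ({0..2 * pi} \<times> {0..T}) (\<lambda>(u, t). B.Z t i u)" for i
      by (rule continuous_on_subset[OF B.Z_continuous]) auto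
  qed (use A.Z_periodic B.Z_periodic c t in auto)
  from this[of PosX] this[of PosY] show ?thesis by (simp add: A.Z_def B.Z_def vec2_eq_iff)
qed

lemma bsmooth_cos_linear:
  assumes "s = 1 \<or> s = -1" shows "bsmooth (\<lambda>u. cos (s * u + a))"
proof -
  define G where "G n u = s ^ n * cos (s * u + a + real n * (pi / 2))" for n u
  have "(G n has_real_derivative G (Suc n) u) (at u)" for n u
  proof -
    have "cos (s * u + a + real (Suc n) * (pi / 2)) = - sin (s * u + a + real n * (pi / 2))"
      using cos_add[of "s * u + a + real n * (pi / 2)" "pi / 2"] by (simp add: add_divide_distrib algebra_simps)
    moreover have "((\<lambda>u. s ^ n * cos (s * u + a + real n * (pi / 2))) has_real_derivative
       s ^ n * (- sin (s * u + a + real n * (pi / 2)) * s)) (at u)"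
      by (rule derivative_eq_intros refl)+ simp
    ultimately show ?thesis unfolding G_def[abs_def] by (simp add: mult_ac)
  qed
  moreover have "G n (u + 2 * pi) = G n u" for n u
  proof -
    have "cos (s * (u + 2 * pi) + x) = cos (s * u + x)" for x
    proof (cases "s = 1")
      case True
      have "cos (u + x + 2 * pi) = cos (u + x)" by (rule cos_periodic)
      then show ?thesis using True by (simp add: algebra_simps)
    next
      case False
      have "cos (- (u + 2 * pi) + x + 2 * pi) = cos (- (u + 2 * pi) + x)" by (rule cos_periodic)
      then show ?thesis using False assms by simp
    qed
    from this[of "a + real n * (pi / 2)"] show ?thesis by (simp add: G_def add.assoc)
  qed
  ultimately have "bsmooth (G 0)" by (intro bsmooth_sequence[of G "2 * pi" 0]) auto
  then show ?thesis by (simp add: G_def[abs_def])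
qed

lemma frame_flow_exists:
  assumes s: "s = 1 \<or> s = -1" and T0: "0 < T0" and c: "continuous_on {0..T0} c"
    and bs: "bsmooth \<sigma>0" "bsmooth (\<lambda>u. \<theta>0 u - s * u)" "bsmooth g0" "\<And>i. bsmooth (\<lambda>u. P0 u $ i)"
    and per0: "\<And>u. \<sigma>0 (u + 2 * pi) = \<sigma>0 u" "\<And>u. \<theta>0 (u + 2 * pi) = \<theta>0 u + 2 * pi * s"
      "\<And>u. g0 (u + 2 * pi) = g0 u" "\<And>u. P0 (u + 2 * pi) = P0 u"
  shows "\<exists>T>0. T \<le> T0 \<and> (\<exists>\<sigma> \<theta> g \<sigma>' \<theta>' g' P P'. frame_flow s T c \<sigma> \<theta> g \<sigma>' \<theta>' g' P P' \<and>
    (\<forall>u. \<sigma> u 0 = \<sigma>0 u \<and> \<theta> u 0 = \<theta>0 u \<and> g u 0 = g0 u \<and> P u 0 = P0 u) \<and>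
    (\<forall>t\<in>{0..T}. \<forall>n i. \<exists>e M. dbound n e M (\<lambda>u. P u t $ i)))"
proof -
  have "bounded (c ` {0..T0})" by (intro compact_imp_bounded compact_continuous_image c compact_Icc)
  then obtain K where K: "\<And>t. t \<in> {0..T0} \<Longrightarrow> \<bar>c t\<bar> \<le> K" unfolding bounded_iff by (auto simp del: atLeastAtMost_iff)
  have K0: "0 \<le> K" using K[of 0] T0 by auto
  obtain \<Phi> where \<Phi>: "\<And>t. t \<in> {0..T0} \<Longrightarrow> (\<Phi> has_real_derivative c t) (at t within {0..T0})"
    using antiderivative_continuous[OF c] by (auto simp: has_real_derivative_iff_has_vector_derivative)
  \<comment> \<open>The primitive of \<open>c\<close> is frozen outside {0..T0}, since the scheme
    asks for a Lipschitz function on the whole line.\<close>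
  define Cf where "Cf t = \<Phi> (max 0 (min T0 t))" for t
  have Cf: "\<bar>Cf a - Cf b\<bar> \<le> K * \<bar>a - b\<bar>" for a b
  proof -
    have "norm (\<Phi> (max 0 (min T0 a)) - \<Phi> (max 0 (min T0 b))) \<le> K * norm (max 0 (min T0 a) - max 0 (min T0 b))"
      by (rule field_differentiable_bound[OF _ \<Phi>]) (use K T0 in auto)
    also have "\<dots> \<le> K * \<bar>a - b\<bar>" using K0 by (intro mult_left_mono) auto
    finally show ?thesis by (simp add: Cf_def)
  qed
  interpret S: diagonal_system char_speed "source s" forcing K by (rule flow_system[OF K0])
  define w0 where "w0 i u = state s u (\<sigma>0 u) (\<theta>0 u) (g0 u) (P0 u) i" for i u
  have w0: "\<exists>B. tame n 1 B (w0 i)" for i n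
  proof (rule bsmooth_tame)
    have "bsmooth (\<lambda>u. cos (s * u))" "bsmooth (\<lambda>u. sin (s * u))"
      using bsmooth_cos_linear[OF s, of 0] bsmooth_cos_linear[OF s, of "- (pi / 2)"] by (simp_all add: cos_diff)
    then show "bsmooth (w0 i)" unfolding w0_def[abs_def]
      by (cases i) (auto intro!: bsmooth_add bsmooth_diff bs)
  qed
  have w0per: "w0 i (u + 2 * pi) = w0 i u" for i u
    unfolding w0_def by (cases i) (simp_all add: per0 trig_periodic[OF s, unfolded distrib_left] distrib_left)
  show ?thesis
  proof (rule S.local_existence[OF w0 Cf T0])
    fix T :: real and W :: "real \<Rightarrow> comp \<Rightarrow> real \<Rightarrow> real"
    assume T: "0 < T" "T \<le> T0"
    and W0: "\<And>i u. W 0 i u = w0 i u"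
    and Wt: "\<And>n. \<exists>e M. 0 < e \<and> e \<le> 1 \<and> (\<forall>t\<in>{0..T}. \<forall>i. tame n e M (W t i))"
    and Wc: "\<And>i. continuous_on (UNIV \<times> {0..T}) (\<lambda>(u, t). W t i u)"
    and Wuc: "\<And>i. continuous_on (UNIV \<times> {0..T}) (\<lambda>(u, t). deriv (W t i) u)"
    and Wper: "\<And>p t i u. (\<And>i u. w0 i (u + p) = w0 i u) \<Longrightarrow> t \<in> {0..T} \<Longrightarrow> W t i (u + p) = W t i u"
    and Wd: "\<And>t c i u. t \<in> {0..T} \<Longrightarrow> (Cf has_real_derivative c) (at t within {0..T}) \<Longrightarrow>
      ((\<lambda>t. W t i u) has_real_derivative
        char_speed i (\<lambda>j. W t j u) * deriv (W t i) u + source s i (\<lambda>j. W t j u) + c * forcing i (\<lambda>j. W t j u)) (at t within {0..T})"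
  have Cfd: "(Cf has_real_derivative c t) (at t within {0..T})" if t: "t \<in> {0..T}" for t
  proof -
    have "(\<Phi> has_real_derivative c t) (at t within {0..T})"
      by (rule has_field_derivative_subset[OF \<Phi>]) (use t T in auto)
    then show ?thesis
      by (rule has_field_derivative_transform_within[OF _ zero_less_one t]) (use T in \<open>auto simp: Cf_def\<close>)
  qed
  note Wd = Wd[OF _ Cfd]
  have Ws: "(W t i has_real_derivative deriv (W t i) u) (at u)" if "t \<in> {0..T}" for t i u
  proof -
    obtain e M where "tame 0 e M (W t i)" using Wt[of 0] \<open>t \<in> {0..T}\<close> by blast
    then show ?thesis unfolding tame_def using DERIV_deriv_iff_real_differentiable real_differentiable_def by blast
  qed
  \<comment> \<open>These two components have zero speed, source and forcing and so keep their
    initial values. Thereby the abstract components form a genuine state with angle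
    \<theta>.\<close>
  have const: "W t Cos u = cos (s * u)" "W t Sin u = sin (s * u)" if t: "t \<in> {0..T}" for t u
  proof -
    have "W t i u = W 0 i u" if i: "i = Cos \<or> i = Sin" for i
    proof -
      have "\<exists>k. \<forall>t\<in>{0..T}. W t i u = k"
      proof (rule has_field_derivative_zero_constant)
        show "((\<lambda>t. W t i u) has_field_derivative 0) (at t within {0..T})" if "t \<in> {0..T}" for t
          using Wd[OF that that, of i u] i by (auto simp: char_speed_def source_def forcing_def)
      qed simp
      then show ?thesis using t T by auto
    qed
    then show "W t Cos u = cos (s * u)" "W t Sin u = sin (s * u)" by (simp_all add: W0 w0_def)
  qed
  define \<sigma> where "\<sigma> u t = (W t Fwd u + W t Bwd u) / 2" for u t
  define \<theta> where "\<theta> u t = (W t Fwd u - W t Bwd u) / 2 + s * u" for u t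
  define P :: "real \<Rightarrow> real \<Rightarrow> real^2" where "P u t = vector [W t PosX u, W t PosY u]" for u t
  define \<sigma>' where "\<sigma>' u t = (deriv (W t Fwd) u + deriv (W t Bwd) u) / 2" for u t
  define \<theta>' where "\<theta>' u t = (deriv (W t Fwd) u - deriv (W t Bwd) u) / 2 + s" for u t
  define P' :: "real \<Rightarrow> real \<Rightarrow> real^2" where "P' u t = vector [deriv (W t PosX) u, deriv (W t PosY) u]" for u t
  have st: "(\<lambda>j. W t j u) = state s u (\<sigma> u t) (\<theta> u t) (W t Len u) (P u t)" if "t \<in> {0..T}" for t u
  proof
    fix j show "W t j u = state s u (\<sigma> u t) (\<theta> u t) (W t Len u) (P u t) j"
      by (cases j) (simp_all add: \<sigma>_def \<theta>_def P_def const[OF that] field_simps)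
  qed
  have Pvec: "(vector [a, b] :: real^2) = a *\<^sub>R axis 1 1 + b *\<^sub>R axis 2 1" for a b
    by (simp add: vec2_eq_iff axis_def)
  have vec_deriv: "((\<lambda>x. vector [f x, h x] :: real^2) has_vector_derivative vector [f', h']) (at x within S)"
    if "(f has_real_derivative f') (at x within S)" "(h has_real_derivative h') (at x within S)" for f h f' h' x S
  proof -
    have "((\<lambda>x. f x *\<^sub>R axis 1 1 + h x *\<^sub>R axis 2 1 :: real^2) has_vector_derivative
       (f x *\<^sub>R 0 + f' *\<^sub>R axis 1 1) + (h x *\<^sub>R 0 + h' *\<^sub>R axis 2 1)) (at x within S)"
      by (intro has_vector_derivative_add has_vector_derivative_scaleR has_vector_derivative_const that)
    then show ?thesis unfolding Pvec by simp
  qed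
  have ff: "frame_flow s T c \<sigma> \<theta> (\<lambda>u t. W t Len u) \<sigma>' \<theta>' (\<lambda>u t. deriv (W t Len) u) P P'"
  proof
    fix u t assume t: "t \<in> {0..T}"
    have f: "((\<lambda>t. W t Fwd u) has_real_derivative exp ((\<sigma> u t)\<^sup>2 / 2 - W t Len u) * deriv (W t Fwd) u
         + s * exp ((\<sigma> u t)\<^sup>2 / 2 - W t Len u) + c t * (P u t \<bullet> rot90 (edir (\<theta> u t)))) (at t within {0..T})"
      and b: "((\<lambda>t. W t Bwd u) has_real_derivative - exp ((\<sigma> u t)\<^sup>2 / 2 - W t Len u) * deriv (W t Bwd) u
         + s * exp ((\<sigma> u t)\<^sup>2 / 2 - W t Len u) + c t * (P u t \<bullet> rot90 (edir (\<theta> u t)))) (at t within {0..T})"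
      and l: "((\<lambda>t. W t Len u) has_real_derivative c t * (\<sigma> u t * (P u t \<bullet> rot90 (edir (\<theta> u t))))) (at t within {0..T})"
      and x: "((\<lambda>t. W t PosX u) has_real_derivative - (\<sigma> u t * sin (\<theta> u t))) (at t within {0..T})"
      and y: "((\<lambda>t. W t PosY u) has_real_derivative \<sigma> u t * cos (\<theta> u t)) (at t within {0..T})"
      using Wd[OF t t, of Fwd u] Wd[OF t t, of Bwd u] Wd[OF t t, of Len u] Wd[OF t t, of PosX u] Wd[OF t t, of PosY u]
      unfolding st[OF t] by (simp_all add: char_speed_def source_def forcing_def)
    show "((\<lambda>\<tau>. \<sigma> u \<tau>) has_real_derivative \<theta>' u t * exp ((\<sigma> u t)\<^sup>2 / 2 - W t Len u)
        + c t * (P u t \<bullet> rot90 (edir (\<theta> u t)))) (at t within {0..T})"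
    proof -
      have alg: "(y * a + s * y + k + (- y * b + s * y + k)) / 2 = ((a - b) / 2 + s) * y + k" for y a b k :: real
        by (simp add: field_simps)
      have eq: "\<sigma> u = (\<lambda>\<tau>. (W \<tau> Fwd u + W \<tau> Bwd u) / 2)" by (simp add: \<sigma>_def fun_eq_iff)
      show ?thesis using DERIV_cdivide[OF DERIV_add[OF f b], of 2] unfolding eq \<theta>'_def alg .
    qed
    show "((\<lambda>\<tau>. \<theta> u \<tau>) has_real_derivative \<sigma>' u t * exp ((\<sigma> u t)\<^sup>2 / 2 - W t Len u)) (at t within {0..T})"
    proof -
      have alg: "(y * a + s * y + k - (- y * b + s * y + k)) / 2 + 0 = (a + b) / 2 * y" for y a b k :: real
        by (simp add: field_simps)
      have eq: "\<theta> u = (\<lambda>\<tau>. (W \<tau> Fwd u - W \<tau> Bwd u) / 2 + s * u)" by (simp add: \<theta>_def fun_eq_iff)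
      show ?thesis using DERIV_add[OF DERIV_cdivide[OF DERIV_diff[OF f b], of 2] DERIV_const[of "s * u"]]
        unfolding eq \<sigma>'_def alg .
    qed
    show "((\<lambda>t. W t Len u) has_real_derivative c t * (\<sigma> u t * (P u t \<bullet> rot90 (edir (\<theta> u t))))) (at t within {0..T})" by (rule l)
    have "\<sigma> u t *\<^sub>R rot90 (edir (\<theta> u t)) = vector [- (\<sigma> u t * sin (\<theta> u t)), \<sigma> u t * cos (\<theta> u t)]"
      by (simp add: vec2_eq_iff)
    then show "((\<lambda>\<tau>. P u \<tau>) has_vector_derivative \<sigma> u t *\<^sub>R rot90 (edir (\<theta> u t))) (at t within {0..T})"
      unfolding P_def[abs_def] using vec_deriv[OF x y] by simp
    show "((\<lambda>x. \<sigma> x t) has_real_derivative \<sigma>' u t) (at u)"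
      unfolding \<sigma>_def \<sigma>'_def by (intro DERIV_cdivide DERIV_add Ws[OF t])
    show "((\<lambda>x. \<theta> x t) has_real_derivative \<theta>' u t) (at u)"
      unfolding \<theta>_def \<theta>'_def
      by (intro DERIV_add DERIV_cdivide DERIV_diff Ws[OF t]) (auto intro!: derivative_eq_intros)
    show "((\<lambda>x. W t Len x) has_real_derivative deriv (W t Len) u) (at u)" by (rule Ws[OF t])
    show "((\<lambda>x. P x t) has_vector_derivative P' u t) (at u)"
      unfolding P_def P'_def by (intro vec_deriv Ws[OF t])
    have Wp: "W t i (u + 2 * pi) = W t i u" for i using Wper[OF w0per t] .
    show "\<sigma> (u + 2 * pi) t = \<sigma> u t" "\<theta> (u + 2 * pi) t = \<theta> u t + 2 * pi * s" "W t Len (u + 2 * pi) = W t Len u" "P (u + 2 * pi) t = P u t"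
      unfolding \<sigma>_def \<theta>_def P_def Wp by (simp_all add: algebra_simps)
  next
    show "continuous_on (UNIV \<times> {0..T}) (\<lambda>(u, t). \<sigma> u t)" "continuous_on (UNIV \<times> {0..T}) (\<lambda>(u, t). \<theta> u t)"
      "continuous_on (UNIV \<times> {0..T}) (\<lambda>(u, t). W t Len u)" "continuous_on (UNIV \<times> {0..T}) (\<lambda>(u, t). P u t)"
      using Wc unfolding \<sigma>_def \<theta>_def P_def Pvec case_prod_beta by (auto intro!: continuous_intros)
    show "continuous_on (UNIV \<times> {0..T}) (\<lambda>(u, t). \<sigma>' u t)" "continuous_on (UNIV \<times> {0..T}) (\<lambda>(u, t). \<theta>' u t)"
      "continuous_on (UNIV \<times> {0..T}) (\<lambda>(u, t). deriv (W t Len) u)" "continuous_on (UNIV \<times> {0..T}) (\<lambda>(u, t). P' u t)"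
      using Wuc unfolding \<sigma>'_def \<theta>'_def P'_def Pvec case_prod_beta by (auto intro!: continuous_intros)
  qed (rule s)
  have init: "\<sigma> u 0 = \<sigma>0 u \<and> \<theta> u 0 = \<theta>0 u \<and> W 0 Len u = g0 u \<and> P u 0 = P0 u" for u
    by (simp add: \<sigma>_def \<theta>_def P_def W0 w0_def vec2_eq_iff field_simps)
  have bd: "\<exists>e M. dbound n e M (\<lambda>u. P u t $ i)" if t: "t \<in> {0..T}" for t n i
  proof -
    obtain e M where e: "0 < e" "e \<le> 1" "\<And>j. tame n e M (W t j)" using Wt[of n] t by blast
    have "dbound n e M (W t j)" for j using tame_dbound[OF e(3,1,2)] dbound_Suc_imp by blast
    moreover have "(\<lambda>u. P u t $ i) = W t PosX \<or> (\<lambda>u. P u t $ i) = W t PosY"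
      using exhaust_2[of i] by (auto simp: P_def)
    ultimately show ?thesis by metis
  qed
  show ?thesis using T ff init bd by blast
  qed
qed

section \<open>The curvature flow\<close>

lemmas frame_continuous_intros = continuous_intros continuous_on_edir continuous_on_rot90

section \<open>Derivatives of families on half-open time intervals\<close>

lemma at_within_Ico_neq_bot:
  fixes t T :: real
  assumes "t \<in> {0..<T}" shows "at t within {0..<T} \<noteq> bot"
proof -
  have "t islimpt {t<..<T}" using assms by (intro islimpt_greaterThanLessThan1) auto
  then have "t islimpt {0..<T}" by (rule islimpt_subset) (use assms in auto)
  then show ?thesis by (simp add: trivial_limit_within)
qed

lemma vector_derivative_Ico:
  assumes "t \<in> {0..<T}" "(f has_vector_derivative d) (at t within {0..<T})"
    "\<And>\<tau>. \<tau> \<in> {0..<T} \<Longrightarrow> h \<tau> = f \<tau>"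
  shows "(h has_vector_derivative d) (at t within {0..<T})" "vector_derivative h (at t within {0..<T}) = d"
proof -
  show 1: "(h has_vector_derivative d) (at t within {0..<T})"
    by (rule has_vector_derivative_transform[OF assms(1) _ assms(2)]) (use assms(3) in auto)
  show "vector_derivative h (at t within {0..<T}) = d"
    by (rule vector_derivative_within[OF at_within_Ico_neq_bot[OF assms(1)] 1])
qed

lemma C1_familyI:
  assumes eq: "\<And>u t. t \<in> {0..<T} \<Longrightarrow> H u t = K u t"
    and du: "\<And>u t. t \<in> {0..<T} \<Longrightarrow> ((\<lambda>x. K x t) has_vector_derivative Ku u t) (at u)"
    and dt: "\<And>u t. t \<in> {0..<T} \<Longrightarrow> ((\<lambda>\<tau>. K u \<tau>) has_vector_derivative Kt u t) (at t within {0..<T})"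
    and cont: "continuous_on (UNIV \<times> {0..<T}) (\<lambda>(u, t). Ku u t)" "continuous_on (UNIV \<times> {0..<T}) (\<lambda>(u, t). Kt u t)"
  shows "C1_family {0..<T} H" "\<And>u t. t \<in> {0..<T} \<Longrightarrow> deriv_u H u t = Ku u t"
    "\<And>u t. t \<in> {0..<T} \<Longrightarrow> deriv_t {0..<T} H u t = Kt u t"
proof -
  have 1: "((\<lambda>x. H x t) has_vector_derivative Ku u t) (at u)" if "t \<in> {0..<T}" for u t
    using du[OF that] eq[OF that] by simp
  have 2: "((\<lambda>\<tau>. H u \<tau>) has_vector_derivative Kt u t) (at t within {0..<T})" if "t \<in> {0..<T}" for u t
    by (rule vector_derivative_Ico(1)[OF that dt[OF that] eq])
  show 3: "deriv_u H u t = Ku u t" if "t \<in> {0..<T}" for u t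
    unfolding deriv_u_def by (rule vector_derivative_at[OF 1[OF that]])
  show 4: "deriv_t {0..<T} H u t = Kt u t" if "t \<in> {0..<T}" for u t
    unfolding deriv_t_def by (rule vector_derivative_Ico(2)[OF that 2[OF that] refl])
  show "C1_family {0..<T} H" unfolding C1_family_def
  proof (intro conjI allI ballI)
    show "continuous_on (UNIV \<times> {0..<T}) (\<lambda>(u, t). deriv_u H u t)"
      using cont(1) by (rule continuous_on_eq) (auto simp: 3)
    show "continuous_on (UNIV \<times> {0..<T}) (\<lambda>(u, t). deriv_t {0..<T} H u t)"
      using cont(2) by (rule continuous_on_eq) (auto simp: 4)
    show "(\<lambda>x. H x t) differentiable at u" "(\<lambda>\<tau>. H u \<tau>) differentiable at t within {0..<T}" if "t \<in> {0..<T}" for u t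
      by (rule differentiableI_vector[OF 1[OF that]], rule differentiableI_vector[OF 2[OF that]])
  qed
qed

lemma C1_familyD:
  assumes "C1_family I H"
  shows "t \<in> I \<Longrightarrow> ((\<lambda>x. H x t) has_vector_derivative deriv_u H u t) (at u)"
    "t \<in> I \<Longrightarrow> ((\<lambda>\<tau>. H u \<tau>) has_vector_derivative deriv_t I H u t) (at t within I)"
    "continuous_on (UNIV \<times> I) (\<lambda>(u, t). deriv_u H u t)" "continuous_on (UNIV \<times> I) (\<lambda>(u, t). deriv_t I H u t)"
  using assms vector_derivative_works unfolding C1_family_def deriv_u_def deriv_t_def by blast+

text \<open>Differentiability in \<open>u\<close> is assumed at time 0 and for the velocity;
  differentiation under the time integral of the velocity carries it to later times.\<close>

lemma space_derivative_of_time_integral: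
  fixes F A Au :: "real \<Rightarrow> real \<Rightarrow> real^2"
  assumes F: "\<And>u t. t \<in> {0..<T} \<Longrightarrow> (F u has_vector_derivative A u t) (at t within {0..<T})"
    and A: "\<And>u t. t \<in> {0..<T} \<Longrightarrow> ((\<lambda>x. A x t) has_vector_derivative Au u t) (at u)"
    and Au: "continuous_on (UNIV \<times> {0..<T}) (\<lambda>(u, t). Au u t)"
    and init: "((\<lambda>x. F x 0) has_vector_derivative D) (at u)" and t: "t \<in> {0..<T}"
  shows "((\<lambda>x. F x t) has_vector_derivative D + integral {0..t} (Au u)) (at u)"
proof -
  have ftc: "(A x has_integral F x t - F x 0) {0..t}" for x
    by (rule fundamental_theorem_of_calculus)
      (use t in \<open>auto intro: has_vector_derivative_within_subset[OF F]\<close>)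
  have "((\<lambda>x. integral (cbox 0 t) (A x)) has_vector_derivative integral (cbox 0 t) (Au u)) (at u within UNIV)"
  proof (rule leibniz_rule_vector_derivative)
    show "continuous_on (UNIV \<times> cbox 0 t) (\<lambda>(x, t). Au x t)" by (rule continuous_on_subset[OF Au]) (use t in auto)
    show "A x integrable_on cbox 0 t" for x using ftc by (auto simp: integrable_on_def)
  qed (use A t in auto)
  from has_vector_derivative_add[OF init this[unfolded box_real]] show ?thesis
    by (simp add: integral_unique[OF ftc])
qed

text \<open>\<open>C2_family\<close> does not include the symmetry of mixed derivatives. It follows
  from the integral formula for the space derivative, also one-sidedly at time 0.\<close>

lemma mixed_derivative:
  fixes F A Au U :: "real \<Rightarrow> real \<Rightarrow> real^2"
  assumes F: "\<And>u t. t \<in> {0..<T} \<Longrightarrow> (F u has_vector_derivative A u t) (at t within {0..<T})"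
    and A: "\<And>u t. t \<in> {0..<T} \<Longrightarrow> ((\<lambda>x. A x t) has_vector_derivative Au u t) (at u)"
    and Au: "continuous_on (UNIV \<times> {0..<T}) (\<lambda>(u, t). Au u t)"
    and U: "\<And>u t. t \<in> {0..<T} \<Longrightarrow> ((\<lambda>x. F x t) has_vector_derivative U u t) (at u)"
    and t: "t \<in> {0..<T}"
  shows "(U u has_vector_derivative Au u t) (at t within {0..<T})"
proof -
  have U_eq: "U u \<tau> = U u 0 + integral {0..\<tau>} (Au u)" if \<tau>: "\<tau> \<in> {0..<T}" for \<tau>
    using space_derivative_of_time_integral[OF F A Au U \<tau>, of u] U[OF \<tau>, of u] \<tau>
      vector_derivative_unique_at by fastforce
  \<comment> \<open>A closed interval reaching beyond \<open>t\<close> but not up to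
    \<open>T\<close>, on which the fundamental theorem applies; near \<open>t\<close> it induces the
    same filter as {0..<T}.\<close>
  define t2 where "t2 = (t + T) / 2"
  have t2: "t < t2" "t2 < T" "0 \<le> t2" using t by (auto simp: t2_def)
  have "continuous_on {0..t2} (Au u)"
    by (rule continuous_on_compose2[OF Au, of _ "\<lambda>t. (u, t)", simplified]) (use t2 in \<open>auto intro!: continuous_intros\<close>)
  then have "((\<lambda>\<tau>. integral {0..\<tau>} (Au u)) has_vector_derivative Au u t) (at t within {0..t2})"
    by (rule integral_has_vector_derivative) (use t t2 in auto)
  moreover have "at t within {0..t2} = at t within {0..<T}"
    by (rule at_within_nhd[where S = "{..<t2}"]) (use t2 in auto)
  ultimately have "((\<lambda>\<tau>. U u 0 + integral {0..\<tau>} (Au u)) has_vector_derivative 0 + Au u t) (at t within {0..<T})"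
    by (intro has_vector_derivative_add has_vector_derivative_const) simp
  then show ?thesis using vector_derivative_Ico(1)[OF t _ U_eq] by simp
qed

section \<open>From the first-order system back to curves\<close>

lemma (in frame_flow) restrict:
  assumes "T' \<le> T" shows "frame_flow s T' c \<sigma> \<theta> g \<sigma>' \<theta>' g' P P'"
proof
  have sub: "UNIV \<times> {0..T'} \<subseteq> UNIV \<times> {0..T}" "{0..T'} \<subseteq> {0..T}" using assms by auto
  show "continuous_on (UNIV \<times> {0..T'}) (\<lambda>(u, t). \<sigma> u t)" "continuous_on (UNIV \<times> {0..T'}) (\<lambda>(u, t). \<theta> u t)"
    "continuous_on (UNIV \<times> {0..T'}) (\<lambda>(u, t). g u t)" "continuous_on (UNIV \<times> {0..T'}) (\<lambda>(u, t). P u t)"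
    "continuous_on (UNIV \<times> {0..T'}) (\<lambda>(u, t). \<sigma>' u t)" "continuous_on (UNIV \<times> {0..T'}) (\<lambda>(u, t). \<theta>' u t)"
    "continuous_on (UNIV \<times> {0..T'}) (\<lambda>(u, t). g' u t)" "continuous_on (UNIV \<times> {0..T'}) (\<lambda>(u, t). P' u t)"
    by (rule cont[THEN continuous_on_subset, OF sub(1)] cont'[THEN continuous_on_subset, OF sub(1)])+
  fix u t assume "t \<in> {0..T'}"
  then have t: "t \<in> {0..T}" using assms by auto
  show "((\<lambda>x. \<sigma> x t) has_real_derivative \<sigma>' u t) (at u)" "((\<lambda>x. \<theta> x t) has_real_derivative \<theta>' u t) (at u)"
    "((\<lambda>x. g x t) has_real_derivative g' u t) (at u)" "((\<lambda>x. P x t) has_vector_derivative P' u t) (at u)"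
    "\<sigma> (u + 2 * pi) t = \<sigma> u t" "\<theta> (u + 2 * pi) t = \<theta> u t + 2 * pi * s" "g (u + 2 * pi) t = g u t" "P (u + 2 * pi) t = P u t"
    by (rule space[OF t] per[OF t])+
  show "((\<lambda>\<tau>. \<sigma> u \<tau>) has_real_derivative \<theta>' u t * exp ((\<sigma> u t)\<^sup>2 / 2 - g u t) + c t * (P u t \<bullet> rot90 (edir (\<theta> u t)))) (at t within {0..T'})"
    "((\<lambda>\<tau>. \<theta> u \<tau>) has_real_derivative \<sigma>' u t * exp ((\<sigma> u t)\<^sup>2 / 2 - g u t)) (at t within {0..T'})"
    "((\<lambda>\<tau>. g u \<tau>) has_real_derivative c t * (\<sigma> u t * (P u t \<bullet> rot90 (edir (\<theta> u t))))) (at t within {0..T'})"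
    "((\<lambda>\<tau>. P u \<tau>) has_vector_derivative \<sigma> u t *\<^sub>R rot90 (edir (\<theta> u t))) (at t within {0..T'})"
    by (rule has_field_derivative_subset[OF time(1)[OF t] sub(2)] has_field_derivative_subset[OF time(2)[OF t] sub(2)]
      has_field_derivative_subset[OF time(3)[OF t] sub(2)] has_vector_derivative_within_subset[OF time(4)[OF t] sub(2)])+
qed (rule s)

locale normal_flow = frame_flow +
  assumes T: "0 < T" and c: "continuous_on {0..T} c"
    and init: "\<And>u. ((\<lambda>x. P x 0) has_vector_derivative exp (g u 0 - (\<sigma> u 0)\<^sup>2 / 2) *\<^sub>R edir (\<theta> u 0)) (at u)"
begin

abbreviation v :: "real \<Rightarrow> real \<Rightarrow> real" where "v u t \<equiv> exp (g u t - (\<sigma> u t)\<^sup>2 / 2)"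
abbreviation tang :: "real \<Rightarrow> real \<Rightarrow> real^2" where "tang u t \<equiv> edir (\<theta> u t)"
abbreviation norml :: "real \<Rightarrow> real \<Rightarrow> real^2" where "norml u t \<equiv> rot90 (edir (\<theta> u t))"

abbreviation \<sigma>_t :: "real \<Rightarrow> real \<Rightarrow> real" where "\<sigma>_t u t \<equiv> \<theta>' u t / v u t + c t * (P u t \<bullet> norml u t)"
abbreviation vel_u :: "real \<Rightarrow> real \<Rightarrow> real^2" where
  "vel_u u t \<equiv> \<sigma>' u t *\<^sub>R norml u t - (\<sigma> u t * \<theta>' u t) *\<^sub>R tang u t"

lemma exp_slow: "exp ((\<sigma> u t)\<^sup>2 / 2 - g u t) = 1 / v u t"
  by (simp add: inverse_eq_divide[symmetric] exp_minus[symmetric])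

lemma in_Icc: "t \<in> {0..<T} \<Longrightarrow> t \<in> {0..T}" by auto

lemma time_Ico:
  assumes "t \<in> {0..<T}"
  shows "((\<lambda>\<tau>. \<sigma> u \<tau>) has_real_derivative \<sigma>_t u t) (at t within {0..<T})"
    "((\<lambda>\<tau>. \<theta> u \<tau>) has_real_derivative \<sigma>' u t / v u t) (at t within {0..<T})"
    "((\<lambda>\<tau>. g u \<tau>) has_real_derivative c t * (\<sigma> u t * (P u t \<bullet> norml u t))) (at t within {0..<T})"
    "((\<lambda>\<tau>. P u \<tau>) has_vector_derivative \<sigma> u t *\<^sub>R norml u t) (at t within {0..<T})"
proof -
  have sub: "{0..<T} \<subseteq> {0..T}" by auto
  note r = time[OF in_Icc[OF assms], of u]
  show "((\<lambda>\<tau>. \<sigma> u \<tau>) has_real_derivative \<sigma>_t u t) (at t within {0..<T})"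
    "((\<lambda>\<tau>. \<theta> u \<tau>) has_real_derivative \<sigma>' u t / v u t) (at t within {0..<T})"
    using has_field_derivative_subset[OF r(1) sub] has_field_derivative_subset[OF r(2) sub] by (simp_all add: exp_slow)
  show "((\<lambda>\<tau>. g u \<tau>) has_real_derivative c t * (\<sigma> u t * (P u t \<bullet> norml u t))) (at t within {0..<T})"
    by (rule has_field_derivative_subset[OF r(3) sub])
  show "((\<lambda>\<tau>. P u \<tau>) has_vector_derivative \<sigma> u t *\<^sub>R norml u t) (at t within {0..<T})"
    by (rule has_vector_derivative_within_subset[OF r(4) sub])
qed

lemma vel_space:
  "t \<in> {0..T} \<Longrightarrow> ((\<lambda>x. \<sigma> x t *\<^sub>R norml x t) has_vector_derivative vel_u u t) (at u)"
  using has_vector_derivative_scaleR[OF space(1) has_vector_derivative_normal[OF space(2)], of t t u] by simp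

text \<open>In the derivative of \<open>v\<close> the terms with \<open>c\<close> from
  \<open>g\<close> and from \<sigma> cancel, leaving -\<sigma> \<theta>'. With the rotation of the
  tangent this is the space derivative of the velocity.\<close>

lemma tangent_time:
  assumes t: "t \<in> {0..<T}"
  shows "((\<lambda>\<tau>. v u \<tau> *\<^sub>R tang u \<tau>) has_vector_derivative vel_u u t) (at t within {0..<T})"
proof -
  note d = time_Ico[OF t, of u]
  have "((\<lambda>\<tau>. v u \<tau>) has_real_derivative v u t * (c t * (\<sigma> u t * (P u t \<bullet> norml u t)) - \<sigma> u t * \<sigma>_t u t)) (at t within {0..<T})"
    by (rule has_real_derivative_speed) (rule d)+
  moreover have "v u t * (c t * (\<sigma> u t * (P u t \<bullet> norml u t)) - \<sigma> u t * \<sigma>_t u t) = - (\<sigma> u t * \<theta>' u t)"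
    by (simp add: field_simps)
  ultimately have "((\<lambda>\<tau>. v u \<tau>) has_real_derivative - (\<sigma> u t * \<theta>' u t)) (at t within {0..<T})" by simp
  from has_vector_derivative_scaleR[OF this has_vector_derivative_edir[OF d(2)]] show ?thesis by (simp add: algebra_simps)
qed

lemma cont_Ico: "continuous_on (UNIV \<times> {0..T}) f \<Longrightarrow> continuous_on (UNIV \<times> {0..<T}) f"
  by (rule continuous_on_subset) auto

lemma cont_c: "continuous_on (UNIV \<times> {0..<T}) (\<lambda>x. c (snd x))"
  by (rule continuous_on_compose2[OF c continuous_on_snd]) auto

lemmas cont_all = cont[unfolded case_prod_beta] cont'[unfolded case_prod_beta]

lemma vel_u_continuous: "continuous_on (UNIV \<times> {0..<T}) (\<lambda>(u, t). vel_u u t)"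
  unfolding case_prod_beta by (intro frame_continuous_intros cont_Ico cont_all)

text \<open>The true space derivative of \<open>P\<close> and the candidate \<open>v\<close> times
  \<open>tang\<close> have the same time derivative \<open>vel_u\<close> and agree at time
  0.\<close>

lemma P_space:
  assumes t: "t \<in> {0..<T}" shows "((\<lambda>x. P x t) has_vector_derivative v u t *\<^sub>R tang u t) (at u)"
proof -
  have "((\<lambda>x. P x t) has_vector_derivative v u 0 *\<^sub>R tang u 0 + integral {0..t} (vel_u u)) (at u)"
    by (rule space_derivative_of_time_integral[OF time_Ico(4) vel_space vel_u_continuous init t]) auto
  moreover have "(vel_u u has_integral v u t *\<^sub>R tang u t - v u 0 *\<^sub>R tang u 0) {0..t}"
    by (rule fundamental_theorem_of_calculus)
      (use t in \<open>auto intro: has_vector_derivative_within_subset[OF tangent_time]\<close>)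
  ultimately show ?thesis by (simp add: integral_unique)
qed

lemma tangent_space:
  assumes t: "t \<in> {0..<T}"
  shows "((\<lambda>x. v x t *\<^sub>R tang x t) has_vector_derivative
    (v u t * (g' u t - \<sigma> u t * \<sigma>' u t)) *\<^sub>R tang u t + (v u t * \<theta>' u t) *\<^sub>R norml u t) (at u)"
proof -
  note d = space[OF in_Icc[OF t], of u]
  have "((\<lambda>x. v x t) has_real_derivative v u t * (g' u t - \<sigma> u t * \<sigma>' u t)) (at u)"
    by (rule has_real_derivative_speed) (rule d)+
  from has_vector_derivative_scaleR[OF this has_vector_derivative_edir[OF d(2)]] show ?thesis
    by (simp add: algebra_simps)
qed

lemma vel_time:
  assumes t: "t \<in> {0..<T}"
  shows "((\<lambda>\<tau>. \<sigma> u \<tau> *\<^sub>R norml u \<tau>) has_vector_derivative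
    \<sigma>_t u t *\<^sub>R norml u t - (\<sigma> u t * (\<sigma>' u t / v u t)) *\<^sub>R tang u t) (at t within {0..<T})"
  using has_vector_derivative_scaleR[OF time_Ico(1)[OF t] has_vector_derivative_normal[OF time_Ico(2)[OF t]]] by simp

lemma P_family: "C1_family {0..<T} P"
    "\<And>u t. t \<in> {0..<T} \<Longrightarrow> deriv_u P u t = v u t *\<^sub>R tang u t"
    "\<And>u t. t \<in> {0..<T} \<Longrightarrow> deriv_t {0..<T} P u t = \<sigma> u t *\<^sub>R norml u t"
proof -
  have "continuous_on (UNIV \<times> {0..<T}) (\<lambda>(u, t). v u t *\<^sub>R tang u t)"
    "continuous_on (UNIV \<times> {0..<T}) (\<lambda>(u, t). \<sigma> u t *\<^sub>R norml u t)"
    unfolding case_prod_beta by (intro frame_continuous_intros cont_Ico cont_all; simp)+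
  from C1_familyI[OF refl P_space time_Ico(4) this]
  show "C1_family {0..<T} P"
    "\<And>u t. t \<in> {0..<T} \<Longrightarrow> deriv_u P u t = v u t *\<^sub>R tang u t"
    "\<And>u t. t \<in> {0..<T} \<Longrightarrow> deriv_t {0..<T} P u t = \<sigma> u t *\<^sub>R norml u t" by auto
qed

lemma Pu_family: "C1_family {0..<T} (deriv_u P)"
proof (rule C1_familyI(1)[OF P_family(2) tangent_space tangent_time])
  show "continuous_on (UNIV \<times> {0..<T}) (\<lambda>(u, t). (v u t * (g' u t - \<sigma> u t * \<sigma>' u t)) *\<^sub>R tang u t + (v u t * \<theta>' u t) *\<^sub>R norml u t)"
    unfolding case_prod_beta by (intro frame_continuous_intros cont_Ico cont_all; simp)
qed (auto intro: vel_u_continuous)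

lemma Pt_family: "C1_family {0..<T} (deriv_t {0..<T} P)"
    "\<And>u t. t \<in> {0..<T} \<Longrightarrow> deriv_u (deriv_t {0..<T} P) u t = vel_u u t"
    "\<And>u t. t \<in> {0..<T} \<Longrightarrow> deriv_t {0..<T} (deriv_t {0..<T} P) u t
      = \<sigma>_t u t *\<^sub>R norml u t - (\<sigma> u t * (\<sigma>' u t / v u t)) *\<^sub>R tang u t"
proof -
  have 1: "continuous_on (UNIV \<times> {0..<T}) (\<lambda>(u, t). \<sigma>_t u t *\<^sub>R norml u t - (\<sigma> u t * (\<sigma>' u t / v u t)) *\<^sub>R tang u t)"
    unfolding case_prod_beta by (intro frame_continuous_intros cont_Ico cont_all cont_c; simp)
  have 2: "((\<lambda>x. \<sigma> x t *\<^sub>R norml x t) has_vector_derivative vel_u u t) (at u)" if "t \<in> {0..<T}" for u t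
    by (rule vel_space[OF in_Icc[OF that]])
  from C1_familyI[OF P_family(3) 2 vel_time vel_u_continuous 1]
  show "C1_family {0..<T} (deriv_t {0..<T} P)"
    "\<And>u t. t \<in> {0..<T} \<Longrightarrow> deriv_u (deriv_t {0..<T} P) u t = vel_u u t"
    "\<And>u t. t \<in> {0..<T} \<Longrightarrow> deriv_t {0..<T} (deriv_t {0..<T} P) u t
      = \<sigma>_t u t *\<^sub>R norml u t - (\<sigma> u t * (\<sigma>' u t / v u t)) *\<^sub>R tang u t" by auto
qed

text \<open>The normal part of the acceleration is the curvature term plus the normal part of c P.
  Its tangential part is minus the mixed-derivative term of \<open>grad_rho\<close>, while the
  \<open>c\<close> term of \<open>grad_rho\<close> cancels the tangential part of c P.\<close>

lemma equation:
  assumes t: "t \<in> {0..<T}"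
  shows "deriv_t {0..<T} (deriv_t {0..<T} P) u t = curvature (\<lambda>x. P x t) u *\<^sub>R inner_normal (\<lambda>x. P x t) u
     - grad_rho {0..<T} c P u t + c t *\<^sub>R P u t"
proof -
  have vp: "0 < v x t" for x by simp
  note fr = curve_frame[OF P_space[OF t] vp]
  have cN: "curvature (\<lambda>x. P x t) u *\<^sub>R inner_normal (\<lambda>x. P x t) u = (\<theta>' u t / v u t) *\<^sub>R norml u t"
    by (rule curve_curvature(2)[OF P_space[OF t] vp space(2)[OF in_Icc[OF t]]])
  have ad: "arc_deriv (\<lambda>x. P x t) (\<lambda>x. \<sigma> x t *\<^sub>R norml x t) u = (1 / v u t) *\<^sub>R vel_u u t"
    unfolding fr(3) using vector_derivative_at[OF vel_space[OF in_Icc[OF t]]] by simp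
  have gr: "grad_rho {0..<T} c P u t = (\<sigma> u t * (\<sigma>' u t / v u t) + c t * (P u t \<bullet> tang u t)) *\<^sub>R tang u t"
  proof -
    have "((1 / v u t) *\<^sub>R vel_u u t) \<bullet> (\<sigma> u t *\<^sub>R norml u t) = \<sigma> u t * (\<sigma>' u t / v u t)"
      by (simp add: inner_diff_left)
    then show ?thesis unfolding grad_rho_def Let_def P_family(3)[OF t] ad fr(2) by simp
  qed
  have "c t *\<^sub>R P u t = (c t * (P u t \<bullet> tang u t)) *\<^sub>R tang u t + (c t * (P u t \<bullet> norml u t)) *\<^sub>R norml u t"
    using arg_cong[OF real2_frame[of "P u t" "\<theta> u t"], of "\<lambda>x. c t *\<^sub>R x"] by (simp add: scaleR_add_right)
  then show ?thesis unfolding Pt_family(3)[OF t] cN gr by (simp add: algebra_simps)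
qed

lemma loop:
  assumes "t \<in> {0..<T}" "\<And>u. 0 < s * \<theta>' u t"
  shows "oriented_loop (\<lambda>u. P u t) (\<lambda>u. v u t) (\<lambda>u. \<theta> u t) (\<lambda>u. \<theta>' u t) s"
  by unfold_locales (use P_space assms space(2) s per in auto)

end

text \<open>The converse direction, needed for uniqueness: regularity of the curves gives the space
  derivative a polar form on the whole strip, and the equation turns this frame into a solution of
  the first-order system. The final time t1 < T leaves a compact time interval for the maximum
  principle.\<close>

lemma solution_frame_flow:
  assumes sol: "solves_ivp c F0 f T G" and t1: "0 \<le> t1" "t1 < T"
    and F0: "oriented_loop F0 (\<lambda>u. exp (l0 u)) \<theta>0 \<kappa>0 s"
  shows "\<exists>\<sigma> \<theta> g \<sigma>' \<theta>' g' G'. frame_flow s t1 c \<sigma> \<theta> g \<sigma>' \<theta>' g' G G' \<and>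
    (\<forall>u. \<sigma> u 0 = s * f u \<and> \<theta> u 0 = \<theta>0 u \<and> g u 0 = l0 u + (s * f u)\<^sup>2 / 2 \<and> G u 0 = F0 u)"
proof -
  interpret L: oriented_loop F0 "\<lambda>u. exp (l0 u)" \<theta>0 \<kappa>0 s by (rule F0)
  define I where "I = {0..<T}"
  define U where "U = deriv_u G"
  define V where "V = deriv_t I G"
  define Uu where "Uu = deriv_u U"
  define Vu where "Vu = deriv_u V"
  define Vt where "Vt = deriv_t I V"
  have I0: "0 \<in> I" "t1 \<in> I" using t1 by (auto simp: I_def)
  from sol have C2: "C2_family I G"
    and per: "\<And>t u. t \<in> I \<Longrightarrow> G (u + 2 * pi) t = G u t"
    and reg: "\<And>t. t \<in> I \<Longrightarrow> regular (\<lambda>u. G u t)"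
    and eqn: "\<And>u t. t \<in> I \<Longrightarrow> Vt u t = curvature (\<lambda>x. G x t) u *\<^sub>R inner_normal (\<lambda>x. G x t) u - grad_rho I c G u t + c t *\<^sub>R G u t"
    and G0: "\<And>u. G u 0 = F0 u" and V0: "\<And>u. V u 0 = f u *\<^sub>R inner_normal F0 u"
    unfolding solves_ivp_def Let_def I_def[symmetric] Vt_def V_def periodic_fun_simple_def by auto
  have C1: "C1_family I G" "C1_family I U" "C1_family I V"
    using C2 unfolding C2_family_def U_def V_def by auto
  note dG = C1_familyD[OF C1(1), folded U_def V_def]
  note dU = C1_familyD[OF C1(2), folded Uu_def]
  note dV = C1_familyD[OF C1(3), folded Vu_def Vt_def]
  have Ut: "(U u has_vector_derivative Vu u t) (at t within I)" if "t \<in> I" for u t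
    using mixed_derivative[of T G V Vu U t u] dG(1,2) dV(1,3) that unfolding I_def by blast
  define S where "S = (UNIV :: real set) \<times> I"
  have U0: "U u t \<noteq> 0" if "t \<in> I" for u t
    using reg[OF that] unfolding regular_def U_def deriv_u_def by blast
  have "contractible S" unfolding S_def I_def by (intro convex_imp_contractible convex_Times) auto
  then obtain l \<theta>1 where l: "continuous_on S l" "continuous_on S \<theta>1"
      "\<And>x. x \<in> S \<Longrightarrow> (\<lambda>(u, t). U u t) x = exp (l x) *\<^sub>R edir (\<theta>1 x)"
    using polar_lift[of S "\<lambda>(u, t). U u t"] dG(3) U0 unfolding S_def by (auto simp: case_prod_beta)
  have Upol1: "U u t = exp (l (u, t)) *\<^sub>R edir (\<theta>1 (u, t))" if "t \<in> I" for u t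
    using l(3)[of "(u, t)"] that by (simp add: S_def)
  have slice: "continuous_on UNIV (\<lambda>u. h (u, t))" "continuous_on I (\<lambda>t. h (u, t))" if "continuous_on S h" "t \<in> I"
    for h :: "real \<times> real \<Rightarrow> real" and u t
    by (rule continuous_on_compose2[OF that(1)]; use that(2) in \<open>auto simp: S_def intro!: continuous_intros\<close>)+
  have init_pol: "exp (l (u, 0)) *\<^sub>R edir (\<theta>1 (u, 0)) = exp (l0 u) *\<^sub>R edir (\<theta>0 u)" for u
  proof -
    have "U u 0 = exp (l0 u) *\<^sub>R edir (\<theta>0 u)"
      using vector_derivative_at[OF L.der] G0 by (simp add: U_def deriv_u_def)
    then show ?thesis using Upol1[OF I0(1)] by simp
  qed
  have l_init: "l (u, 0) = l0 u" for u using arg_cong[OF init_pol[of u], of norm] by simp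
  have "edir (\<theta>1 (u, 0)) = edir (\<theta>0 u)" for u using init_pol[of u] unfolding l_init by simp
  then have cos1: "cos (\<theta>1 (u, 0) - \<theta>0 u) = 1" for u using edir_eq_iff_cos by blast
  \<comment> \<open>The lifted angle agrees initially with \<open>\<theta>0\<close> up to one fixed
    multiple of 2 pi; it is subtracted so that all flows start from the same angle.\<close>
  define k where "k = \<theta>1 (0, 0) - \<theta>0 0"
  have k: "\<theta>1 (u, 0) - \<theta>0 u = k" for u
    unfolding k_def
    by (rule constant_if_cos_eq_1[of UNIV "\<lambda>u. \<theta>1 (u, 0) - \<theta>0 u"])
      (auto intro!: continuous_intros slice[OF l(2) I0(1)] continuous_on_if_derivative[OF L.\<kappa>(1)] cos1)
  have cosk: "cos k = 1" using cos1[of 0] k by simp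
  define \<theta> where "\<theta> u t = \<theta>1 (u, t) - k" for u t
  define lv where "lv u t = l (u, t)" for u t
  have Upol: "U u t = exp (lv u t) *\<^sub>R edir (\<theta> u t)" if "t \<in> I" for u t
  proof -
    have "edir (\<theta> u t) = edir (\<theta>1 (u, t))" unfolding edir_eq_iff_cos by (simp add: \<theta>_def cosk)
    then show ?thesis using Upol1[OF that] by (simp add: lv_def)
  qed
  have \<theta>_init: "\<theta> u 0 = \<theta>0 u" for u using k[of u] by (simp add: \<theta>_def)
  have \<theta>_cont: "continuous_on S (\<lambda>(u, t). \<theta> u t)" unfolding \<theta>_def case_prod_beta
    by (auto intro!: continuous_intros l(2))
  have lv_cont: "continuous_on S (\<lambda>(u, t). lv u t)" unfolding lv_def case_prod_beta by (auto intro!: l(1))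
  have \<theta>_slice: "continuous_on UNIV (\<lambda>u. \<theta> u t)" "continuous_on I (\<lambda>t. \<theta> u t)" if "t \<in> I" for u t
    unfolding \<theta>_def using slice[OF l(2) that] by (auto intro!: continuous_intros)
  define N where "N u t = rot90 (edir (\<theta> u t))" for u t
  define \<theta>' where "\<theta>' u t = exp (- lv u t) * (Uu u t \<bullet> N u t)" for u t
  define l' where "l' u t = exp (- lv u t) * (Uu u t \<bullet> edir (\<theta> u t))" for u t
  have du: "((\<lambda>x. lv x t) has_real_derivative l' u t) (at u)" "((\<lambda>x. \<theta> x t) has_real_derivative \<theta>' u t) (at u)" if t: "t \<in> I" for u t
    using polar_derivative[OF dU(1)[OF t, of u] UNIV_I, of "\<lambda>x. lv x t" "\<lambda>x. \<theta> x t"] Upol[OF t] \<theta>_slice(1)[OF t]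
    unfolding l'_def \<theta>'_def N_def by auto
  have dt: "((\<lambda>\<tau>. lv u \<tau>) has_real_derivative exp (- lv u t) * (Vu u t \<bullet> edir (\<theta> u t))) (at t within I)"
     "((\<lambda>\<tau>. \<theta> u \<tau>) has_real_derivative exp (- lv u t) * (Vu u t \<bullet> N u t)) (at t within I)" if t: "t \<in> I" for u t
    using polar_derivative[OF Ut[OF t, of u] t, of "\<lambda>\<tau>. lv u \<tau>" "\<lambda>\<tau>. \<theta> u \<tau>"] Upol \<theta>_slice(2)[OF t]
    unfolding N_def by auto
  have E_u: "((\<lambda>x. edir (\<theta> x t)) has_vector_derivative \<theta>' u t *\<^sub>R N u t) (at u)" if "t \<in> I" for u t
    unfolding N_def by (rule has_vector_derivative_edir[OF du(2)[OF that]])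
  have N_u: "((\<lambda>x. N x t) has_vector_derivative - (\<theta>' u t *\<^sub>R edir (\<theta> u t))) (at u)" if "t \<in> I" for u t
    using has_vector_derivative_rot90[OF E_u[OF that]] by (simp add: N_def rot90_scaleR rot90_rot90)
  define \<theta>t where "\<theta>t u t = exp (- lv u t) * (Vu u t \<bullet> N u t)" for u t
  have N_t: "((\<lambda>\<tau>. N u \<tau>) has_vector_derivative - (\<theta>t u t *\<^sub>R edir (\<theta> u t))) (at t within I)" if "t \<in> I" for u t
    using has_vector_derivative_rot90[OF has_vector_derivative_edir[OF dt(2)[OF that]]]
    by (simp add: N_def \<theta>t_def rot90_scaleR rot90_rot90)
  have Gpol: "((\<lambda>x. G x t) has_vector_derivative exp (lv u t) *\<^sub>R edir (\<theta> u t)) (at u)" if "t \<in> I" for u t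
    using dG(1)[OF that] Upol[OF that] by simp
  have EN: "edir (\<theta> u t) \<bullet> N u t = 0" "N u t \<bullet> edir (\<theta> u t) = 0" "N u t \<bullet> N u t = 1" for u t
    using inner_commute[of "rot90 (edir (\<theta> u t))" "edir (\<theta> u t)"] by (simp_all add: N_def)
  have Vt_eq: "Vt u t = (\<theta>' u t / exp (lv u t)) *\<^sub>R N u t
     - (exp (- lv u t) * (Vu u t \<bullet> V u t) + c t * (G u t \<bullet> edir (\<theta> u t))) *\<^sub>R edir (\<theta> u t) + c t *\<^sub>R G u t" if t: "t \<in> I" for u t
  proof -
    have p: "0 < exp (lv u t)" for u by simp
    note fr = curve_frame[OF Gpol[OF t] p]
    have "curvature (\<lambda>x. G x t) u *\<^sub>R inner_normal (\<lambda>x. G x t) u = (\<theta>' u t / exp (lv u t)) *\<^sub>R N u t"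
      unfolding N_def by (rule curve_curvature(2)[OF Gpol[OF t] p du(2)[OF t]])
    moreover have "arc_deriv (\<lambda>x. G x t) (\<lambda>x. V x t) u = exp (- lv u t) *\<^sub>R Vu u t"
      unfolding fr(3) by (simp add: Vu_def deriv_u_def exp_minus inverse_eq_divide)
    then have "grad_rho I c G u t = (exp (- lv u t) * (Vu u t \<bullet> V u t) + c t * (G u t \<bullet> edir (\<theta> u t))) *\<^sub>R edir (\<theta> u t)"
      unfolding grad_rho_def Let_def V_def[symmetric] fr(2) by simp
    ultimately show ?thesis using eqn[OF t, of u] by simp
  qed
  \<comment> \<open>The equation gives (Vt, U) = -(Vu, V), since the \<open>c\<close> terms cancel
    tangentially, and the time derivative of \<open>U\<close> is \<open>Vu\<close>. Hence (V, U)
    does not change in time, and it vanishes initially.\<close>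
  have VE: "V u t \<bullet> edir (\<theta> u t) = 0" if t: "t \<in> I" for u t
  proof -
    have d: "((\<lambda>\<tau>. V u \<tau> \<bullet> U u \<tau>) has_real_derivative 0) (at \<tau> within I)" if \<tau>: "\<tau> \<in> I" for \<tau>
    proof -
      have ee: "exp (lv u \<tau>) * exp (- lv u \<tau>) = 1" by (simp flip: exp_add)
      have "Vt u \<tau> \<bullet> edir (\<theta> u \<tau>) = - (exp (- lv u \<tau>) * (Vu u \<tau> \<bullet> V u \<tau>))"
        unfolding Vt_eq[OF \<tau>] by (simp add: inner_diff_left inner_add_left EN)
      then have "Vt u \<tau> \<bullet> U u \<tau> = - ((exp (lv u \<tau>) * exp (- lv u \<tau>)) * (Vu u \<tau> \<bullet> V u \<tau>))"
        unfolding Upol[OF \<tau>] by (simp del: exp_minus)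
      then have "V u \<tau> \<bullet> Vu u \<tau> + Vt u \<tau> \<bullet> U u \<tau> = 0"
        unfolding ee by (simp add: inner_commute)
      then show ?thesis using has_real_derivative_inner[OF dV(2)[OF \<tau>, of u] Ut[OF \<tau>, of u]] by simp
    qed
    have "\<exists>q. \<forall>\<tau>\<in>I. V u \<tau> \<bullet> U u \<tau> = q"
      by (rule has_field_derivative_zero_constant[OF _ d]) (auto simp: I_def)
    then have "V u t \<bullet> U u t = V u 0 \<bullet> U u 0" using I0 t by metis
    also have "\<dots> = 0" unfolding V0 L.inner_normal_eq Upol[OF I0(1)] \<theta>_init
      using inner_commute[of "rot90 (edir (\<theta>0 u))" "edir (\<theta>0 u)"] by simp
    finally show ?thesis by (simp add: Upol[OF t])
  qed
  define \<sigma> where "\<sigma> u t = V u t \<bullet> N u t" for u t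
  have V_eq: "V u t = \<sigma> u t *\<^sub>R N u t" if "t \<in> I" for u t
    using real2_frame[of "V u t" "\<theta> u t"] VE[OF that] by (simp add: \<sigma>_def N_def)
  define \<sigma>' where "\<sigma>' u t = Vu u t \<bullet> N u t" for u t
  have \<sigma>_u: "((\<lambda>x. \<sigma> x t) has_real_derivative \<sigma>' u t) (at u)" if t: "t \<in> I" for u t
    using has_real_derivative_inner[OF dV(1)[OF t] N_u[OF t], of u] VE[OF t]
    unfolding \<sigma>_def \<sigma>'_def by (simp add: inner_commute)
  have VuE: "Vu u t \<bullet> edir (\<theta> u t) = - (\<sigma> u t * \<theta>' u t)" if t: "t \<in> I" for u t
  proof -
    have "((\<lambda>x. V x t \<bullet> edir (\<theta> x t)) has_real_derivative V u t \<bullet> (\<theta>' u t *\<^sub>R N u t) + Vu u t \<bullet> edir (\<theta> u t)) (at u)"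
      by (rule has_real_derivative_inner[OF dV(1)[OF t] E_u[OF t]])
    moreover have "(\<lambda>x. V x t \<bullet> edir (\<theta> x t)) = (\<lambda>x. 0)" using VE[OF t] by auto
    ultimately have "V u t \<bullet> (\<theta>' u t *\<^sub>R N u t) + Vu u t \<bullet> edir (\<theta> u t) = 0"
      using DERIV_unique[OF _ DERIV_const] by metis
    then show ?thesis by (simp add: \<sigma>_def mult.commute)
  qed
  define g where "g u t = lv u t + (\<sigma> u t)\<^sup>2 / 2" for u t
  define g' where "g' u t = l' u t + \<sigma> u t * \<sigma>' u t" for u t
  have slow: "exp ((\<sigma> u t)\<^sup>2 / 2 - g u t) = exp (- lv u t)" for u t by (simp add: g_def)
  have half_sq: "((\<lambda>x. h x + (q x)\<^sup>2 / 2) has_real_derivative h' + q x * q') (at x within A)"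
    if "(h has_real_derivative h') (at x within A)" "(q has_real_derivative q') (at x within A)" for h h' q q' x and A :: "real set"
    by (rule derivative_eq_intros that refl | simp)+
  have \<sigma>_t: "((\<lambda>\<tau>. \<sigma> u \<tau>) has_real_derivative \<theta>' u t * exp (- lv u t) + c t * (G u t \<bullet> N u t)) (at t within I)" if t: "t \<in> I" for u t
  proof -
    have "Vt u t \<bullet> N u t = \<theta>' u t * exp (- lv u t) + c t * (G u t \<bullet> N u t)"
      unfolding Vt_eq[OF t] by (simp add: inner_diff_left inner_add_left EN exp_minus divide_inverse)
    then show ?thesis
      using has_real_derivative_inner[OF dV(2)[OF t, of u] N_t[OF t, of u]] VE[OF t, of u] unfolding \<sigma>_def by simp
  qed
  have g_t: "((\<lambda>\<tau>. g u \<tau>) has_real_derivative c t * (\<sigma> u t * (G u t \<bullet> N u t))) (at t within I)" if t: "t \<in> I" for u t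
    using half_sq[OF dt(1)[OF t, of u] \<sigma>_t[OF t, of u]] unfolding g_def VuE[OF t] by (simp add: algebra_simps)
  have g_u: "((\<lambda>x. g x t) has_real_derivative g' u t) (at u)" if t: "t \<in> I" for u t
    unfolding g_def g'_def by (rule half_sq[OF du(1)[OF t] \<sigma>_u[OF t]])
  have Uper: "U (u + 2 * pi) t = U u t" if t: "t \<in> I" for u t
    by (rule periodic_vector_derivative[of "\<lambda>x. G x t" "\<lambda>x. U x t", OF dG(1)[OF t] per[OF t]])
  have Vper: "V (u + 2 * pi) t = V u t" if t: "t \<in> I" for u t
    using vector_derivative_Ico(2)[of t T "G u" "V u t" "G (u + 2 * pi)"] dG(2)[OF t, of u] per t
    unfolding V_def deriv_t_def I_def by simp
  have lvper: "lv (u + 2 * pi) t = lv u t" if t: "t \<in> I" for u t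
    using arg_cong[OF Uper[OF t, of u], of norm] unfolding Upol[OF t] by simp
  have Eper: "edir (\<theta> (u + 2 * pi) t) = edir (\<theta> u t)" if t: "t \<in> I" for u t
    using Uper[OF t, of u] unfolding Upol[OF t] lvper[OF t] by simp
  have \<theta>per: "\<theta> (u + 2 * pi) t = \<theta> u t + 2 * pi * s" if t: "t \<in> I" for u t
  proof -
    have "\<theta> (u + 2 * pi) t - \<theta> u t = \<theta> (u + 2 * pi) 0 - \<theta> u 0"
    proof (rule constant_if_cos_eq_1[of I "\<lambda>t. \<theta> (u + 2 * pi) t - \<theta> u t"])
      show "continuous_on I (\<lambda>t. \<theta> (u + 2 * pi) t - \<theta> u t)" by (intro continuous_intros \<theta>_slice(2)[OF t])
      show "cos (\<theta> (u + 2 * pi) x - \<theta> u x) = 1" if "x \<in> I" for x using Eper[OF that] edir_eq_iff_cos by blast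
    qed (use t I0 in \<open>auto simp: I_def\<close>)
    then show ?thesis by (simp add: \<theta>_init L.turn)
  qed
  have \<sigma>per: "\<sigma> (u + 2 * pi) t = \<sigma> u t" if t: "t \<in> I" for u t
    by (simp add: \<sigma>_def N_def Vper[OF t] Eper[OF t])
  have sub: "{0..t1} \<subseteq> I" using t1 by (auto simp: I_def)
  have sub2: "UNIV \<times> {0..t1} \<subseteq> S" using sub by (auto simp: S_def)
  have N_cont: "continuous_on S (\<lambda>(u, t). N u t)"
    unfolding N_def case_prod_beta using \<theta>_cont[unfolded case_prod_beta]
    by (intro continuous_on_rot90 continuous_on_edir)
  have E_cont: "continuous_on S (\<lambda>(u, t). edir (\<theta> u t))"
    unfolding case_prod_beta using \<theta>_cont[unfolded case_prod_beta] by (intro continuous_on_edir)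
  have conts: "continuous_on S (\<lambda>x. U (fst x) (snd x))" "continuous_on S (\<lambda>x. V (fst x) (snd x))"
    "continuous_on S (\<lambda>x. Uu (fst x) (snd x))" "continuous_on S (\<lambda>x. Vu (fst x) (snd x))"
    "continuous_on S (\<lambda>x. lv (fst x) (snd x))" "continuous_on S (\<lambda>x. \<theta> (fst x) (snd x))"
    "continuous_on S (\<lambda>x. N (fst x) (snd x))" "continuous_on S (\<lambda>x. edir (\<theta> (fst x) (snd x)))"
    using dG(3,4) dU(3) dV(3) lv_cont \<theta>_cont N_cont E_cont unfolding S_def case_prod_beta by auto
  \<comment> \<open>\<open>C2_family\<close> speaks of continuity of the derivatives only. Joint
    continuity of \<open>G\<close> follows from a bound on \<open>U\<close>, obtained on one period
    and extended to the strip by periodicity.\<close>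
  have G_cont: "continuous_on (UNIV \<times> {0..t1}) (\<lambda>(u, t). G u t)"
  proof -
    have "compact ({0..2 * pi} \<times> {0..t1})" by (intro compact_Times compact_Icc)
    moreover have "continuous_on ({0..2 * pi} \<times> {0..t1}) (\<lambda>x. U (fst x) (snd x))"
      by (rule continuous_on_subset[OF conts(1)]) (use sub in \<open>auto simp: S_def\<close>)
    ultimately have "bounded ((\<lambda>x. U (fst x) (snd x)) ` ({0..2 * pi} \<times> {0..t1}))"
      using compact_continuous_image compact_imp_bounded by blast
    then obtain B where B: "\<And>u t. u \<in> {0..2 * pi} \<Longrightarrow> t \<in> {0..t1} \<Longrightarrow> norm (U u t) \<le> B"
      unfolding bounded_iff by fastforce
    have B': "norm (U u t) \<le> B" if t: "t \<in> {0..t1}" for u t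
    proof -
      obtain n :: int where n: "u + of_int n * (2 * pi) \<in> {0..<2 * pi}" using periodic_reduce[of "2 * pi" u] by auto
      then have "norm (U (u + of_int n * (2 * pi)) t) \<le> B" using t by (intro B) auto
      then show ?thesis using periodic_int_multiple[of "\<lambda>u. U u t" "2 * pi" u n] Uper t sub by auto
    qed
    show ?thesis
    proof (rule continuous_on_Lipschitz_fst[where B = B])
      fix u show "continuous_on {0..t1} (G u)"
        by (rule continuous_on_subset[OF _ sub])
          (use dG(2) in \<open>auto simp: continuous_on_eq_continuous_within intro: has_vector_derivative_continuous\<close>)
    next
      fix u w t assume t: "t \<in> {0..t1}"
      then have tI: "t \<in> I" using sub by auto
      have "norm (G u t - G w t) \<le> B * norm (u - w)"
        by (rule differentiable_bound[where S = UNIV and f = "\<lambda>x. G x t" and f' = "\<lambda>x h. h *\<^sub>R U x t"])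
          (use dG(1)[OF tI] B'[OF t] in \<open>auto simp: has_vector_derivative_def mult.commute[of B] intro!: onorm_le mult_left_mono\<close>)
      then show "norm (G u t - G w t) \<le> B * \<bar>u - w\<bar>" by simp
    qed
  qed
  have "frame_flow s t1 c \<sigma> \<theta> g \<sigma>' \<theta>' g' G U"
  proof
    fix u t assume "t \<in> {0..t1}"
    then have t: "t \<in> I" using sub by auto
    show "((\<lambda>x. \<sigma> x t) has_real_derivative \<sigma>' u t) (at u)" "((\<lambda>x. \<theta> x t) has_real_derivative \<theta>' u t) (at u)"
      "((\<lambda>x. g x t) has_real_derivative g' u t) (at u)" "((\<lambda>x. G x t) has_vector_derivative U u t) (at u)"
      by (rule \<sigma>_u[OF t] du(2)[OF t] g_u[OF t] dG(1)[OF t])+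
    show "((\<lambda>\<tau>. \<sigma> u \<tau>) has_real_derivative \<theta>' u t * exp ((\<sigma> u t)\<^sup>2 / 2 - g u t) + c t * (G u t \<bullet> rot90 (edir (\<theta> u t)))) (at t within {0..t1})"
      using has_field_derivative_subset[OF \<sigma>_t[OF t] sub] unfolding slow N_def .
    show "((\<lambda>\<tau>. \<theta> u \<tau>) has_real_derivative \<sigma>' u t * exp ((\<sigma> u t)\<^sup>2 / 2 - g u t)) (at t within {0..t1})"
      using has_field_derivative_subset[OF dt(2)[OF t] sub] unfolding slow \<sigma>'_def by (simp add: mult.commute)
    show "((\<lambda>\<tau>. g u \<tau>) has_real_derivative c t * (\<sigma> u t * (G u t \<bullet> rot90 (edir (\<theta> u t))))) (at t within {0..t1})"
      using has_field_derivative_subset[OF g_t[OF t] sub] unfolding N_def .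
    show "((\<lambda>\<tau>. G u \<tau>) has_vector_derivative \<sigma> u t *\<^sub>R rot90 (edir (\<theta> u t))) (at t within {0..t1})"
      using has_vector_derivative_within_subset[OF dG(2)[OF t, of u] sub] V_eq[OF t, of u] by (simp add: N_def)
    show "\<sigma> (u + 2 * pi) t = \<sigma> u t" "\<theta> (u + 2 * pi) t = \<theta> u t + 2 * pi * s" "g (u + 2 * pi) t = g u t" "G (u + 2 * pi) t = G u t"
      by (simp_all add: \<sigma>per[OF t] \<theta>per[OF t] g_def lvper[OF t] per[OF t])
  next
    show "continuous_on (UNIV \<times> {0..t1}) (\<lambda>(u, t). \<sigma> u t)" "continuous_on (UNIV \<times> {0..t1}) (\<lambda>(u, t). \<theta> u t)"
      "continuous_on (UNIV \<times> {0..t1}) (\<lambda>(u, t). g u t)"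
      "continuous_on (UNIV \<times> {0..t1}) (\<lambda>(u, t). \<sigma>' u t)" "continuous_on (UNIV \<times> {0..t1}) (\<lambda>(u, t). \<theta>' u t)"
      "continuous_on (UNIV \<times> {0..t1}) (\<lambda>(u, t). g' u t)" "continuous_on (UNIV \<times> {0..t1}) (\<lambda>(u, t). U u t)"
      unfolding case_prod_beta \<sigma>_def g_def \<sigma>'_def \<theta>'_def g'_def l'_def
      by (rule continuous_on_subset[OF _ sub2], (intro continuous_intros conts; simp)?)+
  qed (rule G_cont L.s)+
  moreover have "\<sigma> u 0 = s * f u \<and> \<theta> u 0 = \<theta>0 u \<and> g u 0 = l0 u + (s * f u)\<^sup>2 / 2 \<and> G u 0 = F0 u" for u
  proof -
    have "\<sigma> u 0 = s * f u" by (simp add: \<sigma>_def V0 L.inner_normal_eq N_def \<theta>_init)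
    then show ?thesis by (simp add: \<theta>_init g_def lv_def l_init G0)
  qed
  ultimately show ?thesis by blast
qed

text \<open>Uniform continuity on one period keeps \<theta>' close to its initial values, whose
  minimum in absolute value is positive.\<close>

lemma (in frame_flow) angle_derivative_pos:
  assumes T: "0 < T" and pos: "\<And>u. 0 < s * \<theta>' u 0"
  shows "\<exists>T1>0. T1 \<le> T \<and> (\<forall>t\<in>{0..<T1}. \<forall>u. 0 < s * \<theta>' u t)"
proof -
  define h where "h x = s * \<theta>' (fst x) (snd x)" for x
  let ?K = "{0..2 * pi} \<times> {0..T}"
  have "continuous_on ?K h" unfolding h_def
    by (intro continuous_intros continuous_on_subset[OF cont'(2)[unfolded case_prod_beta]]) auto
  moreover have "compact ?K" by (intro compact_Times compact_Icc)
  ultimately have uc: "uniformly_continuous_on ?K h" by (rule compact_uniformly_continuous)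
  have "continuous_on {0..2 * pi} (\<lambda>u. h (u, 0))"
    by (rule continuous_on_compose2[OF \<open>continuous_on ?K h\<close>]) (use T in \<open>auto intro!: continuous_intros\<close>)
  then obtain u0 where u0: "\<And>u. u \<in> {0..2 * pi} \<Longrightarrow> h (u0, 0) \<le> h (u, 0)"
    using continuous_attains_inf[of "{0..2 * pi}" "\<lambda>u. h (u, 0)"] by fastforce
  have m: "0 < h (u0, 0)" using pos by (simp add: h_def)
  from uc m obtain d where d: "0 < d" "\<And>x y. x \<in> ?K \<Longrightarrow> y \<in> ?K \<Longrightarrow> dist y x < d \<Longrightarrow> dist (h y) (h x) < h (u0, 0)"
    unfolding uniformly_continuous_on_def by meson
  show ?thesis
  proof (intro exI[of _ "min d T"] conjI ballI allI)
    fix t u assume t: "t \<in> {0..<min d T}"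
    obtain n :: int where n: "u + of_int n * (2 * pi) \<in> {0..<2 * pi}" using periodic_reduce[of "2 * pi" u] by auto
    let ?w = "u + of_int n * (2 * pi)"
    have "dist (?w, t) (?w, 0) < d" using t by (simp add: dist_Pair_Pair dist_real_def)
    then have "dist (h (?w, t)) (h (?w, 0)) < h (u0, 0)" using n t T by (intro d) auto
    moreover have "h (u0, 0) \<le> h (?w, 0)" using n by (intro u0) auto
    ultimately have "0 < h (?w, t)" by (auto simp: dist_real_def abs_if split: if_splits)
    moreover have "\<theta>' ?w t = \<theta>' u t"
    proof -
      have tT: "t \<in> {0..T}" using t by auto
      have "\<theta>' (x + 2 * pi) t = \<theta>' x t" for x
      proof -
        have "\<theta>' (x + 2 * pi) t - s = \<theta>' x t - s"
        proof (rule periodic_vector_derivative[where g = "\<lambda>x. \<theta> x t - s * x" and g' = "\<lambda>x. \<theta>' x t - s"])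
          fix u
          have "((\<lambda>x. \<theta> x t - s * x) has_real_derivative \<theta>' u t - s) (at u)"
            by (auto intro!: derivative_eq_intros space(2)[OF tT])
          then show "((\<lambda>x. \<theta> x t - s * x) has_vector_derivative \<theta>' u t - s) (at u)"
            by (simp add: has_real_derivative_iff_has_vector_derivative)
          show "\<theta> (u + 2 * pi) t - s * (u + 2 * pi) = \<theta> u t - s * u" using per(2)[OF tT, of u] by (simp add: algebra_simps)
        qed
        then show ?thesis by simp
      qed
      then show ?thesis by (rule periodic_int_multiple[of "\<lambda>x. \<theta>' x t"])
    qed
    ultimately show "0 < s * \<theta>' u t" by (simp add: h_def)
  qed (use d T in auto)
qed

theorem theorem1p1:
  fixes F\<^sub>0 :: "real \<Rightarrow> real^2" and f c :: "real \<Rightarrow> real" and T :: ereal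
  assumes "0 < T"
    and "strictly_convex_closed_curve F\<^sub>0"
    and "smooth_on_circle f"
    and "continuous_on {t. 0 \<le> t \<and> ereal t < T} c"
    and "bounded (c ` {t. 0 \<le> t \<and> ereal t < T})"
  shows "\<exists>T\<^sub>1>0. ereal T\<^sub>1 \<le> T \<and>
    (\<exists>F. (\<forall>t\<in>{0..<T\<^sub>1}. strictly_convex_closed_curve (\<lambda>u. F u t)) \<and>
         solves_ivp c F\<^sub>0 f T\<^sub>1 F \<and>
         (\<forall>G. solves_ivp c F\<^sub>0 f T\<^sub>1 G \<longrightarrow> (\<forall>u. \<forall>t\<in>{0..<T\<^sub>1}. G u t = F u t)))"
proof -
  \<comment> \<open>\<open>T\<close> may be infinite, and \<open>c\<close> is given on a half-open
    interval; a finite T0 below \<open>T\<close> provides a compact one.\<close>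
  obtain T0 where T0: "0 < T0" "ereal T0 < T"
    using ereal_dense2[OF assms(1)] by (metis ereal_less(2) less_ereal.simps(1) zero_ereal_def)
  have sub: "{0..T0} \<subseteq> {t. 0 \<le> t \<and> ereal t < T}" using T0 by (auto simp: le_less_trans[OF _ T0(2)])
  have c: "continuous_on {0..T0} c" by (rule continuous_on_subset[OF assms(4) sub])
  obtain l0 \<theta>0 \<kappa>0 s where L: "oriented_loop F\<^sub>0 (\<lambda>u. exp (l0 u)) \<theta>0 \<kappa>0 s"
    and bs: "bsmooth l0" "bsmooth (\<lambda>u. \<theta>0 u - s * u)" "bsmooth (\<lambda>u. F\<^sub>0 u $ 1)" "bsmooth (\<lambda>u. F\<^sub>0 u $ 2)"
    and l0: "\<And>u. l0 (u + 2 * pi) = l0 u"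
    using initial_curve[OF assms(2)] by blast
  interpret L: oriented_loop F\<^sub>0 "\<lambda>u. exp (l0 u)" \<theta>0 \<kappa>0 s by (rule L)
  have bf: "bsmooth f" by (rule smooth_on_circle_bsmooth[OF assms(3)])
  have perf: "f (u + 2 * pi) = f u" for u using smooth_on_circle_sequence(2)[OF assms(3), of 0 u] by simp
  have b1: "bsmooth (\<lambda>u. s * f u)" by (intro bsmooth_mult bsmooth_const bf)
  have b2: "bsmooth (\<lambda>u. l0 u + (s * f u)\<^sup>2 / 2)"
  proof -
    have "bsmooth (\<lambda>u. l0 u + (s * f u) * (s * f u) * (1 / 2))" by (intro bsmooth_add bsmooth_mult bsmooth_const bs bf)
    then show ?thesis by (simp add: power2_eq_square)
  qed
  have b3: "bsmooth (\<lambda>u. F\<^sub>0 u $ i)" for i using bs(3,4) exhaust_2[of i] by auto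
  obtain T2 \<sigma> \<theta> g \<sigma>' \<theta>' g' P P' where T2: "0 < T2" "T2 \<le> T0"
    and ff: "frame_flow s T2 c \<sigma> \<theta> g \<sigma>' \<theta>' g' P P'"
    and init: "\<And>u. \<sigma> u 0 = s * f u \<and> \<theta> u 0 = \<theta>0 u \<and> g u 0 = l0 u + (s * f u)\<^sup>2 / 2 \<and> P u 0 = F\<^sub>0 u"
    and sm: "\<And>t n i. t \<in> {0..T2} \<Longrightarrow> \<exists>e M. dbound n e M (\<lambda>u. P u t $ i)"
    using frame_flow_exists[OF L.s T0(1) c b1 bs(2) b2 b3] perf L.turn l0 L.per by metis
  interpret A: frame_flow s T2 c \<sigma> \<theta> g \<sigma>' \<theta>' g' P P' by (rule ff)
  have "\<theta>' u 0 = \<kappa>0 u" for u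
    using A.space(2)[of 0 u] T2 init L.\<kappa>(1)[of u] DERIV_unique by fastforce
  then have "0 < s * \<theta>' u 0" for u using L.\<kappa>(2) by simp
  \<comment> \<open>The life span is shortened once more, so that the tangent angle stays strictly
    monotone and the curves stay strictly convex.\<close>
  from A.angle_derivative_pos[OF T2(1) this] obtain T1 where T1: "0 < T1" "T1 \<le> T2"
    and pos: "\<And>t u. t \<in> {0..<T1} \<Longrightarrow> 0 < s * \<theta>' u t" by blast
  have ffT1: "frame_flow s T1 c \<sigma> \<theta> g \<sigma>' \<theta>' g' P P'" by (rule A.restrict[OF T1(2)])
  interpret B: normal_flow s T1 c \<sigma> \<theta> g \<sigma>' \<theta>' g' P P'
  proof (intro normal_flow.intro ffT1, unfold_locales)
    show "0 < T1" by (rule T1)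
    show "continuous_on {0..T1} c" by (rule continuous_on_subset[OF c]) (use T1 T2 in auto)
    show "((\<lambda>x. P x 0) has_vector_derivative exp (g u 0 - (\<sigma> u 0)\<^sup>2 / 2) *\<^sub>R edir (\<theta> u 0)) (at u)" for u
      using L.der[of u] init by simp
  qed
  have "strictly_convex_closed_curve (\<lambda>u. P u t)" if t: "t \<in> {0..<T1}" for t
  proof -
    interpret O: oriented_loop "\<lambda>u. P u t" "\<lambda>u. B.v u t" "\<lambda>u. \<theta> u t" "\<lambda>u. \<theta>' u t" s
      by (rule B.loop[OF t pos[OF t]])
    have "smooth (\<lambda>u. P u t)"
    proof (rule smooth_if_sequence)
      define D :: "nat \<Rightarrow> real \<Rightarrow> real^2" where "D n u = (deriv ^^ n) (\<lambda>u. P u t $ 1) u *\<^sub>R axis 1 1 + (deriv ^^ n) (\<lambda>u. P u t $ 2) u *\<^sub>R axis 2 (1::real)" for n u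
      have t2: "t \<in> {0..T2}" using t T1 by auto
      show "(D n has_vector_derivative D (Suc n) u) (at u)" for n u
      proof -
        have "((\<lambda>u. (deriv ^^ n) (\<lambda>u. P u t $ i) u *\<^sub>R a) has_vector_derivative (deriv ^^ Suc n) (\<lambda>u. P u t $ i) u *\<^sub>R a) (at u)"
          for i and a :: "real^2"
          using has_vector_derivative_scaleR[OF deriv_sequence[OF sm[OF t2]] has_vector_derivative_const, where g2 = a]
          by (simp del: funpow.simps)
        then show ?thesis unfolding D_def[abs_def] by (intro has_vector_derivative_add)
      qed
      show "D 0 = (\<lambda>u. P u t)" by (simp add: D_def fun_eq_iff vec2_eq_iff axis_def)
    qed
    then show ?thesis unfolding strictly_convex_closed_curve_def smooth_on_circle_def
      using O.regular O.inj_on_period O.curvature_pos O.per by (simp add: periodic_fun_simple_def)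
  qed
  moreover have "solves_ivp c F\<^sub>0 f T1 P"
    unfolding solves_ivp_def Let_def
  proof (intro conjI ballI allI)
    show "C2_family {0..<T1} P" unfolding C2_family_def using B.P_family(1) B.Pu_family B.Pt_family(1) by simp
    show "periodic_fun_simple (\<lambda>u. P u t) (2 * pi)" "regular (\<lambda>u. P u t)" if t: "t \<in> {0..<T1}" for t
      using oriented_loop.regular[OF B.loop[OF t pos[OF t]]] B.per(4)[OF B.in_Icc[OF t]] by (simp_all add: periodic_fun_simple_def)
    show "deriv_t {0..<T1} (deriv_t {0..<T1} P) u t = curvature (\<lambda>x. P x t) u *\<^sub>R inner_normal (\<lambda>x. P x t) u
       - grad_rho {0..<T1} c P u t + c t *\<^sub>R P u t" if "t \<in> {0..<T1}" for u t by (rule B.equation[OF that])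
    show "P u 0 = F\<^sub>0 u" for u using init by simp
    show "deriv_t {0..<T1} P u 0 = f u *\<^sub>R inner_normal F\<^sub>0 u" for u
      using B.P_family(3)[of 0 u] T1 init[of u] by (simp add: L.inner_normal_eq mult.commute)
  qed
  \<comment> \<open>For each \<open>t\<close> the two flows are compared on the compact interval
    {0..t}, on which the maximum is attained.\<close>
  moreover have "G u t = P u t" if G: "solves_ivp c F\<^sub>0 f T1 G" and t: "t \<in> {0..<T1}" for G u t
  proof -
    obtain \<sigma>2 \<theta>2 g2 \<sigma>2' \<theta>2' g2' G' where G2: "frame_flow s t c \<sigma>2 \<theta>2 g2 \<sigma>2' \<theta>2' g2' G G'"
      "\<And>u. \<sigma>2 u 0 = s * f u \<and> \<theta>2 u 0 = \<theta>0 u \<and> g2 u 0 = l0 u + (s * f u)\<^sup>2 / 2 \<and> G u 0 = F\<^sub>0 u"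
      using solution_frame_flow[OF G _ _ L, of t] t by auto
    have PP: "frame_flow s t c \<sigma> \<theta> g \<sigma>' \<theta>' g' P P'" by (rule A.restrict) (use t T1 in auto)
    obtain c0 where c0: "\<And>\<tau>. \<tau> \<in> {0..t} \<Longrightarrow> \<bar>c \<tau>\<bar> \<le> c0"
    proof -
      have "bounded (c ` {0..T0})" by (intro compact_imp_bounded compact_continuous_image c compact_Icc)
      then obtain c0 where "\<And>\<tau>. \<tau> \<in> {0..T0} \<Longrightarrow> \<bar>c \<tau>\<bar> \<le> c0" unfolding bounded_iff by (auto simp del: atLeastAtMost_iff)
      then show ?thesis using that[of c0] t T1 T2 by auto
    qed
    show ?thesis by (rule frame_flow_unique[OF G2(1) PP _ _ _ _ c0]) (use G2(2) init t in auto)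
  qed
  moreover have "ereal T1 \<le> T" using T1 T2 T0 by (meson ereal_less_eq(3) less_imp_le order_trans)
  ultimately show ?thesis using T1(1) by blast
qed

end
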